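(* Let $\mathcal M$ be the collection of all triples $(H,(\cdot,\cdot),\mathfrak t[\cdot,\cdot])$ where $(H,(\cdot,\cdot))$ is a Hilbert space and $\mathfrak t[\cdot,\cdot]$ is a closed symmetric form in this space with gap point $0$. Let $\mathcal N$ be the collection of all triples $(K,[\cdot,\cdot],A)$ where $(K,[\cdot,\cdot])$ is a Krein space and $A$ is a J-non-negative, J-self-adjoint and boundedly invertible operator in this space. Triples in $\mathcal M$, respectively in $\mathcal N$, are identified up to the isomorphisms described in the context, so that elements of $\mathcal M$ and $\mathcal N$ are understood as equivalence classes. Then the mapping $\Phi:\mathcal M\to\mathcal N$ given by the rule $$K:=\operatorname{dom}\mathfrak t,\qquad [\cdot,\cdot]:=\mathfrak t[\cdot,\cdot],\qquad A:=A_{\mathfrak t}$$ (with the range restriction $A_{\mathfrak t}$ of the representing operator of $\mathfrak t$) is (well defined and) bijective. Its inverse $\Phi^{-1}$ is given by the rule $$H:=K_-,\qquad (\cdot,\cdot):=\{\cdot,\cdot\}_-,\qquad \operatorname{dom}\mathfrak t:=K,\qquad \mathfrak t[\cdot,\cdot]:=[\cdot,\cdot],$$ where $(K_-,\{\cdot,\cdot\}_-)$ is the Hilbert space constructed from $(K,[\cdot,\cdot],A)$ as in the context.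
   Context: All spaces are complex; sesquilinear forms are linear in the first argument. Krein spaces. $(K,[\cdot,\cdot])$ is a Krein space if $K=K^+\oplus K^-$ (direct, $[\cdot,\cdot]$-orthogonal; a fundamental decomposition) with $(K^+,[\cdot,\cdot])$ and $(K^-,-[\cdot,\cdot])$ Hilbert spaces. With the projections $P^\pm$ onto $K^\pm$, $J:=P^+-P^-$ is called a fundamental symmetry and $\{\cdot,\cdot\}:=[J\cdot,\cdot]$ is a Hilbert space inner product on $K$; its topology (independent of $J$) is the topology of $K$. A densely defined operator $A$ in $K$ is J-self-adjoint (J-non-negative) if $JA$ is self-adjoint (non-negative) in $(K,\{\cdot,\cdot\})$. "Boundedly invertible" means that the operator has an everywhere defined bounded inverse. Forms. A form is a densely defined symmetric sesquilinear form $\mathfrak t[\cdot,\cdot]$ with domain $\operatorname{dom}\mathfrak t$ in a Hilbert space $(H,(\cdot,\cdot))$. Put $\mathfrak t_\lambda[\cdot,\cdot]:=\mathfrak t[\cdot,\cdot]-\lambda(\cdot,\cdot)$. The form is closed if for some $\lambda\in\mathbb R$ (called a gap point of $\mathfrak t$) $(\operatorname{dom}\mathfrak t,\mathfrak t_\lambda[\cdot,\cdot])$ is a Krein space which is continuously embedded in $(H,(\cdot,\cdot))$. For a closed form there is a unique self-adjoint operator $T_{\mathfrak t}$ in $H$ (the representing operator) with $\operatorname{dom}T_{\mathfrak t}\subset\operatorname{dom}\mathfrak t$ and $\mathfrak t[u,v]=(T_{\mathfrak t}u,v)$ for $u\in\operatorname{dom}T_{\mathfrak t}$, $v\in\operatorname{dom}\mathfrak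 t$; all gap points belong to $\rho(T_{\mathfrak t})$. The range restriction $A_{\mathfrak t}$ is the restriction of $T_{\mathfrak t}$ to $\operatorname{dom}A_{\mathfrak t}:=\{f\in\operatorname{dom}T_{\mathfrak t}: T_{\mathfrak t}f\in\operatorname{dom}\mathfrak t\}$, considered as an operator in the Krein space $\operatorname{dom}\mathfrak t$. Construction of $K_-$. For $(K,[\cdot,\cdot],A)\in\mathcal N$ with fundamental symmetry $J$ and $\{\cdot,\cdot\}=[J\cdot,\cdot]$ let $K_+:=\operatorname{dom}(JA)^{1/2}$ with inner product $\{f,g\}_+:=\{(JA)^{1/2}f,(JA)^{1/2}g\}$; this is a Hilbert space densely and continuously embedded in $K$. Let $K_-$ be the space of all linear functionals on $K_+$ which are continuous with respect to $\{\cdot,\cdot\}_+$, with operations $(\varphi+\psi)(f)=\varphi(f)+\psi(f)$, $(\alpha\cdot\varphi)(f)=\overline\alpha\,\varphi(f)$ and norm $\{\varphi\}_-:=\sup\{|\varphi(f)|: f\in K_+,\ \{f,f\}_+\le1\}$. An element $f\in K$ is identified with the functional $[\cdot,f]$ on $K_+$, so $K\subset K_-$; put $[f,\varphi]:=\varphi(f)$ for $f\in K_+,\varphi\in K_-$. Let $A_-:K_+\to K_-$, $A_-g:=\{\cdot,g\}_+$ (an isometric isomorphism). The inner product on $K_-$ is $\{\varphi,\psi\}_-:=[A_-^{-1}\varphi,\psi]$, which induces the norm $\{\cdot\}_-$. Identifications. $(H_1,(\cdot,\cdot)_1,\mathfrak t_1)$ and $(H_2,(\cdot,\cdot)_2,\mathfrak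 t_2)$ in $\mathcal M$ are identified if there is an isometric Hilbert space isomorphism $\phi:H_1\to H_2$ with $\operatorname{dom}\mathfrak t_2=\phi(\operatorname{dom}\mathfrak t_1)$ and $\mathfrak t_1[f,g]=\mathfrak t_2[\phi(f),\phi(g)]$ for all $f,g\in\operatorname{dom}\mathfrak t_1$. $(K_1,[\cdot,\cdot]_1,A_1)$ and $(K_2,[\cdot,\cdot]_2,A_2)$ in $\mathcal N$ are identified if there is an isometric Krein space isomorphism $\psi:K_1\to K_2$ with $\psi(\operatorname{dom}A_1)=\operatorname{dom}A_2$ and $A_1=\psi^{-1}A_2\psi$. *)

theory Defs
  imports
    "HOL-Analysis.Analysis"
    "HOL-Library.Nonpos_Ints"
    "HOL-Algebra.AbelCoset"
    "HOL-Algebra.Module"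
    "HOL-Decision_Procs.Algebra_Aux"
begin

text \<open>Spaces are carried by subsets of a type, because the space of functionals \<open>K\<^sub>-\<close> below
  needs its own (conjugate) scalar multiplication. The ring fields \<open>mult\<close> and \<open>one\<close>, which the
  HOL-Algebra module record inherits, are never used. Values of \<open>form\<close> outside the carrier are
  irrelevant.\<close>

record 'a form_space = "(complex, 'a) module" +
  form :: "'a \<Rightarrow> 'a \<Rightarrow> complex"

abbreviation complex_vector_space :: "'a form_space \<Rightarrow> bool" where
  "complex_vector_space X \<equiv> Module.module cring_class_ops X"

abbreviation linear_subspace :: "'a set \<Rightarrow> 'a form_space \<Rightarrow> bool" where
  "linear_subspace D X \<equiv> Module.submodule D (cring_class_ops :: complex ring) X"

definition hermitian_space :: "'a form_space \<Rightarrow> bool" where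
  "hermitian_space X \<longleftrightarrow> complex_vector_space X \<and>
     (\<forall>x\<in>carrier X. \<forall>y\<in>carrier X. \<forall>z\<in>carrier X.
        form X (x \<oplus>\<^bsub>X\<^esub> y) z = form X x z + form X y z) \<and>
     (\<forall>a. \<forall>x\<in>carrier X. \<forall>y\<in>carrier X. form X (a \<odot>\<^bsub>X\<^esub> x) y = a * form X x y) \<and>
     (\<forall>x\<in>carrier X. \<forall>y\<in>carrier X. form X y x = cnj (form X x y))"

definition form_norm :: "'a form_space \<Rightarrow> 'a \<Rightarrow> real" where
  "form_norm X x = sqrt (Re (form X x x))"

text \<open>The locale \<^term>\<open>Metric_space\<close> requires nonnegativity and symmetry of the distance on the
  whole type, hence the value 0 outside the carrier.\<close>

definition form_dist :: "'a form_space \<Rightarrow> 'a \<Rightarrow> 'a \<Rightarrow> real" where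
  "form_dist X x y =
     (if x \<in> carrier X \<and> y \<in> carrier X then form_norm X (x \<ominus>\<^bsub>X\<^esub> y) else 0)"

definition norm_topology :: "'a form_space \<Rightarrow> 'a topology" where
  "norm_topology X = Metric_space.mtopology (carrier X) (form_dist X)"

definition hilbert_space :: "'a form_space \<Rightarrow> bool" where
  "hilbert_space X \<longleftrightarrow> hermitian_space X \<and>
     (\<forall>x\<in>carrier X. form X x x \<in> \<real>\<^sub>\<ge>\<^sub>0) \<and>
     (\<forall>x\<in>carrier X. form X x x = 0 \<longrightarrow> x = \<zero>\<^bsub>X\<^esub>) \<and>
     Metric_space.mcomplete (carrier X) (form_dist X)"


section \<open>Krein spaces\<close>

definition fundamental_decomposition :: "'a form_space \<Rightarrow> 'a set \<Rightarrow> 'a set \<Rightarrow> bool" where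
  "fundamental_decomposition K Kp Km \<longleftrightarrow> hermitian_space K \<and>
     linear_subspace Kp K \<and> linear_subspace Km K \<and>
     Kp <+>\<^bsub>K\<^esub> Km = carrier K \<and> Kp \<inter> Km = {\<zero>\<^bsub>K\<^esub>} \<and>
     (\<forall>x\<in>Kp. \<forall>y\<in>Km. form K x y = 0) \<and>
     hilbert_space (K\<lparr>carrier := Kp\<rparr>) \<and>
     hilbert_space (K\<lparr>carrier := Km, form := \<lambda>x y. - form K x y\<rparr>)"

definition krein_space :: "'a form_space \<Rightarrow> bool" where
  "krein_space K \<longleftrightarrow> (\<exists>Kp Km. fundamental_decomposition K Kp Km)"

text \<open>\<open>J = P\<^sup>+ - P\<^sup>-\<close>, where \<open>P\<^sup>+ (x + y) = x\<close> and \<open>P\<^sup>- (x + y) = y\<close> for \<open>x\<close> in \<open>K\<^sup>+\<close>, \<open>y\<close> in \<open>K\<^sup>-\<close>.\<close>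

definition fundamental_symmetry :: "'a form_space \<Rightarrow> ('a \<Rightarrow> 'a) \<Rightarrow> bool" where
  "fundamental_symmetry K J \<longleftrightarrow> (\<exists>Kp Km. fundamental_decomposition K Kp Km \<and>
     (\<forall>x\<in>Kp. \<forall>y\<in>Km. J (x \<oplus>\<^bsub>K\<^esub> y) = x \<ominus>\<^bsub>K\<^esub> y))"

definition J_space :: "'a form_space \<Rightarrow> ('a \<Rightarrow> 'a) \<Rightarrow> 'a form_space" where
  "J_space K J = K\<lparr>form := \<lambda>x y. form K (J x) y\<rparr>"


section \<open>Unbounded operators, represented by their graphs\<close>

definition linear_operator :: "'a form_space \<Rightarrow> ('a \<times> 'a) set \<Rightarrow> bool" where
  "linear_operator X A \<longleftrightarrow> A \<subseteq> carrier X \<times> carrier X \<and> single_valued A \<and>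
     (\<zero>\<^bsub>X\<^esub>, \<zero>\<^bsub>X\<^esub>) \<in> A \<and>
     (\<forall>(x, y)\<in>A. \<forall>(x', y')\<in>A. (x \<oplus>\<^bsub>X\<^esub> x', y \<oplus>\<^bsub>X\<^esub> y') \<in> A) \<and>
     (\<forall>a. \<forall>(x, y)\<in>A. (a \<odot>\<^bsub>X\<^esub> x, a \<odot>\<^bsub>X\<^esub> y) \<in> A)"

definition op_app :: "('a \<times> 'a) set \<Rightarrow> 'a \<Rightarrow> 'a" where
  "op_app A x = (THE y. (x, y) \<in> A)"

definition dense_in :: "'a form_space \<Rightarrow> 'a set \<Rightarrow> bool" where
  "dense_in X D \<longleftrightarrow> D \<subseteq> carrier X \<and> norm_topology X closure_of D = carrier X"

definition adjoint_op :: "'a form_space \<Rightarrow> ('a \<times> 'a) set \<Rightarrow> ('a \<times> 'a) set" where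
  "adjoint_op X A = {(y, z) \<in> carrier X \<times> carrier X. \<forall>(x, w)\<in>A. form X w y = form X x z}"

definition self_adjoint :: "'a form_space \<Rightarrow> ('a \<times> 'a) set \<Rightarrow> bool" where
  "self_adjoint X A \<longleftrightarrow> linear_operator X A \<and> dense_in X (Domain A) \<and> adjoint_op X A = A"

definition nonnegative_op :: "'a form_space \<Rightarrow> ('a \<times> 'a) set \<Rightarrow> bool" where
  "nonnegative_op X A \<longleftrightarrow> (\<forall>(x, w)\<in>A. form X w x \<in> \<real>\<^sub>\<ge>\<^sub>0)"

definition boundedly_invertible :: "'a form_space \<Rightarrow> ('a \<times> 'a) set \<Rightarrow> bool" where
  "boundedly_invertible X A \<longleftrightarrow> single_valued (A\<inverse>) \<and> Domain (A\<inverse>) = carrier X \<and>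
     (\<exists>C. \<forall>(y, x)\<in>A\<inverse>. form_norm X x \<le> C * form_norm X y)"

definition operator_sqrt :: "'a form_space \<Rightarrow> ('a \<times> 'a) set \<Rightarrow> ('a \<times> 'a) set" where
  "operator_sqrt X A = (THE S. self_adjoint X S \<and> nonnegative_op X S \<and> S O S = A)"

definition J_comp :: "('a \<Rightarrow> 'a) \<Rightarrow> ('a \<times> 'a) set \<Rightarrow> ('a \<times> 'a) set" where
  "J_comp J A = {(x, J y) | x y. (x, y) \<in> A}"

definition J_self_adjoint :: "'a form_space \<Rightarrow> ('a \<Rightarrow> 'a) \<Rightarrow> ('a \<times> 'a) set \<Rightarrow> bool" where
  "J_self_adjoint K J A \<longleftrightarrow> linear_operator K A \<and> dense_in (J_space K J) (Domain A) \<and>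
     self_adjoint (J_space K J) (J_comp J A)"

definition J_nonnegative :: "'a form_space \<Rightarrow> ('a \<Rightarrow> 'a) \<Rightarrow> ('a \<times> 'a) set \<Rightarrow> bool" where
  "J_nonnegative K J A \<longleftrightarrow> linear_operator K A \<and> dense_in (J_space K J) (Domain A) \<and>
     nonnegative_op (J_space K J) (J_comp J A)"


section \<open>Closed symmetric forms\<close>

text \<open>The domain of a form with the linear structure of the ambient space and a form on it.\<close>

definition form_domain :: "'a form_space \<Rightarrow> 'a set \<Rightarrow> ('a \<Rightarrow> 'a \<Rightarrow> complex) \<Rightarrow> 'a form_space" where
  "form_domain H D t = H\<lparr>carrier := D, form := t\<rparr>"

definition symmetric_form :: "'a form_space \<Rightarrow> 'a set \<Rightarrow> ('a \<Rightarrow> 'a \<Rightarrow> complex) \<Rightarrow> bool" where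
  "symmetric_form H D t \<longleftrightarrow>
     linear_subspace D H \<and> dense_in H D \<and> hermitian_space (form_domain H D t)"

definition form_shift ::
    "'a form_space \<Rightarrow> ('a \<Rightarrow> 'a \<Rightarrow> complex) \<Rightarrow> real \<Rightarrow> 'a \<Rightarrow> 'a \<Rightarrow> complex" where
  "form_shift H t \<mu> u v = t u v - complex_of_real \<mu> * form H u v"

text \<open>The Krein space topology does not depend on the fundamental symmetry, so in the next
  definition and in \<open>N_class\<close> below it is immaterial which one is used.\<close>

definition gap_point ::
    "'a form_space \<Rightarrow> 'a set \<Rightarrow> ('a \<Rightarrow> 'a \<Rightarrow> complex) \<Rightarrow> real \<Rightarrow> bool" where
  "gap_point H D t \<mu> \<longleftrightarrow>
     (let K = form_domain H D (form_shift H t \<mu>)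
      in krein_space K \<and>
         (\<exists>J. fundamental_symmetry K J \<and>
              continuous_map (norm_topology (J_space K J)) (norm_topology H) id))"

definition closed_form :: "'a form_space \<Rightarrow> 'a set \<Rightarrow> ('a \<Rightarrow> 'a \<Rightarrow> complex) \<Rightarrow> bool" where
  "closed_form H D t \<longleftrightarrow> symmetric_form H D t \<and> (\<exists>\<mu>. gap_point H D t \<mu>)"

definition representing_operator ::
    "'a form_space \<Rightarrow> 'a set \<Rightarrow> ('a \<Rightarrow> 'a \<Rightarrow> complex) \<Rightarrow> ('a \<times> 'a) set" where
  "representing_operator H D t =
     (THE T. self_adjoint H T \<and> Domain T \<subseteq> D \<and> (\<forall>(u, w)\<in>T. \<forall>v\<in>D. t u v = form H w v))"

definition range_restriction ::
    "'a form_space \<Rightarrow> 'a set \<Rightarrow> ('a \<Rightarrow> 'a \<Rightarrow> complex) \<Rightarrow> ('a \<times> 'a) set" where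
  "range_restriction H D t = {(f, g) \<in> representing_operator H D t. g \<in> D}"


section \<open>The space \<open>K\<^sub>-\<close>\<close>

definition K_plus ::
    "('a \<Rightarrow> 'a) \<Rightarrow> 'a form_space \<Rightarrow> ('a \<times> 'a) set \<Rightarrow> 'a form_space" where
  "K_plus J K A =
     (let S = operator_sqrt (J_space K J) (J_comp J A)
      in K\<lparr>carrier := Domain S, form := \<lambda>f g. form (J_space K J) (op_app S f) (op_app S g)\<rparr>)"

definition A_minus ::
    "('a \<Rightarrow> 'a) \<Rightarrow> 'a form_space \<Rightarrow> ('a \<times> 'a) set \<Rightarrow> 'a \<Rightarrow> ('a \<Rightarrow> complex)" where
  "A_minus J K A g =
     (let Kp = K_plus J K A in restrict (\<lambda>f. form Kp f g) (carrier Kp))"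

text \<open>The form is \<open>{\<phi>, \<psi>}\<^sub>- = [A\<^sub>-\<inverse> \<phi>, \<psi>] = \<psi> (A\<^sub>-\<inverse> \<phi>)\<close>.\<close>

definition K_minus ::
    "('a \<Rightarrow> 'a) \<Rightarrow> 'a form_space \<Rightarrow> ('a \<times> 'a) set \<Rightarrow> ('a \<Rightarrow> complex) form_space" where
  "K_minus J K A =
     (let Kp = K_plus J K A in
      \<lparr>carrier = {\<phi> \<in> extensional (carrier Kp).
          (\<forall>f\<in>carrier Kp. \<forall>g\<in>carrier Kp. \<phi> (f \<oplus>\<^bsub>Kp\<^esub> g) = \<phi> f + \<phi> g) \<and>
          (\<forall>a. \<forall>f\<in>carrier Kp. \<phi> (a \<odot>\<^bsub>Kp\<^esub> f) = a * \<phi> f) \<and>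
          continuous_map (norm_topology Kp) euclidean \<phi>},
       mult = undefined, one = undefined,
       zero = restrict (\<lambda>f. 0) (carrier Kp),
       add = (\<lambda>\<phi> \<psi>. restrict (\<lambda>f. \<phi> f + \<psi> f) (carrier Kp)),
       smult = (\<lambda>a \<phi>. restrict (\<lambda>f. cnj a * \<phi> f) (carrier Kp)),
       form = (\<lambda>\<phi> \<psi>. \<psi> (the_inv_into (carrier Kp) (A_minus J K A) \<phi>))\<rparr>)"

text \<open>The identification of \<open>f \<in> K\<close> with the functional \<open>[\<cdot>, f]\<close>.\<close>

definition K_embed ::
    "('a \<Rightarrow> 'a) \<Rightarrow> 'a form_space \<Rightarrow> ('a \<times> 'a) set \<Rightarrow> 'a \<Rightarrow> ('a \<Rightarrow> complex)" where
  "K_embed J K A f = restrict (\<lambda>g. form K g f) (carrier (K_plus J K A))"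


section \<open>The two classes of triples and the mappings between them\<close>

text \<open>A form triple \<open>(H, D, t)\<close> consists of a space with its inner product, the domain of the form
  and the form; a Krein triple \<open>(K, A)\<close> of a space with its indefinite inner product and an
  operator.\<close>

type_synonym 'a form_triple = "'a form_space \<times> 'a set \<times> ('a \<Rightarrow> 'a \<Rightarrow> complex)"
type_synonym 'a krein_triple = "'a form_space \<times> ('a \<times> 'a) set"

definition M_class :: "'a form_triple set" where
  "M_class = {(H, D, t). hilbert_space H \<and> closed_form H D t \<and> gap_point H D t 0}"

definition N_class :: "'a krein_triple set" where
  "N_class = {(K, A). krein_space K \<and>
     (\<exists>J. fundamental_symmetry K J \<and> J_nonnegative K J A \<and> J_self_adjoint K J A \<and>
          boundedly_invertible (J_space K J) A)}"

definition space_iso :: "'a form_space \<Rightarrow> 'b form_space \<Rightarrow> ('a \<Rightarrow> 'b) \<Rightarrow> bool" where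
  "space_iso X Y \<phi> \<longleftrightarrow> bij_betw \<phi> (carrier X) (carrier Y) \<and>
     (\<forall>x\<in>carrier X. \<forall>y\<in>carrier X. \<phi> (x \<oplus>\<^bsub>X\<^esub> y) = \<phi> x \<oplus>\<^bsub>Y\<^esub> \<phi> y) \<and>
     (\<forall>a. \<forall>x\<in>carrier X. \<phi> (a \<odot>\<^bsub>X\<^esub> x) = a \<odot>\<^bsub>Y\<^esub> \<phi> x) \<and>
     (\<forall>x\<in>carrier X. \<forall>y\<in>carrier X. form Y (\<phi> x) (\<phi> y) = form X x y)"

fun M_iso :: "'a form_triple \<Rightarrow> 'b form_triple \<Rightarrow> bool" where
  "M_iso (H\<^sub>1, D\<^sub>1, t\<^sub>1) (H\<^sub>2, D\<^sub>2, t\<^sub>2) \<longleftrightarrow>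
     (\<exists>\<phi>. space_iso H\<^sub>1 H\<^sub>2 \<phi> \<and> D\<^sub>2 = \<phi> ` D\<^sub>1 \<and> (\<forall>f\<in>D\<^sub>1. \<forall>g\<in>D\<^sub>1. t\<^sub>1 f g = t\<^sub>2 (\<phi> f) (\<phi> g)))"

fun N_iso :: "'a krein_triple \<Rightarrow> 'b krein_triple \<Rightarrow> bool" where
  "N_iso (K\<^sub>1, A\<^sub>1) (K\<^sub>2, A\<^sub>2) \<longleftrightarrow>
     (\<exists>\<psi>. space_iso K\<^sub>1 K\<^sub>2 \<psi> \<and> \<psi> ` Domain A\<^sub>1 = Domain A\<^sub>2 \<and>
          A\<^sub>1 = {(x, y) \<in> carrier K\<^sub>1 \<times> carrier K\<^sub>1. (\<psi> x, \<psi> y) \<in> A\<^sub>2})"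

definition M_rel :: "('a form_triple \<times> 'a form_triple) set" where
  "M_rel = {(m\<^sub>1, m\<^sub>2) \<in> M_class \<times> M_class. M_iso m\<^sub>1 m\<^sub>2}"

definition N_rel :: "('a krein_triple \<times> 'a krein_triple) set" where
  "N_rel = {(n\<^sub>1, n\<^sub>2) \<in> N_class \<times> N_class. N_iso n\<^sub>1 n\<^sub>2}"

fun Phi :: "'a form_triple \<Rightarrow> 'a krein_triple" where
  "Phi (H, D, t) = (form_domain H D t, range_restriction H D t)"

definition Phi_class :: "'a form_triple set \<Rightarrow> 'a krein_triple set" where
  "Phi_class C = (\<Union>m\<in>C. N_rel `` {Phi m})"

text \<open>The triple \<open>(K\<^sub>-, K, [\<cdot>, \<cdot>])\<close>, with \<open>K\<close> identified with its image in \<open>K\<^sub>-\<close>. Note the change of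
  the underlying type.\<close>

fun Psi :: "('a \<Rightarrow> 'a) \<Rightarrow> 'a krein_triple \<Rightarrow> ('a \<Rightarrow> complex) form_triple" where
  "Psi J (K, A) =
     (K_minus J K A,
      K_embed J K A ` carrier K,
      (\<lambda>\<phi> \<psi>. form K (the_inv_into (carrier K) (K_embed J K A) \<phi>)
                      (the_inv_into (carrier K) (K_embed J K A) \<psi>)))"

end

theory Submission
  imports Defs
begin

text \<open>Let \<open>t\<close> be a form with gap point \<open>0\<close>, \<open>D\<close> its domain and \<open>A\<close> its range restriction. By the
  definition of the representing operator \<open>(f, g) = t[A\<^sup>-\<^sup>1 f, g]\<close> for all \<open>f, g\<close> in \<open>D\<close>. Since \<open>D\<close> is
  dense in \<open>H\<close>, the Krein space \<open>D\<close> and the operator \<open>A\<close> determine \<open>H\<close> as a completion: an isomorphism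
  of Krein triples is isometric for the Hilbert space inner products as well, and
  \<open>extend_dense_isometry\<close> extends it to an isomorphism of form triples. Thus \<open>\<Phi>\<close> is injective on
  equivalence classes (\<open>N_iso_imp_M_iso\<close>).

  That \<open>\<Phi>\<close> is well defined comes from the Riesz theorem. The functionals \<open>(\<cdot>, w)\<close> are continuous on
  the Krein space \<open>D\<close>, hence of the form \<open>t[\<cdot>, u]\<close>, and \<open>w \<mapsto> u\<close> is an everywhere defined symmetric
  operator whose inverse is the representing operator (\<open>representing_operator_eq\<close>). The class \<open>N\<close> is
  described without a fundamental symmetry: \<open>A\<close> is nonnegative, surjective and equal to its adjoint for
  \<open>[\<cdot>, \<cdot>]\<close> (\<open>N_class_iff\<close>). For any fundamental symmetry \<open>J\<close> the inverse of such an operator is bounded by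
  the Hellinger-Toeplitz theorem.

  For surjectivity let \<open>(K, A)\<close> be in \<open>N\<close>, put \<open>{\<cdot>, \<cdot>} = [J \<cdot>, \<cdot>]\<close> and let \<open>q\<close> be the positive square root
  of the bounded positive operator \<open>(J A)\<^sup>-\<^sup>1\<close>. Then \<open>K\<^sub>+ = ran q\<close>, and on the Hilbert space \<open>(K, {\<cdot>, \<cdot>})\<close>
  the form \<open>t[q x, q y] = [x, y]\<close> with domain \<open>ran q\<close> has gap point \<open>0\<close>. Its image under \<open>\<Phi>\<close> is
  isomorphic to \<open>(K, A)\<close> by \<open>J q\<^sup>-\<^sup>1\<close> (\<open>N_iso_Phi_triple\<close>), and \<open>x \<mapsto> {q\<^sup>-\<^sup>1 \<cdot>, x}\<close> is an isomorphism onto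
  the triple \<open>(K\<^sub>-, K, [\<cdot>, \<cdot>])\<close> (\<open>M_iso_Psi\<close>). The triple on \<open>K\<close> itself is a preimage of \<open>(K, A)\<close> whose
  elements have the same type as those of \<open>K\<close>, while the elements of \<open>K\<^sub>-\<close> are functionals.\<close>

section \<open>Vector spaces on carrier sets\<close>

lemma complex_vector_space_iff:
  fixes X (structure)
  shows "complex_vector_space X \<longleftrightarrow>
    \<zero> \<in> carrier X \<and> (\<forall>x\<in>carrier X. \<forall>y\<in>carrier X. x \<oplus> y \<in> carrier X) \<and>
    (\<forall>a. \<forall>x\<in>carrier X. a \<odot> x \<in> carrier X) \<and>
    (\<forall>x\<in>carrier X. \<forall>y\<in>carrier X. \<forall>z\<in>carrier X. (x \<oplus> y) \<oplus> z = x \<oplus> (y \<oplus> z)) \<and>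
    (\<forall>x\<in>carrier X. \<forall>y\<in>carrier X. x \<oplus> y = y \<oplus> x) \<and>
    (\<forall>x\<in>carrier X. \<zero> \<oplus> x = x) \<and> (\<forall>x\<in>carrier X. (0::complex) \<odot> x = \<zero>) \<and>
    (\<forall>x\<in>carrier X. 1 \<odot> x = x) \<and>
    (\<forall>a b. \<forall>x\<in>carrier X. (a + b) \<odot> x = a \<odot> x \<oplus> b \<odot> x) \<and>
    (\<forall>a. \<forall>x\<in>carrier X. \<forall>y\<in>carrier X. a \<odot> (x \<oplus> y) = a \<odot> x \<oplus> a \<odot> y) \<and>
    (\<forall>a b. \<forall>x\<in>carrier X. (a * b) \<odot> x = a \<odot> (b \<odot> x))" (is "?l = ?r")
proof
  assume ?l
  interpret Module.module cring_class_ops X by fact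
  show ?r
    using smult_l_distr smult_r_distr smult_assoc1 smult_one smult_closed smult_l_null
    by (simp add: carrier_class class_simps) (simp add: M.a_ac)
next
  assume r: ?r
  have "abelian_group X"
  proof (rule abelian_groupI)
    fix x assume x: "x \<in> carrier X"
    have "(-1) \<odot> x \<oplus> 1 \<odot> x = (-1 + 1) \<odot> x" using r x by metis
    then have "(-1) \<odot> x \<oplus> x = \<zero>" using r x by simp
    moreover have "(-1) \<odot> x \<in> carrier X" using r x by simp
    ultimately show "\<exists>y\<in>carrier X. y \<oplus> x = \<zero>" by (rule bexI)
  qed (use r in auto)
  then show ?l
    by (rule Module.moduleI[OF cring_class]) (use r in \<open>auto simp: carrier_class class_simps\<close>)
qed

lemma minus_eq_smult:
  fixes X (structure)
  assumes "complex_vector_space X" "x \<in> carrier X" "y \<in> carrier X"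
  shows "x \<ominus> y = x \<oplus> (-1) \<odot> y"
proof -
  interpret Module.module cring_class_ops X by fact
  have "(-1) \<odot> y = \<ominus> y"
    using smult_l_minus[of 1 y] smult_one[of y] assms by (simp add: carrier_class class_simps)
  then show ?thesis by (simp add: a_minus_def)
qed

lemma linear_subspace_iff:
  fixes X (structure)
  assumes V: "complex_vector_space X"
  shows "linear_subspace D X \<longleftrightarrow> D \<subseteq> carrier X \<and> \<zero> \<in> D \<and>
    (\<forall>x\<in>D. \<forall>y\<in>D. x \<oplus> y \<in> D) \<and> (\<forall>a. \<forall>x\<in>D. a \<odot> x \<in> D)" (is "?l = ?r")
proof
  assume ?l
  then interpret Module.submodule D "cring_class_ops" X .
  show ?r
    using subset one_closed m_closed smult_closed by (auto simp: carrier_class)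
next
  assume r: ?r
  interpret Module.module cring_class_ops X by fact
  show ?l
  proof (rule module.submoduleI[OF V])
    fix a assume a: "a \<in> D"
    then have "a \<in> carrier X" using r by auto
    then have "(-1) \<odot> a = \<ominus> a"
      using smult_l_minus[of 1 a] smult_one[of a] by (simp add: carrier_class class_simps)
    then show "\<ominus> a \<in> D" using r a by metis
  qed (use r in auto)
qed

lemma complex_vector_space_cong:
  assumes "carrier Y = carrier X" "zero Y = zero X" "add Y = add X" "smult Y = smult X"
  shows "complex_vector_space Y \<longleftrightarrow> complex_vector_space X"
  unfolding complex_vector_space_iff assms ..

lemma complex_vector_space_subspace:
  assumes "complex_vector_space X" "linear_subspace D X"
  shows "complex_vector_space (form_domain X D t)"
proof -
  interpret Module.submodule D cring_class_ops X by fact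
  have "Module.module cring_class_ops (X\<lparr>carrier := D\<rparr>)"
    by (rule submodule_is_module[OF assms(1)])
  then show ?thesis
    by (subst complex_vector_space_cong) (simp_all add: form_domain_def)
qed

section \<open>Hermitian forms\<close>

locale hermitian =
  fixes X :: "'a form_space" (structure)
  assumes hermitian: "hermitian_space X"
begin

abbreviation ip :: "'a \<Rightarrow> 'a \<Rightarrow> complex" where "ip x y \<equiv> form X x y"
abbreviation N :: "'a \<Rightarrow> real" where "N x \<equiv> form_norm X x"

lemma vector_space: "complex_vector_space X"
  using hermitian by (simp add: hermitian_space_def)

lemma zero_in [simp, intro]: "\<zero> \<in> carrier X"
  and add_in [simp, intro]: "\<lbrakk>x \<in> carrier X; y \<in> carrier X\<rbrakk> \<Longrightarrow> x \<oplus> y \<in> carrier X"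
  and smult_in [simp, intro]: "x \<in> carrier X \<Longrightarrow> a \<odot> x \<in> carrier X"
  and smult_zero: "x \<in> carrier X \<Longrightarrow> (0::complex) \<odot> x = \<zero>"
  using vector_space[unfolded complex_vector_space_iff] by simp_all

lemma minus_eq: "\<lbrakk>x \<in> carrier X; y \<in> carrier X\<rbrakk> \<Longrightarrow> x \<ominus> y = x \<oplus> (-1) \<odot> y"
  by (rule minus_eq_smult[OF vector_space])

lemma minus_in [simp, intro]: "\<lbrakk>x \<in> carrier X; y \<in> carrier X\<rbrakk> \<Longrightarrow> x \<ominus> y \<in> carrier X"
  by (simp add: minus_eq)

lemma ip_add_left [simp]:
  "\<lbrakk>x \<in> carrier X; y \<in> carrier X; z \<in> carrier X\<rbrakk> \<Longrightarrow> ip (x \<oplus> y) z = ip x z + ip y z"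
  using hermitian unfolding hermitian_space_def by blast

lemma ip_smult_left [simp]:
  "\<lbrakk>x \<in> carrier X; y \<in> carrier X\<rbrakk> \<Longrightarrow> ip (a \<odot> x) y = a * ip x y"
  using hermitian unfolding hermitian_space_def by blast

lemma ip_cnj: "\<lbrakk>x \<in> carrier X; y \<in> carrier X\<rbrakk> \<Longrightarrow> cnj (ip x y) = ip y x"
  using hermitian unfolding hermitian_space_def by (blast intro: sym)

lemma ip_add_right [simp]:
  "\<lbrakk>x \<in> carrier X; y \<in> carrier X; z \<in> carrier X\<rbrakk> \<Longrightarrow> ip z (x \<oplus> y) = ip z x + ip z y"
  using ip_cnj[of "x \<oplus> y" z] by (simp add: ip_cnj)

lemma ip_smult_right [simp]:
  "\<lbrakk>x \<in> carrier X; y \<in> carrier X\<rbrakk> \<Longrightarrow> ip y (a \<odot> x) = cnj a * ip y x"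
  using ip_cnj[of "a \<odot> x" y] by (simp add: ip_cnj)

lemma ip_minus_left [simp]:
  "\<lbrakk>x \<in> carrier X; y \<in> carrier X; z \<in> carrier X\<rbrakk> \<Longrightarrow> ip (x \<ominus> y) z = ip x z - ip y z"
  by (simp add: minus_eq)

lemma ip_minus_right [simp]:
  "\<lbrakk>x \<in> carrier X; y \<in> carrier X; z \<in> carrier X\<rbrakk> \<Longrightarrow> ip z (x \<ominus> y) = ip z x - ip z y"
  by (simp add: minus_eq)

lemma ip_zero_left [simp]: "x \<in> carrier X \<Longrightarrow> ip \<zero> x = 0"
  using ip_smult_left[of \<zero> x 0] by (simp add: smult_zero)

lemma ip_zero_right [simp]: "x \<in> carrier X \<Longrightarrow> ip x \<zero> = 0"
  using ip_smult_right[of \<zero> x 0] by (simp add: smult_zero)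

lemma ip_self: "x \<in> carrier X \<Longrightarrow> ip x x = complex_of_real (Re (ip x x))"
  using ip_cnj[of x x] by (metis complex_is_Real_iff Reals_cnj_iff of_real_Re)

lemma Re_ip_commute: "\<lbrakk>x \<in> carrier X; y \<in> carrier X\<rbrakk> \<Longrightarrow> Re (ip x y) = Re (ip y x)"
  using ip_cnj[of x y] by (metis cnj.sel(1))

text \<open>The semidefinite case covers the form \<open>(P \<cdot>, \<cdot>)\<close> of a nonnegative operator \<open>P\<close>.\<close>

lemma Cauchy_Schwarz_semidefinite:
  assumes pos: "\<And>z. z \<in> carrier X \<Longrightarrow> 0 \<le> Re (ip z z)"
    and x: "x \<in> carrier X" and y: "y \<in> carrier X"
  shows "(cmod (ip x y))\<^sup>2 \<le> Re (ip x x) * Re (ip y y)"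
proof -
  define a where "a = Re (ip x x)"
  define b where "b = Re (ip y y)"
  define c where "c = ip x y"
  \<comment> \<open>The square of \<open>x - s c y\<close>; \<open>s = 1 / b\<close> is optimal if \<open>b > 0\<close>, and a large \<open>s\<close> forces \<open>c = 0\<close> if
    \<open>b = 0\<close>.\<close>
  have key: "0 \<le> a - 2 * s * (cmod c)\<^sup>2 + s\<^sup>2 * (cmod c)\<^sup>2 * b" for s :: real
  proof -
    have yx: "ip y x = cnj c" using x y by (simp add: c_def ip_cnj)
    have cc: "c * cnj c = complex_of_real ((cmod c)\<^sup>2)"
      by (rule complex_norm_square[symmetric])
    let ?z = "x \<ominus> (s * c) \<odot> y"
    have "ip ?z ?z = ip x x - 2 * s * (c * cnj c) + s * s * (c * cnj c) * ip y y"
      using x y by (simp add: yx c_def[symmetric] algebra_simps)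
    also have "\<dots> = complex_of_real (a - 2 * s * (cmod c)\<^sup>2 + s\<^sup>2 * (cmod c)\<^sup>2 * b)"
      by (subst ip_self[OF x], subst ip_self[OF y])
        (simp only: cc a_def b_def power2_eq_square of_real_mult of_real_diff of_real_add of_real_numeral)
    finally have "Re (ip ?z ?z) = a - 2 * s * (cmod c)\<^sup>2 + s\<^sup>2 * (cmod c)\<^sup>2 * b"
      by simp
    then show ?thesis using pos[of ?z] x y by simp
  qed
  have "(cmod c)\<^sup>2 \<le> a * b"
  proof (cases "b = 0")
    case True
    have "c = 0"
    proof (rule ccontr)
      assume "c \<noteq> 0"
      then show False using key[of "(a + 1) / (2 * (cmod c)\<^sup>2)"] True by (simp add: field_simps)
    qed
    then show ?thesis using True by simp
  next
    case False
    then have "b > 0" using pos[OF y] by (simp add: b_def)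
    then show ?thesis using key[of "1 / b"] by (simp add: field_simps power2_eq_square)
  qed
  then show ?thesis by (simp add: a_def b_def c_def)
qed

end

section \<open>Pre-Hilbert spaces\<close>

locale prehilbert = hermitian +
  assumes ip_nonneg: "x \<in> carrier X \<Longrightarrow> form X x x \<in> \<real>\<^sub>\<ge>\<^sub>0"
    and ip_definite: "x \<in> carrier X \<Longrightarrow> form X x x = 0 \<Longrightarrow> x = \<zero>\<^bsub>X\<^esub>"
begin

lemma Re_ip_nonneg [simp]: "x \<in> carrier X \<Longrightarrow> 0 \<le> Re (ip x x)"
  using ip_nonneg[of x] by (simp add: complex_nonneg_Reals_iff)

lemma N_square: "x \<in> carrier X \<Longrightarrow> (N x)\<^sup>2 = Re (ip x x)"
  by (simp add: form_norm_def)

lemma ip_self_N: "x \<in> carrier X \<Longrightarrow> ip x x = complex_of_real ((N x)\<^sup>2)"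
  using ip_self[of x] by (simp add: N_square)

lemma N_nonneg [simp]: "x \<in> carrier X \<Longrightarrow> 0 \<le> N x"
  by (simp add: form_norm_def)

lemma N_zero [simp]: "N \<zero> = 0"
  by (simp add: form_norm_def)

lemma N_eq_0_iff [simp]: "x \<in> carrier X \<Longrightarrow> N x = 0 \<longleftrightarrow> x = \<zero>"
  using ip_self_N[of x] ip_definite[of x] by auto

lemma Cauchy_Schwarz: "\<lbrakk>x \<in> carrier X; y \<in> carrier X\<rbrakk> \<Longrightarrow> cmod (ip x y) \<le> N x * N y"
  using Cauchy_Schwarz_semidefinite[of x y]
  by (intro power2_le_imp_le[of "cmod (ip x y)"]) (simp_all add: power_mult_distrib N_square)

lemma N_smult [simp]: "x \<in> carrier X \<Longrightarrow> N (a \<odot> x) = cmod a * N x"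
proof -
  assume x: "x \<in> carrier X"
  have "ip (a \<odot> x) (a \<odot> x) = complex_of_real ((cmod a)\<^sup>2 * (N x)\<^sup>2)"
    unfolding of_real_mult complex_norm_square using x by (simp add: ip_self_N[OF x])
  then have "(N (a \<odot> x))\<^sup>2 = (cmod a * N x)\<^sup>2"
    using x by (simp add: N_square power_mult_distrib)
  then show ?thesis using x power2_eq_iff_nonneg[of "N (a \<odot> x)" "cmod a * N x"] by simp
qed

lemma N_triangle: "\<lbrakk>x \<in> carrier X; y \<in> carrier X\<rbrakk> \<Longrightarrow> N (x \<oplus> y) \<le> N x + N y"
proof -
  assume xy: "x \<in> carrier X" "y \<in> carrier X"
  have "Re (ip x y) \<le> N x * N y"
    using Cauchy_Schwarz[OF xy] complex_Re_le_cmod[of "ip x y"] by linarith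
  moreover have "Re (ip y x) = Re (ip x y)" using xy by (simp add: Re_ip_commute)
  ultimately have "(N (x \<oplus> y))\<^sup>2 \<le> (N x + N y)\<^sup>2"
    using xy by (simp add: N_square power2_sum)
  then show ?thesis by (rule power2_le_imp_le) (use xy in simp)
qed

lemma eq_iff_minus: "\<lbrakk>x \<in> carrier X; y \<in> carrier X\<rbrakk> \<Longrightarrow> x = y \<longleftrightarrow> x \<ominus> y = \<zero>"
proof -
  assume xy: "x \<in> carrier X" "y \<in> carrier X"
  interpret Module.module cring_class_ops X by (rule vector_space)
  have "x \<ominus> y = \<zero> \<longleftrightarrow> x \<oplus> \<ominus> y = y \<oplus> \<ominus> y"
    using xy by (simp add: M.minus_eq M.r_neg)
  also have "\<dots> \<longleftrightarrow> x = y"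
    using xy by (subst M.add.right_cancel) auto
  finally show ?thesis by blast
qed

text \<open>Vectors are compared by pairing them with all vectors; this turns vector identities into
  identities between complex numbers.\<close>

lemma ip_eqI:
  assumes "x \<in> carrier X" "y \<in> carrier X" "\<And>z. z \<in> carrier X \<Longrightarrow> ip z x = ip z y"
  shows "x = y"
  using assms eq_iff_minus ip_definite[of "x \<ominus> y"] by simp

lemma N_minus_commute: "\<lbrakk>x \<in> carrier X; y \<in> carrier X\<rbrakk> \<Longrightarrow> N (x \<ominus> y) = N (y \<ominus> x)"
  by (simp add: form_norm_def)

lemma N_triangle_minus:
  assumes "x \<in> carrier X" "y \<in> carrier X" "z \<in> carrier X"
  shows "N (x \<ominus> z) \<le> N (x \<ominus> y) + N (y \<ominus> z)"
proof -
  have "x \<ominus> z = (x \<ominus> y) \<oplus> (y \<ominus> z)"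
    by (rule ip_eqI) (use assms in auto)
  then show ?thesis using N_triangle[of "x \<ominus> y" "y \<ominus> z"] assms by simp
qed

sublocale metric: Metric_space "carrier X" "form_dist X"
proof
  fix x y z
  show "0 \<le> form_dist X x y" by (simp add: form_dist_def)
  show "form_dist X x y = form_dist X y x" by (simp add: form_dist_def N_minus_commute)
  assume "x \<in> carrier X" "y \<in> carrier X"
  then show "(form_dist X x y = 0) = (x = y)"
    by (simp add: form_dist_def eq_iff_minus)
  assume "z \<in> carrier X"
  with \<open>x \<in> carrier X\<close> \<open>y \<in> carrier X\<close>
  show "form_dist X x z \<le> form_dist X x y + form_dist X y z"
    by (simp add: form_dist_def N_triangle_minus)
qed

lemma dense_in_iff:
  "dense_in X D \<longleftrightarrow> D \<subseteq> carrier X \<and> (\<forall>x\<in>carrier X. \<forall>e>0. \<exists>d\<in>D. N (x \<ominus> d) < e)"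
  unfolding dense_in_def norm_topology_def metric.metric_closure_of
  by (auto simp: metric.in_mball form_dist_def subset_iff set_eq_iff) (metis+)

lemma subspaceD:
  assumes "linear_subspace D X"
  shows "x \<in> D \<Longrightarrow> x \<in> carrier X" "\<zero> \<in> D" "\<lbrakk>x \<in> D; y \<in> D\<rbrakk> \<Longrightarrow> x \<oplus> y \<in> D" "x \<in> D \<Longrightarrow> a \<odot> x \<in> D"
    "\<lbrakk>x \<in> D; y \<in> D\<rbrakk> \<Longrightarrow> x \<ominus> y \<in> D"
  using assms[unfolded linear_subspace_iff[OF vector_space]] by (auto simp: minus_eq subset_iff)

end

section \<open>Hilbert spaces\<close>

lemma le_if_mult_self_le: "\<lbrakk>a * a \<le> b * a; 0 \<le> b; 0 \<le> a\<rbrakk> \<Longrightarrow> a \<le> b" for a b :: real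
  by (cases "a = 0") auto

locale hilbert = prehilbert +
  assumes complete: "metric.mcomplete"
begin

lemma Cauchy_converges:
  assumes \<sigma>: "\<And>n. \<sigma> n \<in> carrier X"
    and C: "\<And>e. e > 0 \<Longrightarrow> \<exists>M. \<forall>m\<ge>M. \<forall>n\<ge>M. N (\<sigma> m \<ominus> \<sigma> n) < e"
  obtains l where "l \<in> carrier X" "(\<lambda>n. N (\<sigma> n \<ominus> l)) \<longlonglongrightarrow> 0"
proof -
  have "metric.MCauchy \<sigma>"
    using \<sigma> C by (auto simp: metric.MCauchy_def form_dist_def)
  then obtain l where "limitin metric.mtopology \<sigma> l sequentially"
    using complete metric.mcomplete_def by blast
  then have "l \<in> carrier X" "(\<lambda>n. form_dist X (\<sigma> n) l) \<longlonglongrightarrow> 0"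
    by (auto simp: metric.limitin_metric_dist_null)
  then show ?thesis
    using that \<sigma> by (simp add: form_dist_def)
qed

end

lemma hilbert_space_iff: "hilbert_space X \<longleftrightarrow> hilbert X"
  by (auto simp: hilbert_space_def hilbert_def hilbert_axioms_def prehilbert_def prehilbert_axioms_def
      hermitian_def)

lemma prehilbert_hilbertI:
  fixes X (structure)
  assumes "prehilbert X"
    and C: "\<And>\<sigma>. (\<And>n. \<sigma> n \<in> carrier X) \<Longrightarrow>
      (\<And>e. e > 0 \<Longrightarrow> \<exists>M. \<forall>m\<ge>M. \<forall>n\<ge>M. form_norm X (\<sigma> m \<ominus> \<sigma> n) < e) \<Longrightarrow>
      \<exists>l\<in>carrier X. (\<lambda>n. form_norm X (\<sigma> n \<ominus> l)) \<longlonglongrightarrow> 0"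
  shows "hilbert X"
proof -
  interpret prehilbert X by fact
  have "metric.mcomplete"
    unfolding metric.mcomplete_def
  proof (intro allI impI)
    fix \<sigma> assume "metric.MCauchy \<sigma>"
    then have \<sigma>: "\<sigma> n \<in> carrier X"
      and \<sigma>2: "e > 0 \<Longrightarrow> \<exists>M. \<forall>n n'. M \<le> n \<longrightarrow> M \<le> n' \<longrightarrow> form_dist X (\<sigma> n) (\<sigma> n') < e" for n e
      by (auto simp: metric.MCauchy_def)
    have "\<exists>l\<in>carrier X. (\<lambda>n. form_norm X (\<sigma> n \<ominus> l)) \<longlonglongrightarrow> 0"
    proof (rule C[OF \<sigma>])
      fix e :: real assume "e > 0"
      from \<sigma>2[OF this] show "\<exists>M. \<forall>m\<ge>M. \<forall>n\<ge>M. form_norm X (\<sigma> m \<ominus> \<sigma> n) < e"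
        using \<sigma> by (simp add: form_dist_def)
    qed
    then obtain l where l: "l \<in> carrier X" "(\<lambda>n. form_norm X (\<sigma> n \<ominus> l)) \<longlonglongrightarrow> 0" ..
    then have "limitin metric.mtopology \<sigma> l sequentially"
      using \<sigma> by (simp add: metric.limitin_metric_dist_null form_dist_def)
    then show "\<exists>l. limitin metric.mtopology \<sigma> l sequentially" ..
  qed
  then show ?thesis by unfold_locales
qed

context hilbert
begin

text \<open>The Riesz theorem (for the whole space) and the orthogonal projection onto the closure of a
  subspace (for \<open>\<phi> = (\<cdot>, x)\<close>) have a common source: minimise \<open>\<parallel>d\<parallel>\<^sup>2 - 2 Re \<phi>(d)\<close> over the subspace. By
  the parallelogram identity a minimising sequence is a Cauchy sequence, and its limit \<open>p\<close> represents
  \<open>\<phi>\<close> because the first variation vanishes.\<close>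

lemma representation_on_subspace:
  assumes D: "linear_subspace D X"
    and add: "\<And>x y. x \<in> D \<Longrightarrow> y \<in> D \<Longrightarrow> \<phi> (x \<oplus> y) = \<phi> x + \<phi> y"
    and smult: "\<And>a x. x \<in> D \<Longrightarrow> \<phi> (a \<odot> x) = a * \<phi> x"
    and bound: "\<And>x. x \<in> D \<Longrightarrow> cmod (\<phi> x) \<le> C * N x"
  obtains p where "p \<in> carrier X" "\<And>v. v \<in> D \<Longrightarrow> \<phi> v = ip v p"
    "\<And>e. e > 0 \<Longrightarrow> \<exists>d\<in>D. N (p \<ominus> d) < e"
proof -
  note sub = subspaceD[OF D]
  define F where "F d = (N d)\<^sup>2 - 2 * Re (\<phi> d)" for d
  define m where "m = Inf (F ` D)"
  have lower: "- C\<^sup>2 \<le> F d" if d: "d \<in> D" for d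
  proof -
    have "Re (\<phi> d) \<le> C * N d"
      using bound[OF d] complex_Re_le_cmod[of "\<phi> d"] by linarith
    moreover have "0 \<le> (N d - C)\<^sup>2" by simp
    ultimately show ?thesis by (simp add: F_def power2_diff algebra_simps)
  qed
  then have bdd: "bdd_below (F ` D)" by (meson bdd_belowI2)
  have m_le: "m \<le> F d" if "d \<in> D" for d
    unfolding m_def using bdd that by (simp add: cInf_lower)
  have "\<exists>d\<in>D. F d < m + inverse (Suc n)" for n
  proof -
    have "Inf (F ` D) < m + inverse (Suc n)" by (simp add: m_def)
    then show ?thesis
      using sub(2) cInf_lessD[of "F ` D"] by blast
  qed
  then obtain \<sigma> where \<sigma>D: "\<And>n. \<sigma> n \<in> D" and \<sigma>: "\<And>n. F (\<sigma> n) < m + inverse (Suc n)"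
    by metis
  have \<sigma>X [simp]: "\<sigma> n \<in> carrier X" for n by (intro sub(1) \<sigma>D)
  have par: "(N (\<sigma> i \<ominus> \<sigma> j))\<^sup>2 \<le> 2 * inverse (Suc i) + 2 * inverse (Suc j)" for i j
  proof -
    let ?c = "(1/2) \<odot> (\<sigma> i \<oplus> \<sigma> j)"
    have "?c \<in> D" by (intro sub(4) sub(3) \<sigma>D)
    then have "m \<le> F ?c" by (rule m_le)
    moreover have "4 * F ?c + (N (\<sigma> i \<ominus> \<sigma> j))\<^sup>2 = 2 * F (\<sigma> i) + 2 * F (\<sigma> j)"
      using \<sigma>D sub(3)[OF \<sigma>D \<sigma>D] by (simp add: F_def N_square add smult algebra_simps del: N_smult)
    ultimately show ?thesis using \<sigma>[of i] \<sigma>[of j] by linarith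
  qed
  obtain p where p: "p \<in> carrier X" and lim: "(\<lambda>n. N (\<sigma> n \<ominus> p)) \<longlonglongrightarrow> 0"
  proof (rule Cauchy_converges[of \<sigma>])
    fix e :: real assume e: "e > 0"
    obtain M where M: "inverse (real (Suc M)) < e\<^sup>2 / 4"
      using reals_Archimedean[of "e\<^sup>2 / 4"] e by auto
    have "N (\<sigma> i \<ominus> \<sigma> j) < e" if "i \<ge> M" "j \<ge> M" for i j
    proof -
      have "inverse (real (Suc i)) \<le> inverse (real (Suc M))" "inverse (real (Suc j)) \<le> inverse (real (Suc M))"
        using that by (simp_all add: le_imp_inverse_le)
      then have "(N (\<sigma> i \<ominus> \<sigma> j))\<^sup>2 < e\<^sup>2" using par[of i j] M by linarith
      then show ?thesis using e by (meson less_imp_le power_less_imp_less_base)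
    qed
    then show "\<exists>M. \<forall>i\<ge>M. \<forall>j\<ge>M. N (\<sigma> i \<ominus> \<sigma> j) < e" by blast
  qed auto
  \<comment> \<open>The first variation at the \<open>n\<close>-th term: its value exceeds the infimum by at most \<open>1 / (n + 1)\<close>.\<close>
  have var: "(cmod (ip v (\<sigma> n) - \<phi> v))\<^sup>2 \<le> inverse (Suc n) * (N v)\<^sup>2" if v: "v \<in> D" for v n
  proof -
    have [simp]: "v \<in> carrier X" using v by (rule sub(1))
    define c where "c = ip v (\<sigma> n) - \<phi> v"
    have key: "0 \<le> inverse (Suc n) - 2 * s * (cmod c)\<^sup>2 + s\<^sup>2 * (cmod c)\<^sup>2 * (N v)\<^sup>2" for s :: real
    proof -
      define a where "a = - complex_of_real s * cnj c"
      have vc: "ip v (\<sigma> n) = c + \<phi> v" by (simp add: c_def)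
      have D': "\<sigma> n \<oplus> a \<odot> v \<in> D" "a \<odot> v \<in> D" by (intro sub(4) sub(3) \<sigma>D v)+
      have "Re (ip (\<sigma> n) (a \<odot> v)) = Re (a * ip v (\<sigma> n))"
        using Re_ip_commute[of "\<sigma> n" "a \<odot> v"] by (simp del: ip_smult_right)
      then have "F (\<sigma> n \<oplus> a \<odot> v) = F (\<sigma> n) + 2 * Re (a * c) + (N (a \<odot> v))\<^sup>2"
        using D' \<sigma>D v
        by (simp add: F_def N_square add smult vc algebra_simps del: ip_smult_right N_smult)
      also have "Re (a * c) = - s * (cmod c)\<^sup>2"
      proof -
        have "a * c = - complex_of_real s * complex_of_real ((cmod c)\<^sup>2)"
          unfolding complex_norm_square by (simp add: a_def)
        then show ?thesis by simp
      qed
      also have "(N (a \<odot> v))\<^sup>2 = s\<^sup>2 * (cmod c)\<^sup>2 * (N v)\<^sup>2"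
        by (simp add: a_def norm_mult power_mult_distrib)
      finally show ?thesis using m_le[OF D'(1)] \<sigma>[of n] by linarith
    qed
    have "(cmod c)\<^sup>2 \<le> inverse (Suc n) * (N v)\<^sup>2"
    proof (cases "N v = 0")
      case True
      then have "v = \<zero>" by simp
      moreover have "\<phi> \<zero> = 0" using smult[OF sub(2), of 0] by (simp add: smult_zero)
      ultimately have "c = 0" by (simp add: c_def)
      then show ?thesis by simp
    next
      case False
      define P where "P = (N v)\<^sup>2"
      have "P > 0" using False by (simp add: P_def)
      have "0 \<le> inverse (real (Suc n)) - (cmod c)\<^sup>2 / P"
        using key[of "1 / P"] \<open>P > 0\<close> unfolding P_def[symmetric] by (simp add: power2_eq_square)
      then show ?thesis
        using \<open>P > 0\<close> unfolding P_def[symmetric] by (simp add: pos_divide_le_eq)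
    qed
    then show ?thesis by (simp add: c_def)
  qed
  show ?thesis
  proof (rule that[OF p])
    fix v assume v: "v \<in> D"
    then have vX [simp]: "v \<in> carrier X" using sub by blast
    have "(\<lambda>n. ip v (\<sigma> n) - \<phi> v) \<longlonglongrightarrow> 0"
    proof (rule Lim_null_comparison)
      show "(\<lambda>n. sqrt (inverse (Suc n) * (N v)\<^sup>2)) \<longlonglongrightarrow> 0"
        using tendsto_real_sqrt[OF tendsto_mult_left_zero[OF LIMSEQ_inverse_real_of_nat]] by simp
      show "\<forall>\<^sub>F n in sequentially. cmod (ip v (\<sigma> n) - \<phi> v) \<le> sqrt (inverse (Suc n) * (N v)\<^sup>2)"
        using var[OF v] by (intro always_eventually allI real_le_rsqrt)
    qed
    then have 1: "(\<lambda>n. ip v (\<sigma> n)) \<longlonglongrightarrow> \<phi> v" by (simp add: LIM_zero_iff)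
    have "(\<lambda>n. ip v (\<sigma> n) - ip v p) \<longlonglongrightarrow> 0"
    proof (rule Lim_null_comparison)
      show "(\<lambda>n. N v * N (\<sigma> n \<ominus> p)) \<longlonglongrightarrow> 0"
        using tendsto_mult_right_zero[OF lim] by simp
      show "\<forall>\<^sub>F n in sequentially. cmod (ip v (\<sigma> n) - ip v p) \<le> N v * N (\<sigma> n \<ominus> p)"
        using Cauchy_Schwarz[of v "\<sigma> n \<ominus> p" for n] p by (intro always_eventually allI) simp
    qed
    then have 2: "(\<lambda>n. ip v (\<sigma> n)) \<longlonglongrightarrow> ip v p" by (simp add: LIM_zero_iff)
    show "\<phi> v = ip v p" using LIMSEQ_unique[OF 1 2] .
  next
    fix e :: real assume "e > 0"
    then obtain n where "N (\<sigma> n \<ominus> p) < e"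
      using order_tendstoD(2)[OF lim] eventually_happens' sequentially_bot by blast
    then have "N (p \<ominus> \<sigma> n) < e" using N_minus_commute[OF p \<sigma>X] by simp
    then show "\<exists>d\<in>D. N (p \<ominus> d) < e" using \<sigma>D by blast
  qed
qed

lemma carrier_subspace: "linear_subspace (carrier X) X"
  unfolding linear_subspace_iff[OF vector_space] by auto

lemma Riesz:
  assumes "\<And>x y. x \<in> carrier X \<Longrightarrow> y \<in> carrier X \<Longrightarrow> \<phi> (x \<oplus> y) = \<phi> x + \<phi> y"
    and "\<And>a x. x \<in> carrier X \<Longrightarrow> \<phi> (a \<odot> x) = a * \<phi> x"
    and "\<And>x. x \<in> carrier X \<Longrightarrow> cmod (\<phi> x) \<le> C * N x"
  obtains p where "p \<in> carrier X" "\<And>v. v \<in> carrier X \<Longrightarrow> \<phi> v = ip v p"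
  by (rule representation_on_subspace[OF carrier_subspace, of \<phi> C]) (use assms in \<open>simp_all\<close>)

text \<open>Density becomes a statement about the inner product alone; for the range of a symmetric
  operator it says that the kernel is trivial.\<close>

lemma dense_in_iff_orthogonal:
  assumes D: "linear_subspace D X"
  shows "dense_in X D \<longleftrightarrow> (\<forall>y\<in>carrier X. (\<forall>d\<in>D. ip d y = 0) \<longrightarrow> y = \<zero>)"
proof
  assume dense: "dense_in X D"
  show "\<forall>y\<in>carrier X. (\<forall>d\<in>D. ip d y = 0) \<longrightarrow> y = \<zero>"
  proof (intro ballI impI)
    fix y assume y: "y \<in> carrier X" and 0: "\<forall>d\<in>D. ip d y = 0"
    have "N y \<le> 0 + e" if e: "e > 0" for e
    proof -
      obtain d where d: "d \<in> D" "N (y \<ominus> d) < e"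
        using dense y e unfolding dense_in_iff by blast
      then have dX: "d \<in> carrier X" using subspaceD(1)[OF D] by blast
      have "(N y)\<^sup>2 = Re (ip (y \<ominus> d) y)" using 0 d y dX by (simp add: N_square)
      also have "\<dots> \<le> N (y \<ominus> d) * N y"
        using Cauchy_Schwarz[of "y \<ominus> d" y] complex_Re_le_cmod[of "ip (y \<ominus> d) y"] y dX by force
      finally have "N y * N y \<le> N (y \<ominus> d) * N y" by (simp add: power2_eq_square)
      then have "N y \<le> N (y \<ominus> d)"
        by (rule le_if_mult_self_le) (use y dX in auto)
      then show ?thesis using d by simp
    qed
    then have "N y \<le> 0" by (rule field_le_epsilon)
    then have "N y = 0" using y N_nonneg[of y] by linarith
    then show "y = \<zero>" using y by simp
  qed
next
  assume perp: "\<forall>y\<in>carrier X. (\<forall>d\<in>D. ip d y = 0) \<longrightarrow> y = \<zero>"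
  note sub = subspaceD[OF D]
  show "dense_in X D"
    unfolding dense_in_iff
  proof (intro conjI ballI allI impI subsetI)
    fix x and e :: real assume x: "x \<in> carrier X" and e: "e > 0"
    have "cmod (ip d x) \<le> N x * N d" if "d \<in> D" for d
      using Cauchy_Schwarz[of d x] sub(1)[OF that] x by (simp add: mult.commute)
    then obtain p where p: "p \<in> carrier X" "\<And>v. v \<in> D \<Longrightarrow> ip v x = ip v p"
      "\<And>e. e > 0 \<Longrightarrow> \<exists>d\<in>D. N (p \<ominus> d) < e"
      using representation_on_subspace[OF D, of "\<lambda>d. ip d x" "N x"] sub(1) x by auto
    have "x \<ominus> p = \<zero>" using perp p x sub(1) by simp
    then have "x = p" using eq_iff_minus p(1) x by blast
    then show "\<exists>d\<in>D. N (x \<ominus> d) < e" using p e by simp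
  qed (use sub(1) in blast)
qed

lemma dense_eqI:
  assumes D: "linear_subspace D X" "dense_in X D" and "x \<in> carrier X" "y \<in> carrier X"
    and eq: "\<And>d. d \<in> D \<Longrightarrow> ip d x = ip d y"
  shows "x = y"
proof -
  have "x \<ominus> y = \<zero>"
    using D dense_in_iff_orthogonal[OF D(1)] subspaceD(1)[OF D(1)] assms by auto
  then show ?thesis using assms eq_iff_minus by blast
qed

lemma norm_le_if_dense:
  assumes D: "linear_subspace D X" "dense_in X D" and z: "z \<in> carrier X" and C: "0 \<le> C"
    and le: "\<And>d. d \<in> D \<Longrightarrow> cmod (ip d z) \<le> C * N d"
  shows "N z \<le> C"
proof -
  have "N z * N z \<le> C * N z + e" if e: "e > 0" for e
  proof -
    \<comment> \<open>Replacing \<open>z\<close> by a vector \<open>d\<close> at distance \<open>\<delta>\<close> costs at most \<open>\<delta> (\<bar>C\<bar> + \<parallel>z\<parallel>)\<close>.\<close>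
    define \<delta> where "\<delta> = e / (\<bar>C\<bar> + N z + 1)"
    have pos: "\<bar>C\<bar> + N z + 1 > 0" using z N_nonneg[of z] by linarith
    then have \<delta>: "\<delta> > 0" using e by (simp add: \<delta>_def)
    obtain d where d: "d \<in> D" "N (z \<ominus> d) < \<delta>"
      using D(2) z \<delta> unfolding dense_in_iff by blast
    have dX: "d \<in> carrier X" using d subspaceD(1)[OF D(1)] by blast
    have "(N z)\<^sup>2 = Re (ip d z) + Re (ip (z \<ominus> d) z)" using z dX by (simp add: N_square)
    also have "\<dots> \<le> C * N d + N (z \<ominus> d) * N z"
      using le[OF d(1)] Cauchy_Schwarz[of "z \<ominus> d" z] complex_Re_le_cmod[of "ip d z"]
        complex_Re_le_cmod[of "ip (z \<ominus> d) z"] z dX by force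
    also have "C * N d \<le> C * N z + \<bar>C\<bar> * N (z \<ominus> d)"
    proof -
      have "d = z \<oplus> (d \<ominus> z)" "z = d \<oplus> (z \<ominus> d)"
        using z dX by (auto intro!: ip_eqI)
      then have "N d \<le> N z + N (z \<ominus> d)" "N z \<le> N d + N (z \<ominus> d)"
        using N_triangle[of z "d \<ominus> z"] N_triangle[of d "z \<ominus> d"] z dX
        by (auto simp: N_minus_commute[of d z])
      then have "\<bar>N d - N z\<bar> \<le> N (z \<ominus> d)" by linarith
      then have "\<bar>C * (N d - N z)\<bar> \<le> \<bar>C\<bar> * N (z \<ominus> d)"
        unfolding abs_mult by (rule mult_left_mono) simp
      then show ?thesis by (simp add: algebra_simps)
    qed
    also have "C * N z + \<bar>C\<bar> * N (z \<ominus> d) + N (z \<ominus> d) * N z \<le> C * N z + \<delta> * (\<bar>C\<bar> + N z + 1)"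
    proof -
      have "(\<bar>C\<bar> + N z) * N (z \<ominus> d) \<le> (\<bar>C\<bar> + N z) * \<delta>"
        using d z by (intro mult_left_mono) auto
      then show ?thesis using \<delta> by (simp add: algebra_simps)
    qed
    also have "\<delta> * (\<bar>C\<bar> + N z + 1) = e" using pos by (simp add: \<delta>_def)
    finally show ?thesis by (simp add: power2_eq_square)
  qed
  then have "N z * N z \<le> C * N z" by (rule field_le_epsilon)
  then show ?thesis using C N_nonneg[OF z] by (rule le_if_mult_self_le)
qed

end

section \<open>Symmetric operators defined everywhere\<close>

context hilbert
begin

text \<open>For an everywhere defined \<open>P\<close> the identity \<open>(P x, y) = (x, P y)\<close> forces linearity
  (\<open>symmetric_on_linear\<close>) and boundedness (\<open>symmetric_on_bounded\<close>).\<close>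

definition symmetric_on :: "('a \<Rightarrow> 'a) \<Rightarrow> bool" where
  "symmetric_on P \<longleftrightarrow> P \<in> carrier X \<rightarrow> carrier X \<and>
     (\<forall>x\<in>carrier X. \<forall>y\<in>carrier X. ip (P x) y = ip x (P y))"

definition positive_on :: "('a \<Rightarrow> 'a) \<Rightarrow> bool" where
  "positive_on P \<longleftrightarrow> symmetric_on P \<and> (\<forall>x\<in>carrier X. ip (P x) x \<in> \<real>\<^sub>\<ge>\<^sub>0)"

lemma symmetric_onD:
  assumes "symmetric_on P"
  shows "x \<in> carrier X \<Longrightarrow> P x \<in> carrier X"
    "\<lbrakk>x \<in> carrier X; y \<in> carrier X\<rbrakk> \<Longrightarrow> ip (P x) y = ip x (P y)"
  using assms by (auto simp: symmetric_on_def)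

lemma positive_onD:
  assumes "positive_on P"
  shows "x \<in> carrier X \<Longrightarrow> P x \<in> carrier X"
    "\<lbrakk>x \<in> carrier X; y \<in> carrier X\<rbrakk> \<Longrightarrow> ip (P x) y = ip x (P y)"
    "x \<in> carrier X \<Longrightarrow> 0 \<le> Re (ip (P x) x)"
  using assms by (auto simp: symmetric_on_def positive_on_def complex_nonneg_Reals_iff)

lemma symmetric_on_linear:
  assumes P: "symmetric_on P" and x: "x \<in> carrier X" and y: "y \<in> carrier X"
  shows "P (x \<oplus> y) = P x \<oplus> P y" "P (a \<odot> x) = a \<odot> P x" "P (x \<ominus> y) = P x \<ominus> P y" "P \<zero> = \<zero>"
proof -
  note s = symmetric_onD[OF P]
  show "P (x \<oplus> y) = P x \<oplus> P y"
    by (rule ip_eqI) (use x y s(1) s(2)[symmetric] in \<open>simp_all\<close>)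
  show "P (a \<odot> x) = a \<odot> P x"
    by (rule ip_eqI) (use x y s(1) s(2)[symmetric] in \<open>simp_all\<close>)
  show "P (x \<ominus> y) = P x \<ominus> P y"
    by (rule ip_eqI) (use x y s(1) s(2)[symmetric] in \<open>simp_all\<close>)
  show "P \<zero> = \<zero>"
    by (rule ip_eqI) (use s(1) s(2)[symmetric] in \<open>simp_all\<close>)
qed

text \<open>The Hellinger-Toeplitz theorem. The sets \<open>{x. \<parallel>P x\<parallel> \<le> n}\<close> are closed because
  \<open>\<parallel>P x\<parallel>\<^sup>2 = (x, P P x)\<close> depends continuously on the first entry, and they cover the space; by the Baire
  category theorem one of them contains a ball.\<close>

lemma symmetric_on_bounded:
  assumes P: "symmetric_on P"
  obtains C where "C \<ge> 0" "\<And>x. x \<in> carrier X \<Longrightarrow> N (P x) \<le> C * N x"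
proof -
  note [simp] = symmetric_onD(1)[OF P]
  note s = symmetric_onD(2)[OF P]
  note lin = symmetric_on_linear[OF P]
  define B where "B n = {x \<in> carrier X. N (P x) \<le> real n}" for n :: nat
  have closed: "closedin metric.mtopology (B n)" for n
  proof -
    have "metric.mtopology closure_of (B n) \<subseteq> B n"
    proof
      fix x assume "x \<in> metric.mtopology closure_of (B n)"
      then have x: "x \<in> carrier X" and "\<And>e. e > 0 \<Longrightarrow> \<exists>y\<in>B n. y \<in> metric.mball x e"
        unfolding metric.metric_closure_of by auto
      then have ap: "\<And>e. e > 0 \<Longrightarrow> \<exists>y\<in>B n. N (x \<ominus> y) < e"
        by (simp add: form_dist_def B_def cong: conj_cong)
      have "N (P x) * N (P x) \<le> real n * N (P x) + e" if e: "e > 0" for e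
      proof -
        let ?z = "P (P x)"
        have "e / (N ?z + 1) > 0" using x e N_nonneg[of ?z] by (simp add: add_nonneg_pos)
        then obtain y where y: "y \<in> carrier X" "N (P y) \<le> real n" and d: "N (x \<ominus> y) < e / (N ?z + 1)"
          using ap B_def by blast
        have "ip (P x) (P x) = ip (x \<ominus> y) ?z + ip (P y) (P x)"
          using x y s by simp
        then have "(N (P x))\<^sup>2 = Re (ip (x \<ominus> y) ?z) + Re (ip (P y) (P x))"
          using x by (simp add: N_square)
        also have "\<dots> \<le> N (x \<ominus> y) * N ?z + N (P y) * N (P x)"
          using Cauchy_Schwarz[of "x \<ominus> y" ?z] Cauchy_Schwarz[of "P y" "P x"]
            complex_Re_le_cmod[of "ip (x \<ominus> y) ?z"] complex_Re_le_cmod[of "ip (P y) (P x)"] x y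
          by force
        also have "N (P y) * N (P x) \<le> real n * N (P x)"
          using y x by (intro mult_right_mono) auto
        also have "N (x \<ominus> y) * N ?z \<le> N (x \<ominus> y) * (N ?z + 1)"
          using x y by (intro mult_left_mono) auto
        also have "N (x \<ominus> y) * (N ?z + 1) \<le> e"
          using d x N_nonneg[of ?z] by (simp add: pos_less_divide_eq add_nonneg_pos less_imp_le)
        finally show ?thesis by (simp add: power2_eq_square)
      qed
      then have "N (P x) * N (P x) \<le> real n * N (P x)" by (rule field_le_epsilon)
      then have "N (P x) \<le> real n" by (rule le_if_mult_self_le) (use x in auto)
      then show "x \<in> B n" using x by (simp add: B_def)
    qed
    then have "metric.mtopology closure_of (B n) = B n"
      by (intro equalityI closure_of_subset) (auto simp: B_def)
    then show ?thesis by (simp add: closure_of_eq)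
  qed
  have "\<Union>(range B) = carrier X"
  proof (intro equalityI subsetI)
    fix x assume "x \<in> carrier X"
    moreover obtain n where "N (P x) \<le> real n" using real_arch_simple by blast
    ultimately show "x \<in> \<Union>(range B)" by (auto simp: B_def)
  qed (auto simp: B_def)
  then have "metric.mtopology interior_of \<Union>(range B) = carrier X"
    by (metis interior_of_topspace metric.topspace_mtopology)
  then have "\<not> (\<forall>n. metric.mtopology interior_of B n = {})"
    using metric.metric_Baire_category_alt[OF complete, of "range B"] closed zero_in by auto
  then obtain n x where "x \<in> metric.mtopology interior_of B n" by blast
  then obtain r where x: "x \<in> carrier X" and r: "r > 0" and sub: "metric.mball x r \<subseteq> B n"
    unfolding metric.metric_interior_of by (auto simp: B_def)
  have small: "N (P z) \<le> 2 * real n" if z: "z \<in> carrier X" "N z < r" for z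
  proof -
    have e: "x \<ominus> (x \<oplus> z) = (-1) \<odot> z"
      by (rule ip_eqI) (use x z in auto)
    have "x \<oplus> z \<in> metric.mball x r" "x \<in> metric.mball x r"
      using x z r e eq_iff_minus[of x x] by (simp_all add: form_dist_def)
    then have "x \<oplus> z \<in> B n" "x \<in> B n" using sub by blast+
    then have b: "N (P x) \<le> real n" "N (P (x \<oplus> z)) \<le> real n" by (auto simp: B_def)
    have "P z = P (x \<oplus> z) \<oplus> (-1) \<odot> P x"
      by (rule ip_eqI) (use x z lin in auto)
    then have "N (P z) \<le> N (P (x \<oplus> z)) + N (P x)"
      using N_triangle[of "P (x \<oplus> z)" "(-1) \<odot> P x"] x z by simp
    then show ?thesis using b by simp
  qed
  show ?thesis
  proof
    show "0 \<le> 4 * real n / r" using r by simp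
    fix z assume z: "z \<in> carrier X"
    show "N (P z) \<le> 4 * real n / r * N z"
    proof (cases "N z = 0")
      case True
      then have "z = 0 \<odot> z" using z smult_zero[of z] by simp
      then have "P z = 0 \<odot> P z" using lin(2)[OF z z, of 0] by simp
      then have "P z = \<zero>" using z smult_zero[of "P z"] by simp
      then show ?thesis using True by simp
    next
      case False
      then have pos: "N z > 0" using z N_nonneg[of z] by linarith
      define s where "s = r / (2 * N z)"
      have s: "s > 0" using r pos by (simp add: s_def)
      have "N (P (s \<odot> z)) \<le> 2 * real n"
      proof (rule small)
        have "N (complex_of_real s \<odot> z) = s * N z" using s z by simp
        also have "\<dots> = r / 2" using pos by (simp add: s_def)
        finally show "N (complex_of_real s \<odot> z) < r" using r by simp
      qed (use z in simp)
      then have "s * N (P z) \<le> 2 * real n"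
        using z s lin(2)[OF z z] by simp
      then show ?thesis using r pos by (simp add: s_def field_simps)
    qed
  qed
qed

end

section \<open>Square roots\<close>

text \<open>The coefficients of \<open>(1 - x)\<^sup>1\<^sup>/\<^sup>2\<close>: the first is \<open>1\<close>, the others are nonpositive with sum at
  least \<open>-1\<close>.\<close>

definition sqrt_coeff :: "nat \<Rightarrow> real" where
  "sqrt_coeff n = (-1) ^ n * (1/2 gchoose n)"

lemma sqrt_coeff_0 [simp]: "sqrt_coeff 0 = 1"
  by (simp add: sqrt_coeff_def)

lemma sqrt_coeff_sum: "(\<Sum>i\<le>n. sqrt_coeff i) = (-1) ^ n * (-1/2 gchoose n)"
  unfolding sqrt_coeff_def using gbinomial_sum_lower_neg[of "1/2 :: real" n]
  by (simp add: mult.commute)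

lemma gbinomial_minus_half_sign: "0 \<le> (-1) ^ n * ((-1/2 :: real) gchoose n)"
proof (induction n)
  case (Suc n)
  have "real (Suc n) * ((-1/2) gchoose Suc n) = (-1/2 - real n) * ((-1/2) gchoose n)"
    using gbinomial_mult_1[of "-1/2 :: real" n] by (simp add: algebra_simps)
  then have eq: "((-1/2 :: real) gchoose Suc n) = (-1/2 - real n) / real (Suc n) * ((-1/2) gchoose n)"
    by (simp add: field_simps)
  then have "(-1) ^ Suc n * ((-1/2 :: real) gchoose Suc n) = ((-1) ^ n * (-1/2 gchoose n)) * ((1/2 + n) / (Suc n))"
    by (subst eq) (simp add: divide_simps, simp add: algebra_simps)
  then show ?case using Suc by simp
qed simp

lemma sqrt_coeff_nonpos: "n > 0 \<Longrightarrow> sqrt_coeff n \<le> 0"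
proof (cases n)
  case (Suc m)
  have "sqrt_coeff n = - ((1/2) / Suc m) * ((-1) ^ m * ((-1/2) gchoose m))"
    using gbinomial_absorption[of m "1/2 :: real"] Suc
    by (simp add: sqrt_coeff_def field_simps)
  then show ?thesis using gbinomial_minus_half_sign[of m] by (simp add: mult_nonneg_nonneg)
qed simp

lemma sqrt_coeff_abs_sum: "(\<Sum>i<n. \<bar>sqrt_coeff (Suc i)\<bar>) \<le> 1"
proof -
  have "(\<Sum>i\<le>n. sqrt_coeff i) = 1 + (\<Sum>i<n. sqrt_coeff (Suc i))"
    by (induction n) auto
  moreover have "(\<Sum>i<n. \<bar>sqrt_coeff (Suc i)\<bar>) = - (\<Sum>i<n. sqrt_coeff (Suc i))"
    by (simp add: sum_negf[symmetric] abs_of_nonpos sqrt_coeff_nonpos)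
  ultimately show ?thesis
    using gbinomial_minus_half_sign[of n] sqrt_coeff_sum[of n] by linarith
qed

lemma sqrt_coeff_summable: "summable (\<lambda>n. \<bar>sqrt_coeff n\<bar>)"
proof (subst summable_Suc_iff[symmetric], rule summableI_nonneg_bounded)
  show "(\<Sum>i<n. \<bar>sqrt_coeff (Suc i)\<bar>) \<le> 1" for n by (rule sqrt_coeff_abs_sum)
qed simp

lemma sqrt_coeff_convolution:
  "(\<Sum>i\<le>n. sqrt_coeff i * sqrt_coeff (n - i)) = (if n = 0 then 1 else if n = 1 then -1 else 0)"
proof -
  have "(\<Sum>i\<le>n. sqrt_coeff i * sqrt_coeff (n - i))
      = (\<Sum>i\<le>n. (-1) ^ n * ((1/2 gchoose i) * (1/2 gchoose (n - i))))"
    by (rule sum.cong) (auto simp: sqrt_coeff_def power_add[symmetric] mult_ac simp flip: power_add)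
  also have "\<dots> = (-1) ^ n * ((1 :: real) gchoose n)"
    using gbinomial_Vandermonde[of "1/2 :: real" "1/2" n] 
    by (simp add: sum_distrib_left[symmetric] atMost_atLeast0)
  also have "(1 :: real) gchoose n = of_nat (1 choose n)"
    by (metis binomial_gbinomial of_nat_1)
  finally show ?thesis by (auto simp: binomial_eq_0 not_le)
qed

text \<open>The identity \<open>((1 - x)\<^sup>1\<^sup>/\<^sup>2)\<^sup>2 = 1 - x\<close> with \<open>x\<^sup>n\<close> replaced by the bounded sequence \<open>h\<close>. For an
  operator \<open>T\<close> the sequence is \<open>h n = (T\<^sup>n v, x)\<close>.\<close>

lemma sqrt_coeff_double_sum:
  fixes h :: "nat \<Rightarrow> complex"
  assumes h: "\<And>n. cmod (h n) \<le> M"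
  shows "(\<Sum>n. sqrt_coeff n * (\<Sum>m. sqrt_coeff m * h (m + n))) = h 0 - h 1"
proof -
  define g where "g = (\<lambda>(n, m). complex_of_real (sqrt_coeff n) * complex_of_real (sqrt_coeff m) * h (m + n))"
  have c: "(\<lambda>n. \<bar>sqrt_coeff n\<bar>) summable_on UNIV"
    using norm_summable_imp_summable_on[of "\<lambda>n. \<bar>sqrt_coeff n\<bar>"] sqrt_coeff_summable by simp
  have M: "0 \<le> M" using h[of 0] norm_ge_zero order_trans by blast
  have "Infinite_Sum.abs_summable_on (\<lambda>(n, m). sqrt_coeff n * sqrt_coeff m * M) (UNIV \<times> UNIV)"
    unfolding Infinite_Sum.abs_summable_on_Sigma_iff
  proof (intro conjI ballI)
    show "Infinite_Sum.abs_summable_on (\<lambda>m. case (n, m) of (n, m) \<Rightarrow> sqrt_coeff n * sqrt_coeff m * M) (UNIV)" for n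
      using summable_on_cmult_left[OF summable_on_cmult_right[OF c, of "\<bar>sqrt_coeff n\<bar>"], of M] M
      by (simp add: abs_mult)
    have "(\<Sum>\<^sub>\<infinity>m. norm (case (n, m) of (n, m) \<Rightarrow> sqrt_coeff n * sqrt_coeff m * M))
        = \<bar>sqrt_coeff n\<bar> * (infsum (\<lambda>m. \<bar>sqrt_coeff m\<bar>) UNIV * M)" for n
      using M c by (simp add: abs_mult mult.assoc infsum_cmult_right infsum_cmult_left summable_on_cmult_left)
    then show "Infinite_Sum.abs_summable_on (\<lambda>n. \<Sum>\<^sub>\<infinity>m. norm (case (n, m) of (n, m) \<Rightarrow> sqrt_coeff n * sqrt_coeff m * M)) (UNIV)"
      using c M by (simp add: abs_mult summable_on_cmult_left)
  qed
  then have g: "Infinite_Sum.abs_summable_on g (UNIV \<times> UNIV)"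
  proof (rule Infinite_Sum.abs_summable_on_comparison_test)
    fix x :: "nat \<times> nat"
    show "norm (g x) \<le> norm (case x of (n, m) \<Rightarrow> sqrt_coeff n * sqrt_coeff m * M)"
      using h[of "snd x + fst x"] M
      by (simp add: g_def split_beta norm_mult abs_mult mult_left_mono)
  qed
  have inner: "(\<Sum>m. sqrt_coeff m * h (m + n)) = infsum (\<lambda>m. sqrt_coeff m * h (m + n)) UNIV" (is ?inner)
    and bd: "cmod (\<Sum>m. sqrt_coeff m * h (m + n)) \<le> (\<Sum>m. \<bar>sqrt_coeff m\<bar>) * M" (is ?bd) for n
  proof -
    have le: "norm (sqrt_coeff m * h (m + n)) \<le> \<bar>sqrt_coeff m\<bar> * M" for m
      using h[of "m + n"] by (simp add: norm_mult mult_left_mono)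
    have s: "summable (\<lambda>m. norm (sqrt_coeff m * h (m + n)))"
      by (rule summable_comparison_test'[OF summable_mult2[OF sqrt_coeff_summable, of M]]) (use le in simp)
    then show ?inner
      by (intro infsumI[symmetric] norm_summable_imp_has_sum) (simp_all add: summable_norm_cancel summable_sums)
    have "cmod (\<Sum>m. sqrt_coeff m * h (m + n)) \<le> (\<Sum>m. norm (sqrt_coeff m * h (m + n)))"
      by (rule summable_norm[OF s])
    also have "\<dots> \<le> (\<Sum>m. \<bar>sqrt_coeff m\<bar> * M)"
      by (rule suminf_le[OF le s summable_mult2[OF sqrt_coeff_summable]])
    also have "\<dots> = (\<Sum>m. \<bar>sqrt_coeff m\<bar>) * M"
      using suminf_mult2[OF sqrt_coeff_summable] by simp
    finally show ?bd .
  qed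
  have s: "summable (\<lambda>n. norm (sqrt_coeff n * (\<Sum>m. sqrt_coeff m * h (m + n))))"
    by (rule summable_comparison_test'[OF summable_mult2[OF sqrt_coeff_summable, of "(\<Sum>m. \<bar>sqrt_coeff m\<bar>) * M"]])
      (use bd in \<open>simp add: norm_mult mult_left_mono\<close>)
  have "(\<Sum>n. sqrt_coeff n * (\<Sum>m. sqrt_coeff m * h (m + n)))
      = infsum (\<lambda>n. sqrt_coeff n * (\<Sum>m. sqrt_coeff m * h (m + n))) UNIV"
    using s by (intro infsumI[symmetric] norm_summable_imp_has_sum) (simp_all add: summable_norm_cancel summable_sums)
  also have "\<dots> = infsum (\<lambda>n. infsum (\<lambda>m. g (n, m)) UNIV) UNIV"
    unfolding inner g_def by (simp add: mult.assoc infsum_cmult_right')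
  also have "\<dots> = infsum g (UNIV \<times> UNIV)"
    by (rule infsum_Sigma_banach[OF abs_summable_summable[OF g]])
  also have "\<dots> = infsum (\<lambda>p. g (case p of (k, i) \<Rightarrow> (i, k - i))) (SIGMA k:UNIV. {..k})"
    by (rule infsum_reindex_bij_betw[symmetric], rule bij_betwI[where g="\<lambda>(n, m). (n + m, n)"]) auto
  also have "\<dots> = infsum (\<lambda>k. infsum (\<lambda>i. g (i, k - i)) {..k}) UNIV"
  proof (subst infsum_Sigma_banach[symmetric])
    show "(\<lambda>p. g (case p of (k, i) \<Rightarrow> (i, k - i))) summable_on (SIGMA k:UNIV. {..k})"
      by (subst summable_on_reindex_bij_betw[where B="UNIV \<times> UNIV"], rule bij_betwI[where g="\<lambda>(n, m). (n + m, n)"])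
        (use abs_summable_summable[OF g] in auto)
  qed simp
  also have "\<dots> = infsum (\<lambda>k. of_real (\<Sum>i\<le>k. sqrt_coeff i * sqrt_coeff (k - i)) * h k) UNIV"
    by (rule infsum_cong) (simp add: g_def sum_distrib_right)
  also have "\<dots> = infsum (\<lambda>k. of_real (\<Sum>i\<le>k. sqrt_coeff i * sqrt_coeff (k - i)) * h k) {0, 1}"
    by (rule infsum_cong_neutral) (auto simp: sqrt_coeff_convolution)
  also have "\<dots> = h 0 - h 1"
    unfolding sqrt_coeff_convolution by simp
  finally show ?thesis .
qed

context hilbert
begin

text \<open>The commutation clause is what makes positive square roots unique; it holds because \<open>q\<close> is a
  weak limit of polynomials in \<open>c\<close>.\<close>

definition positive_root :: "('a \<Rightarrow> 'a) \<Rightarrow> ('a \<Rightarrow> 'a) \<Rightarrow> bool" where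
  "positive_root c q \<longleftrightarrow> positive_on q \<and> (\<forall>x\<in>carrier X. q (q x) = c x) \<and>
     (\<forall>p. symmetric_on p \<longrightarrow> (\<forall>y\<in>carrier X. p (c y) = c (p y)) \<longrightarrow>
        (\<forall>x\<in>carrier X. q (p x) = p (q x)))"

lemma positive_rootD:
  assumes "positive_root c q"
  shows "positive_on q" "x \<in> carrier X \<Longrightarrow> q (q x) = c x"
    "\<lbrakk>symmetric_on p; \<And>y. y \<in> carrier X \<Longrightarrow> p (c y) = c (p y); x \<in> carrier X\<rbrakk> \<Longrightarrow> q (p x) = p (q x)"
  using assms by (auto simp: positive_root_def)

text \<open>The binomial series for \<open>(1 - T)\<^sup>1\<^sup>/\<^sup>2\<close> is summed after pairing with vectors: its terms
  \<open>(T\<^sup>n v, x)\<close> are bounded numbers, and the operator is recovered by the Riesz representation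
  theorem.\<close>

lemma contraction_sqrt:
  assumes c: "positive_on c" and le: "\<And>x. x \<in> carrier X \<Longrightarrow> Re (ip (c x) x) \<le> (N x)\<^sup>2"
  shows "\<exists>q. positive_root c q"
proof -
  note [simp] = positive_onD(1)[OF c]
  note sc = positive_onD(2)[OF c] and pc = positive_onD(3)[OF c]
  have sym: "symmetric_on c" using c by (simp add: positive_on_def)
  note lin = symmetric_on_linear[OF sym]
  have cc: "(N (c x))\<^sup>2 \<le> Re (ip (c x) x)" if x: "x \<in> carrier X" for x
  proof -
    let ?Y = "X\<lparr>form := \<lambda>x y. form X (c x) y\<rparr>"
    have "complex_vector_space ?Y"
      using vector_space by (subst complex_vector_space_cong[of _ X]) simp_all
    then have "hermitian_space ?Y"
      unfolding hermitian_space_def using lin sc by (auto simp: ip_cnj)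
    then interpret Y: hermitian ?Y by (rule hermitian.intro)
    have "(cmod (ip (c x) (c x)))\<^sup>2 \<le> Re (ip (c x) x) * Re (ip (c (c x)) (c x))"
      using Y.Cauchy_Schwarz_semidefinite[of x "c x"] pc x by simp
    also have "\<dots> \<le> Re (ip (c x) x) * (N (c x))\<^sup>2"
      using le[of "c x"] pc x by (intro mult_left_mono) auto
    also have "(cmod (ip (c x) (c x)))\<^sup>2 = (N (c x))\<^sup>2 * (N (c x))\<^sup>2"
      using x by (simp only: ip_self_N \<open>x \<in> carrier X \<Longrightarrow> c x \<in> carrier X\<close> norm_of_real)
        (simp add: power2_eq_square)
    finally show ?thesis by (rule le_if_mult_self_le) (use pc x in auto)
  qed
  \<comment> \<open>By \<open>cc\<close> the operator \<open>T = 1 - c\<close> is a contraction.\<close>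
  define T where "T x = x \<ominus> c x" for x
  have T_in [simp]: "T x \<in> carrier X" if "x \<in> carrier X" for x using that by (simp add: T_def)
  have T_sym: "ip (T x) y = ip x (T y)" if "x \<in> carrier X" "y \<in> carrier X" for x y
    using that sc by (simp add: T_def)
  have symT: "symmetric_on T" using T_sym by (auto simp: symmetric_on_def)
  note linT = symmetric_on_linear[OF symT]
  have T_le: "N (T x) \<le> N x" if x: "x \<in> carrier X" for x
  proof -
    have "(N (T x))\<^sup>2 = (N x)\<^sup>2 - 2 * Re (ip (c x) x) + (N (c x))\<^sup>2"
      using x sc[of x x] by (simp add: T_def N_square)
    also have "\<dots> \<le> (N x)\<^sup>2" using cc[OF x] pc[OF x] by linarith
    finally show ?thesis by (rule power2_le_imp_le) (use x in simp)
  qed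
  have Tn_in [simp]: "(T ^^ n) x \<in> carrier X" if "x \<in> carrier X" for x n
    by (induction n) (use that in auto)
  have Tn_le: "N ((T ^^ n) x) \<le> N x" if "x \<in> carrier X" for x n
    by (induction n) (use that T_le order_trans in \<open>auto intro: order_trans[OF T_le]\<close>)
  have Tn_sym: "ip ((T ^^ n) x) y = ip x ((T ^^ n) y)" if "x \<in> carrier X" "y \<in> carrier X" for x y n
    using that
  proof (induction n arbitrary: y)
    case (Suc n)
    have "ip ((T ^^ Suc n) x) y = ip ((T ^^ n) x) (T y)" using Suc.prems by (simp add: T_sym)
    also have "\<dots> = ip x ((T ^^ n) (T y))" using Suc.prems by (intro Suc.IH) simp_all
    finally show ?case by (simp only: funpow_Suc_right comp_apply)
  qed simp
  have Tn_lin: "(T ^^ n) (x \<oplus> y) = (T ^^ n) x \<oplus> (T ^^ n) y" "(T ^^ n) (a \<odot> x) = a \<odot> (T ^^ n) x"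
    if "x \<in> carrier X" "y \<in> carrier X" for x y n a
    by (induction n) (use that linT in auto)
  have bd: "cmod (ip ((T ^^ n) v) x) \<le> N v * N x" if "v \<in> carrier X" "x \<in> carrier X" for v x n
    using Cauchy_Schwarz[of "(T ^^ n) v" x] Tn_le[of v n] that
    by (meson N_nonneg Tn_in mult_right_mono order_trans)
  define b where "b v x = (\<Sum>n. sqrt_coeff n * ip ((T ^^ n) v) x)" for v x
  have summ: "summable (\<lambda>n. norm (sqrt_coeff n * ip ((T ^^ n) v) x))"
    if "v \<in> carrier X" "x \<in> carrier X" for v x
    by (rule summable_comparison_test'[OF summable_mult2[OF sqrt_coeff_summable, of "N v * N x"]])
      (use bd that in \<open>simp add: norm_mult mult_left_mono\<close>)
  note summ' = summable_norm_cancel[OF summ]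
  have b_bd: "cmod (b v x) \<le> (\<Sum>n. \<bar>sqrt_coeff n\<bar>) * N x * N v"
    if "v \<in> carrier X" "x \<in> carrier X" for v x
  proof -
    have "cmod (b v x) \<le> (\<Sum>n. norm (sqrt_coeff n * ip ((T ^^ n) v) x))"
      unfolding b_def by (rule summable_norm[OF summ[OF that]])
    also have "\<dots> \<le> (\<Sum>n. \<bar>sqrt_coeff n\<bar> * (N v * N x))"
      by (rule suminf_le[OF _ summ[OF that] summable_mult2[OF sqrt_coeff_summable]])
        (use bd that in \<open>simp add: norm_mult mult_left_mono\<close>)
    also have "\<dots> = (\<Sum>n. \<bar>sqrt_coeff n\<bar>) * (N v * N x)"
      using suminf_mult2[OF sqrt_coeff_summable] by simp
    finally show ?thesis by (simp add: mult_ac)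
  qed
  have "\<exists>p\<in>carrier X. \<forall>v\<in>carrier X. b v x = ip v p" if x: "x \<in> carrier X" for x
  proof (rule Riesz[of "\<lambda>v. b v x" "(\<Sum>n. \<bar>sqrt_coeff n\<bar>) * N x"])
    show "b (u \<oplus> v) x = b u x + b v x" if "u \<in> carrier X" "v \<in> carrier X" for u v
      unfolding b_def using suminf_add[OF summ'[OF that(1) x] summ'[OF that(2) x]] that x
      by (simp add: Tn_lin(1)[OF that] distrib_left)
    show "b (a \<odot> v) x = a * b v x" if "v \<in> carrier X" for a v
      unfolding b_def using suminf_mult[OF summ'[OF that x], of a] that x
      by (simp add: Tn_lin(2)[OF that that] mult_ac)
  qed (use b_bd x in auto)
  then obtain q where q_in [simp]: "\<And>x. x \<in> carrier X \<Longrightarrow> q x \<in> carrier X"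
    and q: "\<And>v x. v \<in> carrier X \<Longrightarrow> x \<in> carrier X \<Longrightarrow> ip v (q x) = b v x"
    by metis
  have q': "ip (q x) y = b x y" if "x \<in> carrier X" "y \<in> carrier X" for x y
  proof -
    have "ip (q x) y = cnj (b y x)" using that by (simp add: q[symmetric] ip_cnj)
    also have "\<dots> = (\<Sum>n. cnj (sqrt_coeff n * ip ((T ^^ n) y) x))"
      unfolding b_def by (rule bounded_linear.suminf[OF bounded_linear_cnj summ'[OF that(2,1)]])
    also have "\<dots> = b x y"
      unfolding b_def using that by (simp add: ip_cnj Tn_sym)
    finally show ?thesis .
  qed
  have "symmetric_on q" using q q' by (auto simp: symmetric_on_def)
  moreover have "ip (q x) x \<in> \<real>\<^sub>\<ge>\<^sub>0" if x: "x \<in> carrier X" for x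
  proof -
    have "Im (ip (q x) x) = 0"
      using ip_cnj[of "q x" x] q q' x by (metis complex_cnj_cancel_iff cnj.simps(2) equal_neg_zero q_in)
    moreover have "0 \<le> Re (ip (q x) x)"
    proof -
      have s: "(\<lambda>n. Re (sqrt_coeff n * ip ((T ^^ n) x) x)) sums Re (b x x)"
        unfolding b_def by (rule sums_Re[OF summable_sums[OF summ'[OF x x]]])
      have "0 \<le> (\<Sum>i<n. Re (sqrt_coeff i * ip ((T ^^ i) x) x))" for n
      proof (cases n)
        case (Suc m)
        have "(\<Sum>i<n. Re (sqrt_coeff i * ip ((T ^^ i) x) x))
            = (N x)\<^sup>2 + (\<Sum>i<m. Re (sqrt_coeff (Suc i) * ip ((T ^^ Suc i) x) x))"
          unfolding Suc sum.lessThan_Suc_shift using x by (simp add: N_square)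
        moreover have "- (\<Sum>i<m. \<bar>sqrt_coeff (Suc i)\<bar> * (N x)\<^sup>2)
            \<le> (\<Sum>i<m. Re (sqrt_coeff (Suc i) * ip ((T ^^ Suc i) x) x))"
          unfolding sum_negf[symmetric]
        proof (rule sum_mono)
          fix i
          have "\<bar>Re (sqrt_coeff (Suc i) * ip ((T ^^ Suc i) x) x)\<bar>
              \<le> cmod (sqrt_coeff (Suc i) * ip ((T ^^ Suc i) x) x)"
            by (rule abs_Re_le_cmod)
          also have "\<dots> \<le> \<bar>sqrt_coeff (Suc i)\<bar> * (N x)\<^sup>2"
            unfolding norm_mult power2_eq_square norm_of_real
            by (intro mult_left_mono bd x) simp
          finally show "- (\<bar>sqrt_coeff (Suc i)\<bar> * (N x)\<^sup>2) \<le> Re (sqrt_coeff (Suc i) * ip ((T ^^ Suc i) x) x)"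
            by linarith
        qed
        moreover have "(\<Sum>i<m. \<bar>sqrt_coeff (Suc i)\<bar> * (N x)\<^sup>2) \<le> 1 * (N x)\<^sup>2"
          unfolding sum_distrib_right[symmetric] by (intro mult_right_mono sqrt_coeff_abs_sum) simp
        ultimately show ?thesis by simp
      qed simp
      then have "0 \<le> Re (b x x)"
        using LIMSEQ_le_const[OF s[unfolded sums_def]] by blast
      then show ?thesis using q'[OF x x] by simp
    qed
    ultimately show ?thesis by (simp add: complex_nonneg_Reals_iff)
  qed
  ultimately have pos: "positive_on q" by (simp add: positive_on_def)
  have "q (q x) = c x" if x: "x \<in> carrier X" for x
  proof (rule ip_eqI)
    fix v assume v: "v \<in> carrier X"
    have "ip v (q (q x)) = ip (q v) (q x)" using v x q[of v "q x"] q'[of v "q x"] by simp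
    also have "\<dots> = (\<Sum>n. sqrt_coeff n * (\<Sum>m. sqrt_coeff m * ip ((T ^^ (m + n)) v) x))"
    proof -
      have "ip ((T ^^ n) (q v)) x = (\<Sum>m. sqrt_coeff m * ip ((T ^^ (m + n)) v) x)" for n
      proof -
        have "ip ((T ^^ n) (q v)) x = b v ((T ^^ n) x)"
          using v x by (simp add: Tn_sym q')
        then show ?thesis unfolding b_def
          using v x by (simp add: Tn_sym[symmetric] funpow_add[symmetric] add.commute
            flip: comp_apply[of "T ^^ n" "T ^^ m" for n m])
      qed
      then show ?thesis using v x by (simp add: q b_def)
    qed
    also have "\<dots> = ip ((T ^^ 0) v) x - ip ((T ^^ 1) v) x"
      by (rule sqrt_coeff_double_sum[of "\<lambda>n. ip ((T ^^ n) v) x" "N v * N x"]) (rule bd[OF v x])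
    also have "\<dots> = ip v (c x)"
      using v x sc by (simp add: T_def)
    finally show "ip v (q (q x)) = ip v (c x)" .
  qed (use x in simp_all)
  moreover have "q (p x) = p (q x)"
    if p: "symmetric_on p" and com: "\<And>y. y \<in> carrier X \<Longrightarrow> p (c y) = c (p y)" and x: "x \<in> carrier X" for p x
  proof (rule ip_eqI)
    note [simp] = symmetric_onD(1)[OF p]
    note sp = symmetric_onD(2)[OF p]
    have pT: "p (T y) = T (p y)" if y: "y \<in> carrier X" for y
      using y com[OF y] symmetric_on_linear(3)[OF p, of y "c y"] by (simp add: T_def)
    have pTn: "p ((T ^^ n) y) = (T ^^ n) (p y)" if "y \<in> carrier X" for y n
      by (induction n) (use that pT in auto)
    fix v assume v: "v \<in> carrier X"
    have "b v (p x) = b (p v) x"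
      unfolding b_def using v x by (simp add: sp[symmetric] pTn)
    then show "ip v (q (p x)) = ip v (p (q x))"
      using v x by (simp add: q sp[symmetric])
  qed (use x symmetric_onD(1)[OF that(1)] in simp_all)
  ultimately show ?thesis using pos by (auto simp: positive_root_def)
qed

text \<open>Hellinger-Toeplitz bounds \<open>c\<close>, and rescaling reduces to a contraction.\<close>

lemma positive_sqrt:
  assumes c: "positive_on c"
  shows "\<exists>q. positive_root c q"
proof -
  note [simp] = positive_onD(1)[OF c]
  have sym: "symmetric_on c" using c by (simp add: positive_on_def)
  obtain C where C: "C \<ge> 0" "\<And>x. x \<in> carrier X \<Longrightarrow> N (c x) \<le> C * N x"
    using symmetric_on_bounded[OF sym] by blast
  define K where "K = C + 1"
  have K: "K > 0" using C by (simp add: K_def)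
  have scaled: "positive_on (\<lambda>x. complex_of_real r \<odot> p x)" if "positive_on p" "0 \<le> r" for p r
    using that positive_onD[OF that(1)]
    by (auto simp: positive_on_def symmetric_on_def complex_nonneg_Reals_iff)
  have pos: "positive_on (\<lambda>x. complex_of_real (1 / K) \<odot> c x)"
    using scaled[OF c, of "1 / K"] K by simp
  have le: "Re (ip (complex_of_real (1 / K) \<odot> c x) x) \<le> (N x)\<^sup>2" if x: "x \<in> carrier X" for x
  proof -
    have "Re (ip (c x) x) \<le> N (c x) * N x"
      using Cauchy_Schwarz[of "c x" x] complex_Re_le_cmod[of "ip (c x) x"] x by force
    also have "\<dots> \<le> K * N x * N x"
      using C(2)[OF x] N_nonneg[OF x] by (intro mult_right_mono) (simp_all add: K_def distrib_right)
    finally show ?thesis using x K by (simp add: field_simps power2_eq_square)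
  qed
  obtain p where root: "positive_root (\<lambda>x. complex_of_real (1 / K) \<odot> c x) p"
    using contraction_sqrt[OF pos le] by blast
  note p = positive_rootD(1)[OF root] and pp = positive_rootD(2)[OF root] and com = positive_rootD(3)[OF root]
  note [simp] = positive_onD(1)[OF p]
  have psym: "symmetric_on p" using p by (simp add: positive_on_def)
  note lin = symmetric_on_linear[OF psym]
  have "positive_root c (\<lambda>x. complex_of_real (sqrt K) \<odot> p x)"
    unfolding positive_root_def
  proof (intro conjI ballI allI impI)
    show "positive_on (\<lambda>x. complex_of_real (sqrt K) \<odot> p x)"
      using scaled[OF p] K by simp
    fix x assume x: "x \<in> carrier X"
    have "complex_of_real (sqrt K) * complex_of_real (sqrt K) = K"
      using K by (simp flip: of_real_mult)
    then have "cnj (complex_of_real (sqrt K)) * (cnj (complex_of_real (sqrt K)) * cnj (1 / K)) = 1"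
      using K by (simp add: mult.assoc[symmetric])
    then show "complex_of_real (sqrt K) \<odot> p (complex_of_real (sqrt K) \<odot> p x) = c x"
      by (intro ip_eqI) (use x in \<open>simp_all add: lin(2)[of "p x" "p x"] pp mult.assoc[symmetric]\<close>)
  next
    fix r x assume r: "symmetric_on r" and "\<forall>y\<in>carrier X. r (c y) = c (r y)" and x: "x \<in> carrier X"
    then have "p (r x) = r (p x)"
      by (intro com) (simp_all add: symmetric_on_linear(2)[OF r])
    then show "complex_of_real (sqrt K) \<odot> p (r x) = r (complex_of_real (sqrt K) \<odot> p x)"
      using x symmetric_onD(1)[OF psym] by (simp add: symmetric_on_linear(2)[OF r])
  qed
  then show ?thesis by blast
qed

text \<open>Write \<open>p = r\<^sup>2\<close>; then \<open>(p y, y) = \<parallel>r y\<parallel>\<^sup>2\<close>.\<close>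

lemma positive_kernel:
  assumes p: "positive_on p" and y: "y \<in> carrier X" and 0: "ip (p y) y = 0"
  shows "p y = \<zero>"
proof -
  obtain r where r: "positive_on r" "\<And>x. x \<in> carrier X \<Longrightarrow> r (r x) = p x"
    using positive_sqrt[OF p] by (auto simp: positive_root_def)
  note [simp] = positive_onD(1)[OF r(1)]
  have "ip (r y) (r y) = 0"
    using 0 y positive_onD(2)[OF r(1), of "r y" y] by (simp add: r(2))
  then have "r y = \<zero>" using y ip_definite by simp
  moreover have "r \<zero> = \<zero>"
    by (rule ip_eqI) (simp_all add: positive_onD(2)[OF r(1), symmetric])
  ultimately show ?thesis using r(2)[OF y] by simp
qed

text \<open>Put \<open>y = p x - q x\<close>. Because \<open>p\<close> and \<open>q\<close> commute, \<open>(p + q) y = p\<^sup>2 x - q\<^sup>2 x = 0\<close>, so the two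
  nonnegative numbers \<open>(p y, y)\<close> and \<open>(q y, y)\<close> add up to \<open>0\<close>. Then \<open>p y = 0\<close>, and \<open>y = 0\<close> by
  injectivity.\<close>

lemma positive_sqrt_unique:
  assumes p: "positive_on p" and q: "positive_on q"
    and eq: "\<And>x. x \<in> carrier X \<Longrightarrow> p (p x) = q (q x)"
    and com: "\<And>x. x \<in> carrier X \<Longrightarrow> q (p x) = p (q x)"
    and inj: "\<And>x. x \<in> carrier X \<Longrightarrow> p x = \<zero> \<Longrightarrow> x = \<zero>"
    and x: "x \<in> carrier X"
  shows "p x = q x"
proof -
  note [simp] = positive_onD(1)[OF p] positive_onD(1)[OF q]
  have sym: "symmetric_on p" "symmetric_on q" using p q by (auto simp: positive_on_def)
  define y where "y = p x \<ominus> q x"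
  have y [simp]: "y \<in> carrier X" using x by (simp add: y_def)
  have "p y = p (p x) \<ominus> p (q x)"
    using symmetric_on_linear(3)[OF sym(1)] x by (simp add: y_def)
  moreover have "q y = q (p x) \<ominus> q (q x)"
    using symmetric_on_linear(3)[OF sym(2)] x by (simp add: y_def)
  ultimately have sum: "ip (p y) y + ip (q y) y = 0"
    using x by (simp add: eq com)
  have "0 \<le> Re (ip (p y) y)" "0 \<le> Re (ip (q y) y)"
    using positive_onD(3)[OF p y] positive_onD(3)[OF q y] .
  then have "Re (ip (p y) y) = 0" using sum by (metis add_nonneg_eq_0_iff plus_complex.sel(1) zero_complex.sel(1))
  moreover have "ip (p y) y \<in> \<real>\<^sub>\<ge>\<^sub>0" using p by (simp add: positive_on_def)
  ultimately have "ip (p y) y = 0" by (simp add: complex_nonneg_Reals_iff complex_eq_iff)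
  then have "y = \<zero>" using positive_kernel[OF p y] inj[OF y] by blast
  then show ?thesis using x eq_iff_minus by (simp add: y_def)
qed

section \<open>The square root of an operator with everywhere defined inverse\<close>

definition inverse_graph :: "('a \<Rightarrow> 'a) \<Rightarrow> ('a \<times> 'a) set" where
  "inverse_graph p = {(p x, x) |x. x \<in> carrier X}"

lemma symmetric_inj_on:
  assumes p: "symmetric_on p" and inj: "\<And>x. x \<in> carrier X \<Longrightarrow> p x = \<zero> \<Longrightarrow> x = \<zero>"
  shows "inj_on p (carrier X)"
proof (rule inj_onI)
  note [simp] = symmetric_onD(1)[OF p]
  fix x y assume xy: "x \<in> carrier X" "y \<in> carrier X" "p x = p y"
  have "p (x \<ominus> y) = \<zero>"
    using symmetric_on_linear(3)[OF p xy(1,2)] xy eq_iff_minus[of "p x" "p y"] by simp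
  then show "x = y" using xy inj[of "x \<ominus> y"] eq_iff_minus[of x y] by simp
qed

text \<open>The range of \<open>p\<close> is dense since \<open>y \<bottom> ran p\<close> means \<open>p y = 0\<close>. If \<open>(y, z)\<close> lies in the adjoint, then
  \<open>(x, y) = (p x, z) = (x, p z)\<close> for all \<open>x\<close>, so \<open>y = p z\<close>.\<close>

lemma self_adjoint_inverse_graph:
  assumes p: "symmetric_on p" and inj: "\<And>x. x \<in> carrier X \<Longrightarrow> p x = \<zero> \<Longrightarrow> x = \<zero>"
  shows "self_adjoint X (inverse_graph p)"
proof -
  note [simp] = symmetric_onD(1)[OF p]
  note s = symmetric_onD(2)[OF p]
  note lin = symmetric_on_linear[OF p]
  have p0: "p \<zero> = \<zero>" by (rule lin(4)[OF zero_in zero_in])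
  have "linear_operator X (inverse_graph p)"
    unfolding linear_operator_def
  proof (intro conjI)
    show "inverse_graph p \<subseteq> carrier X \<times> carrier X" by (auto simp: inverse_graph_def)
    show "single_valued (inverse_graph p)"
      using symmetric_inj_on[OF p inj] by (auto simp: single_valued_def inverse_graph_def inj_on_def)
    show "(\<zero>, \<zero>) \<in> inverse_graph p" using p0 by (force simp: inverse_graph_def)
    show "\<forall>(x, y)\<in>inverse_graph p. \<forall>(x', y')\<in>inverse_graph p. (x \<oplus> x', y \<oplus> y') \<in> inverse_graph p"
      using lin(1) by (fastforce simp: inverse_graph_def)
    show "\<forall>a. \<forall>(x, y)\<in>inverse_graph p. (a \<odot> x, a \<odot> y) \<in> inverse_graph p"
      using lin(2) by (fastforce simp: inverse_graph_def)
  qed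
  moreover have "dense_in X (Domain (inverse_graph p))"
  proof -
    have dom: "Domain (inverse_graph p) = p ` carrier X" by (auto simp: inverse_graph_def)
    have "linear_subspace (p ` carrier X) X"
      unfolding linear_subspace_iff[OF vector_space]
      by (auto simp: lin(1)[symmetric] lin(2)[symmetric] intro: image_eqI[where x=\<zero> and f=p, OF p0[symmetric]])
    then show ?thesis
      unfolding dom dense_in_iff_orthogonal[OF \<open>linear_subspace (p ` carrier X) X\<close>]
      using s ip_definite inj by (metis imageI symmetric_onD(1)[OF p])
  qed
  moreover have "adjoint_op X (inverse_graph p) = inverse_graph p"
  proof (intro equalityI subrelI)
    fix y z assume "(y, z) \<in> adjoint_op X (inverse_graph p)"
    then have yz: "y \<in> carrier X" "z \<in> carrier X" "\<And>x. x \<in> carrier X \<Longrightarrow> ip x y = ip (p x) z"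
      by (auto simp: adjoint_op_def inverse_graph_def)
    then have "y = p z" by (intro ip_eqI) (simp_all add: s)
    then show "(y, z) \<in> inverse_graph p" using yz by (auto simp: inverse_graph_def)
  qed (auto simp: adjoint_op_def inverse_graph_def s)
  ultimately show ?thesis by (simp add: self_adjoint_def)
qed

text \<open>A self-adjoint operator with full range is the inverse of a symmetric operator defined
  everywhere.\<close>

lemma self_adjoint_surj_inverse:
  assumes S: "self_adjoint X S" and surj: "Range S = carrier X"
  obtains p where "symmetric_on p" "S = inverse_graph p" "\<And>x. x \<in> carrier X \<Longrightarrow> p x = \<zero> \<Longrightarrow> x = \<zero>"
proof -
  have SX: "S \<subseteq> carrier X \<times> carrier X" and sv: "single_valued S" and zero: "(\<zero>, \<zero>) \<in> S"
    using S by (auto simp: self_adjoint_def linear_operator_def)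
  have symS: "ip y x' = ip x y'" if "(x, y) \<in> S" "(x', y') \<in> S" for x y x' y'
  proof -
    have "(x', y') \<in> adjoint_op X S" using S that by (simp add: self_adjoint_def)
    then show ?thesis using that by (auto simp: adjoint_op_def)
  qed
  have "\<forall>y\<in>carrier X. \<exists>x. (x, y) \<in> S" using surj by auto
  then obtain p where p: "\<And>y. y \<in> carrier X \<Longrightarrow> (p y, y) \<in> S" by metis
  then have p_in: "p y \<in> carrier X" if "y \<in> carrier X" for y using that SX by blast
  show ?thesis
  proof
    show "symmetric_on p"
      unfolding symmetric_on_def
    proof (intro conjI ballI)
      fix x y assume "x \<in> carrier X" "y \<in> carrier X"
      then show "ip (p x) y = ip x (p y)" by (intro symS[symmetric] p)
    qed (use p_in in blast)
    have "x = p y" if "(x, y) \<in> S" for x y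
    proof (rule ip_eqI)
      fix z assume z: "z \<in> carrier X"
      have "y \<in> carrier X" using that SX by blast
      then show "ip z x = ip z (p y)"
        using symS[OF p[OF z] that] symS[OF p[OF z] p] by simp
    qed (use that SX p_in in blast)+
    moreover have "y \<in> carrier X" if "(x, y) \<in> S" for x y using that SX by blast
    ultimately show "S = inverse_graph p"
      using p unfolding inverse_graph_def by auto
    fix x assume "x \<in> carrier X" "p x = \<zero>"
    then have "(\<zero>, x) \<in> S" using p by metis
    then show "x = \<zero>" using sv zero by (auto simp: single_valued_def)
  qed
qed

text \<open>A nonnegative self-adjoint \<open>S\<close> with \<open>S\<^sup>2 = c\<^sup>-\<^sup>1\<close> is surjective, so it is the inverse of an everywhere
  defined positive \<open>p\<close> with \<open>p\<^sup>2 = c\<close>. This \<open>p\<close> commutes with \<open>c\<close>, hence with \<open>q\<close>, and uniqueness of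
  bounded positive roots applies.\<close>

lemma operator_sqrt_inverse_graph:
  assumes c: "positive_on c" and root: "positive_root c q"
    and inj: "\<And>x. x \<in> carrier X \<Longrightarrow> c x = \<zero> \<Longrightarrow> x = \<zero>"
  shows "operator_sqrt X (inverse_graph c) = inverse_graph q"
proof -
  note q = positive_rootD(1)[OF root] and sq = positive_rootD(2)[OF root] and com = positive_rootD(3)[OF root]
  note [simp] = positive_onD(1)[OF q] positive_onD(1)[OF c]
  have symq: "symmetric_on q" using q by (simp add: positive_on_def)
  have q0: "q \<zero> = \<zero>" by (rule symmetric_on_linear(4)[OF symq zero_in zero_in])
  have injq: "x = \<zero>" if "x \<in> carrier X" "q x = \<zero>" for x
    using inj[OF that(1)] sq[OF that(1)] that q0 by simp
  have nonneg_iff: "nonnegative_op X (inverse_graph p) \<longleftrightarrow> positive_on p" if "symmetric_on p" for p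
  proof -
    have "ip x (p x) = ip (p x) x" if "x \<in> carrier X" for x
      using symmetric_onD[OF \<open>symmetric_on p\<close>] that by simp
    then show ?thesis
      using that by (auto simp: nonnegative_op_def inverse_graph_def positive_on_def)
  qed
  show ?thesis
    unfolding operator_sqrt_def
  proof (rule the_equality, intro conjI)
    show "self_adjoint X (inverse_graph q)" by (rule self_adjoint_inverse_graph[OF symq injq])
    show "nonnegative_op X (inverse_graph q)" using nonneg_iff[OF symq] q by simp
    show "inverse_graph q O inverse_graph q = inverse_graph c"
    proof (intro equalityI subrelI)
      fix a b assume "(a, b) \<in> inverse_graph c"
      then have "b \<in> carrier X" "a = q (q b)" using sq by (auto simp: inverse_graph_def)
      then show "(a, b) \<in> inverse_graph q O inverse_graph q"
        by (intro relcompI[of a "q b"]) (auto simp: inverse_graph_def)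
    qed (auto simp: inverse_graph_def sq)
  next
    fix S assume S: "self_adjoint X S \<and> nonnegative_op X S \<and> S O S = inverse_graph c"
    have SX: "S \<subseteq> carrier X \<times> carrier X"
      using S by (auto simp: self_adjoint_def linear_operator_def)
    have "Range S = carrier X"
    proof (intro equalityI subsetI)
      fix x assume "x \<in> carrier X"
      then have "(c x, x) \<in> S O S" using S by (auto simp: inverse_graph_def)
      then show "x \<in> Range S" by auto
    qed (use SX in auto)
    then obtain p where p: "symmetric_on p" "S = inverse_graph p"
      and injp: "\<And>x. x \<in> carrier X \<Longrightarrow> p x = \<zero> \<Longrightarrow> x = \<zero>"
      using self_adjoint_surj_inverse[of S] S by blast
    note [simp] = symmetric_onD(1)[OF p(1)]
    have pos: "positive_on p" using nonneg_iff[OF p(1)] S p(2) by simp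
    have pp: "p (p x) = c x" if "x \<in> carrier X" for x
    proof -
      have "(c x, x) \<in> S O S" using S that by (auto simp: inverse_graph_def)
      then show ?thesis by (auto simp: p(2) inverse_graph_def)
    qed
    have "p x = q x" if "x \<in> carrier X" for x
    proof (rule positive_sqrt_unique[OF pos q _ _ injp that])
      show "p (p x) = q (q x)" if "x \<in> carrier X" for x using pp sq that by simp
      show "q (p x) = p (q x)" if "x \<in> carrier X" for x
        by (rule com[OF p(1)]) (use that in \<open>simp_all flip: pp\<close>)
    qed
    then show "S = inverse_graph q" by (auto simp: p(2) inverse_graph_def)
  qed
qed

end

section \<open>Isometric isomorphisms\<close>

lemma space_isoD:
  assumes "space_iso X Y \<phi>"
  shows "bij_betw \<phi> (carrier X) (carrier Y)"
    and "inj_on \<phi> (carrier X)"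
    and "\<phi> ` carrier X = carrier Y"
    and "x \<in> carrier X \<Longrightarrow> \<phi> x \<in> carrier Y"
    and "\<lbrakk>x \<in> carrier X; y \<in> carrier X\<rbrakk> \<Longrightarrow> \<phi> (x \<oplus>\<^bsub>X\<^esub> y) = \<phi> x \<oplus>\<^bsub>Y\<^esub> \<phi> y"
    and "x \<in> carrier X \<Longrightarrow> \<phi> (a \<odot>\<^bsub>X\<^esub> x) = a \<odot>\<^bsub>Y\<^esub> \<phi> x"
    and "\<lbrakk>x \<in> carrier X; y \<in> carrier X\<rbrakk> \<Longrightarrow> form Y (\<phi> x) (\<phi> y) = form X x y"
  using assms by (auto simp: space_iso_def bij_betw_def)

lemma space_iso_id: "space_iso X X id"
  by (simp add: space_iso_def)

lemma space_iso_comp: "\<lbrakk>space_iso X Y \<phi>; space_iso Y Z \<psi>\<rbrakk> \<Longrightarrow> space_iso X Z (\<psi> \<circ> \<phi>)"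
  unfolding space_iso_def by (auto intro: bij_betw_trans simp: bij_betw_apply)

lemma space_iso_inv:
  assumes V: "complex_vector_space X" and iso: "space_iso X Y \<phi>"
  shows "space_iso Y X (the_inv_into (carrier X) \<phi>)"
proof -
  note D = space_isoD[OF iso]
  have inv [simp]: "the_inv_into (carrier X) \<phi> (\<phi> x) = x" if "x \<in> carrier X" for x
    using that D(2) by (simp add: the_inv_into_f_f)
  have V': "x \<oplus>\<^bsub>X\<^esub> y \<in> carrier X" "a \<odot>\<^bsub>X\<^esub> x \<in> carrier X" if "x \<in> carrier X" "y \<in> carrier X" for x y a
    using V that unfolding complex_vector_space_iff by simp_all
  show ?thesis
    unfolding space_iso_def
    using bij_betw_the_inv_into[OF D(1)]
    by (simp add: D(3)[symmetric] D(5)[symmetric] D(6)[symmetric] D(7) V')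
qed

lemma space_iso_zero:
  assumes "complex_vector_space X" "complex_vector_space Y" "space_iso X Y \<phi>"
  shows "\<phi> \<zero>\<^bsub>X\<^esub> = \<zero>\<^bsub>Y\<^esub>"
proof -
  have 0: "\<zero>\<^bsub>X\<^esub> \<in> carrier X" "\<And>x. x \<in> carrier X \<Longrightarrow> (0::complex) \<odot>\<^bsub>X\<^esub> x = \<zero>\<^bsub>X\<^esub>"
    "\<And>x. x \<in> carrier Y \<Longrightarrow> (0::complex) \<odot>\<^bsub>Y\<^esub> x = \<zero>\<^bsub>Y\<^esub>"
    using assms(1,2) unfolding complex_vector_space_iff by simp_all
  then show ?thesis
    using space_isoD(6)[OF assms(3), of "\<zero>\<^bsub>X\<^esub>" 0] space_isoD(4)[OF assms(3)] by simp
qed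

lemma space_iso_minus:
  assumes "complex_vector_space X" "complex_vector_space Y" "space_iso X Y \<phi>"
    and "x \<in> carrier X" "y \<in> carrier X"
  shows "\<phi> (x \<ominus>\<^bsub>X\<^esub> y) = \<phi> x \<ominus>\<^bsub>Y\<^esub> \<phi> y"
proof -
  have "(-1) \<odot>\<^bsub>X\<^esub> y \<in> carrier X"
    using assms(1,5) unfolding complex_vector_space_iff by simp
  then show ?thesis
    using assms(4,5) space_isoD(4-6)[OF assms(3)]
    by (simp add: minus_eq_smult[OF assms(1)] minus_eq_smult[OF assms(2)])
qed

lemma space_iso_norm:
  "\<lbrakk>space_iso X Y \<phi>; x \<in> carrier X\<rbrakk> \<Longrightarrow> form_norm Y (\<phi> x) = form_norm X x"
  by (simp add: form_norm_def space_isoD(7))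

lemma hermitian_space_iso:
  assumes X: "hermitian_space X" and V: "complex_vector_space Y" and iso: "space_iso X Y \<phi>"
  shows "hermitian_space Y"
proof -
  interpret hermitian X using X by (rule hermitian.intro)
  note D = space_isoD[OF iso]
  show ?thesis
    unfolding hermitian_space_def D(3)[symmetric]
    using V by (simp add: D(5)[symmetric] D(6)[symmetric] D(7)) (simp add: ip_cnj)
qed

lemma hilbert_iso:
  assumes X: "hilbert X" and V: "complex_vector_space Y" and iso: "space_iso X Y \<phi>"
  shows "hilbert Y"
proof -
  interpret hilbert X by fact
  note D = space_isoD[OF iso]
  have "prehilbert Y"
  proof
    show "hermitian_space Y" by (rule hermitian_space_iso[OF hermitian V iso])
    fix y assume "y \<in> carrier Y"
    then obtain x where x: "x \<in> carrier X" "y = \<phi> x" using D(3) by blast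
    then show "form Y y y \<in> \<real>\<^sub>\<ge>\<^sub>0" by (simp add: D(7) ip_nonneg)
    assume "form Y y y = 0"
    then have "x = \<zero>\<^bsub>X\<^esub>" using x ip_definite by (simp add: D(7))
    then show "y = \<zero>\<^bsub>Y\<^esub>" using x space_iso_zero[OF vector_space V iso] by simp
  qed
  then show ?thesis
  proof (rule prehilbert_hilbertI)
    fix \<sigma> :: "nat \<Rightarrow> _" assume \<sigma>: "\<And>n. \<sigma> n \<in> carrier Y"
      and C: "\<And>e. e > 0 \<Longrightarrow> \<exists>M. \<forall>m\<ge>M. \<forall>n\<ge>M. form_norm Y (\<sigma> m \<ominus>\<^bsub>Y\<^esub> \<sigma> n) < e"
    have "\<exists>x\<in>carrier X. \<sigma> n = \<phi> x" for n using \<sigma>[of n] D(3) by auto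
    then obtain \<tau> where \<tau>: "\<And>n. \<tau> n \<in> carrier X" "\<And>n. \<sigma> n = \<phi> (\<tau> n)"
      by metis
    have eq: "form_norm Y (\<sigma> m \<ominus>\<^bsub>Y\<^esub> \<phi> x) = N (\<tau> m \<ominus>\<^bsub>X\<^esub> x)" if "x \<in> carrier X" for m :: nat and x
      using \<tau> that by (simp add: space_iso_minus[OF vector_space V iso, symmetric] space_iso_norm[OF iso])
    have C': "\<exists>M. \<forall>m\<ge>M. \<forall>n\<ge>M. N (\<tau> m \<ominus>\<^bsub>X\<^esub> \<tau> n) < e" if "e > 0" for e
      using C[OF that] unfolding \<tau>(2) by (simp add: eq[unfolded \<tau>(2)] \<tau>(1))
    obtain l where "l \<in> carrier X" "(\<lambda>n. N (\<tau> n \<ominus>\<^bsub>X\<^esub> l)) \<longlonglongrightarrow> 0"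
      by (rule Cauchy_converges[OF \<tau>(1) C'])
    then show "\<exists>l\<in>carrier Y. (\<lambda>n. form_norm Y (\<sigma> n \<ominus>\<^bsub>Y\<^esub> l)) \<longlonglongrightarrow> 0"
      using eq D(4) by (intro bexI[of _ "\<phi> l"]) simp_all
  qed
qed

text \<open>For an isometry \<open>V\<close> defined on a dense subspace, \<open>W\<close> is the adjoint.\<close>

lemma dense_isometry_adjoint:
  assumes "hilbert X" "hilbert Y" and D: "linear_subspace D X" "dense_in X D"
    and V: "\<And>x. x \<in> D \<Longrightarrow> V x \<in> carrier Y"
    and add: "\<And>x y. x \<in> D \<Longrightarrow> y \<in> D \<Longrightarrow> V (x \<oplus>\<^bsub>X\<^esub> y) = V x \<oplus>\<^bsub>Y\<^esub> V y"
    and smult: "\<And>a x. x \<in> D \<Longrightarrow> V (a \<odot>\<^bsub>X\<^esub> x) = a \<odot>\<^bsub>Y\<^esub> V x"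
    and iso: "\<And>x. x \<in> D \<Longrightarrow> form Y (V x) (V x) = form X x x"
  obtains W where "\<And>y. y \<in> carrier Y \<Longrightarrow> W y \<in> carrier X"
    "\<And>x y. x \<in> D \<Longrightarrow> y \<in> carrier Y \<Longrightarrow> form Y (V x) y = form X x (W y)"
    "\<And>y. y \<in> carrier Y \<Longrightarrow> form_norm X (W y) \<le> form_norm Y y"
proof -
  interpret X: hilbert X by fact
  interpret Y: hilbert Y by fact
  have bd: "cmod (form Y (V x) y) \<le> form_norm Y y * form_norm X x" if "x \<in> D" "y \<in> carrier Y" for x y
    using Y.Cauchy_Schwarz[OF V[OF that(1)] that(2)] iso[OF that(1)]
    by (simp add: form_norm_def mult.commute)
  have "\<exists>p\<in>carrier X. \<forall>x\<in>D. form Y (V x) y = form X x p" if y: "y \<in> carrier Y" for y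
    by (rule X.representation_on_subspace[OF D(1), of "\<lambda>x. form Y (V x) y" "form_norm Y y"])
      (use y V add smult bd in auto)
  then obtain W where W: "\<And>y. y \<in> carrier Y \<Longrightarrow> W y \<in> carrier X"
    "\<And>x y. x \<in> D \<Longrightarrow> y \<in> carrier Y \<Longrightarrow> form Y (V x) y = form X x (W y)"
    by metis
  show ?thesis
  proof (rule that[OF W])
    fix y assume y: "y \<in> carrier Y"
    show "form_norm X (W y) \<le> form_norm Y y"
      by (rule X.norm_le_if_dense[OF D]) (use y W bd in \<open>auto simp flip: W(2)\<close>)
  qed
qed

text \<open>The extension \<open>\<phi>\<close> is the adjoint of \<open>V\<^sup>-\<^sup>1\<close>, and its inverse is the adjoint \<open>W\<close> of \<open>V\<close>. Both are
  contractions, so both preserve the norm, and polarisation gives the inner product.\<close>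

lemma extend_dense_isometry:
  assumes "hilbert X" "hilbert Y"
    and D: "linear_subspace D X" "dense_in X D" and E: "linear_subspace E Y" "dense_in Y E"
    and bij: "bij_betw V D E"
    and add: "\<And>x y. x \<in> D \<Longrightarrow> y \<in> D \<Longrightarrow> V (x \<oplus>\<^bsub>X\<^esub> y) = V x \<oplus>\<^bsub>Y\<^esub> V y"
    and smult: "\<And>a x. x \<in> D \<Longrightarrow> V (a \<odot>\<^bsub>X\<^esub> x) = a \<odot>\<^bsub>Y\<^esub> V x"
    and iso: "\<And>x y. x \<in> D \<Longrightarrow> y \<in> D \<Longrightarrow> form Y (V x) (V y) = form X x y"
  obtains \<phi> where "space_iso X Y \<phi>" "\<forall>x\<in>D. \<phi> x = V x"
proof -
  interpret X: hilbert X by fact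
  interpret Y: hilbert Y by fact
  note subD = X.subspaceD[OF D(1)] and subE = Y.subspaceD[OF E(1)]
  define U where "U = the_inv_into D V"
  have inj: "inj_on V D" and VE: "V ` D = E" using bij by (auto simp: bij_betw_def)
  have V_in: "V x \<in> E" if "x \<in> D" for x using VE that by blast
  have UV: "U (V x) = x" if "x \<in> D" for x using inj that by (simp add: U_def the_inv_into_f_f)
  have U_in: "U y \<in> D" and VU: "V (U y) = y" if "y \<in> E" for y
    using inj VE that UV by auto
  have Uadd: "U (x \<oplus>\<^bsub>Y\<^esub> y) = U x \<oplus>\<^bsub>X\<^esub> U y" if "x \<in> E" "y \<in> E" for x y
    using UV[of "U x \<oplus>\<^bsub>X\<^esub> U y"] that U_in VU add subD(3) by simp
  have Usmult: "U (a \<odot>\<^bsub>Y\<^esub> y) = a \<odot>\<^bsub>X\<^esub> U y" if "y \<in> E" for a y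
    using UV[of "a \<odot>\<^bsub>X\<^esub> U y"] that U_in VU smult subD(4) by simp
  have Uiso: "form X (U x) (U y) = form Y x y" if "x \<in> E" "y \<in> E" for x y
    using iso[of "U x" "U y"] that U_in VU by simp
  obtain W where W_in: "\<And>y. y \<in> carrier Y \<Longrightarrow> W y \<in> carrier X"
    and W: "\<And>x y. x \<in> D \<Longrightarrow> y \<in> carrier Y \<Longrightarrow> form Y (V x) y = form X x (W y)"
    and W_le: "\<And>y. y \<in> carrier Y \<Longrightarrow> form_norm X (W y) \<le> form_norm Y y"
    using dense_isometry_adjoint[OF assms(1,2) D subE(1)[OF V_in] add smult iso] by blast
  obtain \<phi> where \<phi>_in: "\<And>x. x \<in> carrier X \<Longrightarrow> \<phi> x \<in> carrier Y"
    and \<phi>: "\<And>y x. y \<in> E \<Longrightarrow> x \<in> carrier X \<Longrightarrow> form X (U y) x = form Y y (\<phi> x)"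
    and \<phi>_le: "\<And>x. x \<in> carrier X \<Longrightarrow> form_norm Y (\<phi> x) \<le> form_norm X x"
    using dense_isometry_adjoint[OF assms(2,1) E subD(1)[OF U_in] Uadd Usmult Uiso] by blast
  have W\<phi>: "W (\<phi> x) = x" if "x \<in> carrier X" for x
    by (rule X.dense_eqI[OF D]) (use that W_in \<phi>_in W[symmetric] \<phi>[symmetric] V_in UV in simp_all)
  have \<phi>W: "\<phi> (W y) = y" if "y \<in> carrier Y" for y
    by (rule Y.dense_eqI[OF E]) (use that W_in \<phi>_in W[symmetric] \<phi>[symmetric] U_in VU in simp_all)
  have \<phi>_add: "\<phi> (x \<oplus>\<^bsub>X\<^esub> y) = \<phi> x \<oplus>\<^bsub>Y\<^esub> \<phi> y" if "x \<in> carrier X" "y \<in> carrier X" for x y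
    by (rule Y.dense_eqI[OF E]) (use that \<phi>_in \<phi>[symmetric] subD(1)[OF U_in] subE(1) in simp_all)
  have \<phi>_smult: "\<phi> (a \<odot>\<^bsub>X\<^esub> x) = a \<odot>\<^bsub>Y\<^esub> \<phi> x" if "x \<in> carrier X" for x a
    by (rule Y.dense_eqI[OF E]) (use that \<phi>_in \<phi>[symmetric] subD(1)[OF U_in] subE(1) in simp_all)
  have norm: "form_norm Y (\<phi> x) = form_norm X x" if "x \<in> carrier X" for x
    using \<phi>_le[OF that] W_le[OF \<phi>_in[OF that]] W\<phi>[OF that] by simp
  have Re: "Re (form Y (\<phi> x) (\<phi> y)) = Re (form X x y)" if "x \<in> carrier X" "y \<in> carrier X" for x y
  proof -
    have "(form_norm Y (\<phi> x \<oplus>\<^bsub>Y\<^esub> \<phi> y))\<^sup>2 = (form_norm X (x \<oplus>\<^bsub>X\<^esub> y))\<^sup>2"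
      using that norm[of "x \<oplus>\<^bsub>X\<^esub> y"] by (simp add: \<phi>_add)
    moreover have "(form_norm Y (\<phi> x))\<^sup>2 = (form_norm X x)\<^sup>2" "(form_norm Y (\<phi> y))\<^sup>2 = (form_norm X y)\<^sup>2"
      using that norm by simp_all
    ultimately show ?thesis
      using that \<phi>_in X.Re_ip_commute[of x y] Y.Re_ip_commute[of "\<phi> x" "\<phi> y"]
      by (simp add: X.N_square Y.N_square)
  qed
  \<comment> \<open>The imaginary part of \<open>(x, y)\<close> is the real part of \<open>(-\<i> x, y)\<close>.\<close>
  have "form Y (\<phi> x) (\<phi> y) = form X x y" if "x \<in> carrier X" "y \<in> carrier X" for x y
    using Re[OF that] Re[of "(- \<i>) \<odot>\<^bsub>X\<^esub> x" y] that \<phi>_in by (simp add: \<phi>_smult complex_eq_iff)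
  moreover have "bij_betw \<phi> (carrier X) (carrier Y)"
    by (rule bij_betwI[where g=W]) (use W_in \<phi>_in W\<phi> \<phi>W in auto)
  ultimately have "space_iso X Y \<phi>"
    using \<phi>_add \<phi>_smult by (simp add: space_iso_def)
  moreover have "\<phi> x = V x" if "x \<in> D" for x
    by (rule Y.dense_eqI[OF E])
      (use that \<phi>_in subD(1) subE(1) V_in U_in VU iso in \<open>simp_all flip: \<phi> iso\<close>)
  ultimately show ?thesis using that by blast
qed

section \<open>Bounded and continuous maps\<close>

text \<open>For a linear map \<open>f\<close> and \<open>p x = \<parallel>f x\<parallel>\<close> the left-hand side is the continuity of \<open>f\<close>. Two kinds of
  target occur, the Hilbert space of a form and the complex numbers, so only the homogeneous function
  \<open>p\<close> appears.\<close>

lemma (in prehilbert) continuity_iff_bounded: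
  assumes "\<And>r x. x \<in> carrier X \<Longrightarrow> 0 \<le> r \<Longrightarrow> p (complex_of_real r \<odot>\<^bsub>X\<^esub> x) = r * p x"
  shows "(\<forall>a\<in>carrier X. \<forall>e>0. \<exists>\<delta>>0. \<forall>x. x \<in> carrier X \<and> form_dist X a x < \<delta> \<longrightarrow> p (a \<ominus>\<^bsub>X\<^esub> x) < e) \<longleftrightarrow>
    (\<exists>C. \<forall>x\<in>carrier X. p x \<le> C * N x)" (is "?l \<longleftrightarrow> ?r")
proof
  assume ?l
  then obtain \<delta> where \<delta>: "\<delta> > 0" and
    "\<And>x. x \<in> carrier X \<Longrightarrow> form_dist X \<zero>\<^bsub>X\<^esub> x < \<delta> \<Longrightarrow> p (\<zero>\<^bsub>X\<^esub> \<ominus>\<^bsub>X\<^esub> x) < 1"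
    using zero_in zero_less_one by metis
  then have small: "p x < 1" if x: "x \<in> carrier X" "N x < \<delta>" for x
  proof -
    have "\<zero>\<^bsub>X\<^esub> \<ominus>\<^bsub>X\<^esub> ((-1) \<odot>\<^bsub>X\<^esub> x) = x" by (rule ip_eqI) (use x in simp_all)
    then show ?thesis
      using \<open>\<And>x. \<lbrakk>x \<in> carrier X; form_dist X \<zero>\<^bsub>X\<^esub> x < \<delta>\<rbrakk> \<Longrightarrow> p (\<zero>\<^bsub>X\<^esub> \<ominus>\<^bsub>X\<^esub> x) < 1\<close>[of "(-1) \<odot>\<^bsub>X\<^esub> x"] x
      by (simp add: form_dist_def)
  qed
  have "p x \<le> 2 / \<delta> * N x" if x: "x \<in> carrier X" for x
  proof (cases "N x = 0")
    case True
    then show ?thesis using assms[OF x, of 0] smult_zero[OF x] x by simp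
  next
    case False
    then have pos: "N x > 0" using N_nonneg[OF x] by linarith
    define s where "s = \<delta> / (2 * N x)"
    have s: "s > 0" using pos \<delta> by (simp add: s_def)
    have "N (complex_of_real s \<odot>\<^bsub>X\<^esub> x) = s * N x" using s x by simp
    also have "\<dots> < \<delta>" using pos \<delta> by (simp add: s_def)
    finally have "s * p x < 1" using small[of "complex_of_real s \<odot>\<^bsub>X\<^esub> x"] x s assms by simp
    then show ?thesis using pos \<delta> by (simp add: s_def field_simps)
  qed
  then show ?r by blast
next
  assume ?r
  then obtain C where C: "\<And>x. x \<in> carrier X \<Longrightarrow> p x \<le> C * N x" by blast
  show ?l
  proof (intro ballI allI impI)
    fix a and e :: real assume a: "a \<in> carrier X" and e: "e > 0"
    have "p (a \<ominus>\<^bsub>X\<^esub> x) < e" if x: "x \<in> carrier X" and d: "form_dist X a x < e / (\<bar>C\<bar> + 1)" for x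
    proof -
      have "p (a \<ominus>\<^bsub>X\<^esub> x) \<le> C * N (a \<ominus>\<^bsub>X\<^esub> x)" using C a x by simp
      also have "\<dots> \<le> (\<bar>C\<bar> + 1) * N (a \<ominus>\<^bsub>X\<^esub> x)" using a x by (intro mult_right_mono) auto
      also have "\<dots> < e"
        using d a x by (simp add: form_dist_def pos_less_divide_eq mult.commute)
      finally show ?thesis .
    qed
    then show "\<exists>\<delta>>0. \<forall>x. x \<in> carrier X \<and> form_dist X a x < \<delta> \<longrightarrow> p (a \<ominus>\<^bsub>X\<^esub> x) < e"
      using e by (intro exI[of _ "e / (\<bar>C\<bar> + 1)"]) auto
  qed
qed

lemma continuous_embedding_iff:
  assumes "prehilbert X" "prehilbert H" and sub: "carrier X \<subseteq> carrier H"
    and ops: "add X = add H" "smult X = smult H"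
  shows "continuous_map (norm_topology X) (norm_topology H) id \<longleftrightarrow>
    (\<exists>C. \<forall>x\<in>carrier X. form_norm H x \<le> C * form_norm X x)"
proof -
  interpret X: prehilbert X by fact
  interpret H: prehilbert H by fact
  have minus: "x \<ominus>\<^bsub>H\<^esub> y = x \<ominus>\<^bsub>X\<^esub> y" if "x \<in> carrier X" "y \<in> carrier X" for x y
    using that sub by (simp add: X.minus_eq H.minus_eq ops subset_iff)
  have "continuous_map (norm_topology X) (norm_topology H) id \<longleftrightarrow>
    (\<forall>a\<in>carrier X. \<forall>e>0. \<exists>\<delta>>0. \<forall>x. x \<in> carrier X \<and> form_dist X a x < \<delta> \<longrightarrow> form_norm H (a \<ominus>\<^bsub>X\<^esub> x) < e)"
    unfolding norm_topology_def X.metric.metric_continuous_map[OF H.metric.Metric_space_axioms]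
    using sub by (auto simp: form_dist_def minus subset_iff cong: conj_cong)
  also have "\<dots> \<longleftrightarrow> (\<exists>C. \<forall>x\<in>carrier X. form_norm H x \<le> C * form_norm X x)"
    by (rule X.continuity_iff_bounded) (use sub in \<open>auto simp: ops\<close>)
  finally show ?thesis .
qed

lemma continuous_functional_iff:
  assumes "prehilbert X" 
    and add: "\<And>x y. x \<in> carrier X \<Longrightarrow> y \<in> carrier X \<Longrightarrow> \<phi> (x \<oplus>\<^bsub>X\<^esub> y) = \<phi> x + \<phi> y"
    and smult: "\<And>a x. x \<in> carrier X \<Longrightarrow> \<phi> (a \<odot>\<^bsub>X\<^esub> x) = a * \<phi> x"
  shows "continuous_map (norm_topology X) euclidean \<phi> \<longleftrightarrow>
    (\<exists>C. \<forall>x\<in>carrier X. cmod (\<phi> x) \<le> C * form_norm X x)"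
proof -
  interpret X: prehilbert X by fact
  have minus: "\<phi> (x \<ominus>\<^bsub>X\<^esub> y) = \<phi> x - \<phi> y" if "x \<in> carrier X" "y \<in> carrier X" for x y
    using that by (simp add: X.minus_eq add smult)
  have "continuous_map (norm_topology X) euclidean \<phi> \<longleftrightarrow>
    (\<forall>a\<in>carrier X. \<forall>e>0. \<exists>\<delta>>0. \<forall>x. x \<in> carrier X \<and> form_dist X a x < \<delta> \<longrightarrow> cmod (\<phi> (a \<ominus>\<^bsub>X\<^esub> x)) < e)"
    unfolding norm_topology_def mtopology_is_euclidean[symmetric]
      X.metric.metric_continuous_map[OF Met_TC.Metric_space_axioms]
    by (auto simp: minus dist_norm cong: conj_cong)
  also have "\<dots> \<longleftrightarrow> (\<exists>C. \<forall>x\<in>carrier X. cmod (\<phi> x) \<le> C * form_norm X x)"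
    by (rule X.continuity_iff_bounded) (simp add: smult norm_mult)
  finally show ?thesis .
qed

section \<open>Krein spaces\<close>

lemma form_domain_simps [simp]:
  "carrier (form_domain H D t) = D" "form (form_domain H D t) = t" "add (form_domain H D t) = add H"
  "smult (form_domain H D t) = smult H" "zero (form_domain H D t) = zero H"
  by (simp_all add: form_domain_def)

lemma J_space_simps [simp]:
  "carrier (J_space K J) = carrier K" "form (J_space K J) = (\<lambda>x y. form K (J x) y)"
  "add (J_space K J) = add K" "smult (J_space K J) = smult K" "zero (J_space K J) = zero K"
  by (simp_all add: J_space_def)

lemma space_iso_subspace:
  assumes iso: "space_iso X Y \<phi>" and D: "D \<subseteq> carrier X"
    and t: "\<And>x y. x \<in> D \<Longrightarrow> y \<in> D \<Longrightarrow> u (\<phi> x) (\<phi> y) = t x y"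
  shows "space_iso (form_domain X D t) (form_domain Y (\<phi> ` D) u) \<phi>"
  using D space_isoD[OF iso] t
  by (auto simp: space_iso_def bij_betw_def inj_on_subset subset_iff)

lemma linear_subspace_iso:
  assumes X: "complex_vector_space X" "complex_vector_space Y" and iso: "space_iso X Y \<phi>"
    and D: "linear_subspace D X"
  shows "linear_subspace (\<phi> ` D) Y"
proof -
  note I = space_isoD[OF iso]
  have sub: "D \<subseteq> carrier X" and D': "\<zero>\<^bsub>X\<^esub> \<in> D" "\<And>x y. x \<in> D \<Longrightarrow> y \<in> D \<Longrightarrow> x \<oplus>\<^bsub>X\<^esub> y \<in> D"
    "\<And>a x. x \<in> D \<Longrightarrow> a \<odot>\<^bsub>X\<^esub> x \<in> D"
    using D unfolding linear_subspace_iff[OF X(1)] by auto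
  have "\<zero>\<^bsub>Y\<^esub> \<in> \<phi> ` D" using D'(1) space_iso_zero[OF X iso] by (metis imageI)
  then show ?thesis
    unfolding linear_subspace_iff[OF X(2)]
    using sub D' I by (auto simp: subset_iff simp flip: I(5,6))
qed

lemma hilbert_subspace_iso:
  assumes X: "complex_vector_space X" "complex_vector_space Y" and iso: "space_iso X Y \<phi>"
    and D: "linear_subspace D X"
    and t: "\<And>x y. x \<in> D \<Longrightarrow> y \<in> D \<Longrightarrow> u (\<phi> x) (\<phi> y) = t x y"
    and hilb: "hilbert (form_domain X D t)"
  shows "hilbert (form_domain Y (\<phi> ` D) u)"
proof (rule hilbert_iso[OF hilb])
  show "complex_vector_space (form_domain Y (\<phi> ` D) u)"
    by (rule complex_vector_space_subspace[OF X(2) linear_subspace_iso[OF X iso D]])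
  show "space_iso (form_domain X D t) (form_domain Y (\<phi> ` D) u) \<phi>"
    using D[unfolded linear_subspace_iff[OF X(1)]] t by (intro space_iso_subspace[OF iso]) auto
qed

lemma fundamental_decomposition_iff:
  "fundamental_decomposition K Kp Km \<longleftrightarrow> hermitian_space K \<and>
     linear_subspace Kp K \<and> linear_subspace Km K \<and>
     {p \<oplus>\<^bsub>K\<^esub> m |p m. p \<in> Kp \<and> m \<in> Km} = carrier K \<and> Kp \<inter> Km = {\<zero>\<^bsub>K\<^esub>} \<and>
     (\<forall>x\<in>Kp. \<forall>y\<in>Km. form K x y = 0) \<and>
     hilbert (form_domain K Kp (form K)) \<and>
     hilbert (form_domain K Km (\<lambda>x y. - form K x y))"
proof -
  have 1: "form_domain K Kp (form K) = K\<lparr>carrier := Kp\<rparr>"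
    and 2: "form_domain K Km (\<lambda>x y. - form K x y) = K\<lparr>carrier := Km, form := \<lambda>x y. - form K x y\<rparr>"
    by (simp_all add: form_domain_def)
  have 3: "Kp <+>\<^bsub>K\<^esub> Km = {p \<oplus>\<^bsub>K\<^esub> m |p m. p \<in> Kp \<and> m \<in> Km}"
    by (auto simp: set_add_def')
  show ?thesis
    unfolding fundamental_decomposition_def 1 2 3 hilbert_space_iff ..
qed

lemma fundamental_decomposition_iso:
  assumes dec: "fundamental_decomposition X Xp Xm"
    and V: "complex_vector_space Y" and iso: "space_iso X Y \<phi>"
  shows "fundamental_decomposition Y (\<phi> ` Xp) (\<phi> ` Xm)"
proof -
  note dec' = dec[unfolded fundamental_decomposition_iff]
  interpret hermitian X using dec' by (intro hermitian.intro) simp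
  note I = space_isoD[OF iso]
  have sub: "Xp \<subseteq> carrier X" "Xm \<subseteq> carrier X"
    using dec' by (auto simp: linear_subspace_iff[OF vector_space])
  have "hermitian_space Y" by (rule hermitian_space_iso[OF hermitian V iso])
  moreover have "linear_subspace (\<phi> ` Xp) Y" "linear_subspace (\<phi> ` Xm) Y"
    using dec' by (auto intro!: linear_subspace_iso[OF vector_space V iso])
  moreover have "{p \<oplus>\<^bsub>Y\<^esub> m |p m. p \<in> \<phi> ` Xp \<and> m \<in> \<phi> ` Xm} = carrier Y"
  proof (intro equalityI subsetI)
    fix y assume "y \<in> {p \<oplus>\<^bsub>Y\<^esub> m |p m. p \<in> \<phi> ` Xp \<and> m \<in> \<phi> ` Xm}"
    then obtain p m where pm: "p \<in> Xp" "m \<in> Xm" and y: "y = \<phi> p \<oplus>\<^bsub>Y\<^esub> \<phi> m" by blast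
    have "p \<in> carrier X" "m \<in> carrier X" using pm sub by auto
    then show "y \<in> carrier Y" unfolding y by (simp add: I(4) flip: I(5))
  next
    fix y assume "y \<in> carrier Y"
    then obtain x where x: "x \<in> carrier X" "y = \<phi> x" using I(3) by blast
    moreover have "carrier X = {p \<oplus>\<^bsub>X\<^esub> m |p m. p \<in> Xp \<and> m \<in> Xm}" using dec' by simp
    ultimately obtain p m where pm: "p \<in> Xp" "m \<in> Xm" "x = p \<oplus>\<^bsub>X\<^esub> m" by blast
    moreover have "p \<in> carrier X" "m \<in> carrier X" using pm sub by auto
    ultimately have "y = \<phi> p \<oplus>\<^bsub>Y\<^esub> \<phi> m" using x I(5) by simp
    then show "y \<in> {p \<oplus>\<^bsub>Y\<^esub> m |p m. p \<in> \<phi> ` Xp \<and> m \<in> \<phi> ` Xm}" using pm by blast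
  qed
  moreover have "\<phi> ` Xp \<inter> \<phi> ` Xm = {\<zero>\<^bsub>Y\<^esub>}"
    using inj_on_image_Int[OF I(2) sub] dec' space_iso_zero[OF vector_space V iso] by simp
  moreover have "\<forall>x\<in>\<phi> ` Xp. \<forall>y\<in>\<phi> ` Xm. form Y x y = 0"
    using I(7) sub dec' by (auto simp: subset_iff)
  moreover have "hilbert (form_domain Y (\<phi> ` Xp) (form Y))"
    using dec' I(7) sub by (intro hilbert_subspace_iso[OF vector_space V iso, where t="form X"]) auto
  moreover have "hilbert (form_domain Y (\<phi> ` Xm) (\<lambda>x y. - form Y x y))"
    using dec' I(7) sub
    by (intro hilbert_subspace_iso[OF vector_space V iso, where t="\<lambda>x y. - form X x y"]) auto
  ultimately show ?thesis unfolding fundamental_decomposition_iff by blast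
qed

text \<open>The image of a fundamental symmetry under an isometric isomorphism. Krein spaces are recognised
  in this way as isometric copies of known ones.\<close>

lemma fundamental_symmetry_iso:
  assumes J: "fundamental_symmetry X J" and V: "complex_vector_space Y" and iso: "space_iso X Y \<phi>"
    and J': "\<And>x. x \<in> carrier X \<Longrightarrow> J' (\<phi> x) = \<phi> (J x)"
  shows "fundamental_symmetry Y J'"
proof -
  obtain Xp Xm where dec: "fundamental_decomposition X Xp Xm"
    and JX: "\<And>x y. x \<in> Xp \<Longrightarrow> y \<in> Xm \<Longrightarrow> J (x \<oplus>\<^bsub>X\<^esub> y) = x \<ominus>\<^bsub>X\<^esub> y"
    using J by (auto simp: fundamental_symmetry_def)
  note dec' = dec[unfolded fundamental_decomposition_iff]
  interpret hermitian X using dec' by (intro hermitian.intro) simp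
  have sub: "Xp \<subseteq> carrier X" "Xm \<subseteq> carrier X"
    using dec' by (auto simp: linear_subspace_iff[OF vector_space])
  have "J' (\<phi> x \<oplus>\<^bsub>Y\<^esub> \<phi> y) = \<phi> x \<ominus>\<^bsub>Y\<^esub> \<phi> y" if "x \<in> Xp" "y \<in> Xm" for x y
  proof -
    have xy: "x \<in> carrier X" "y \<in> carrier X" using that sub by auto
    have "J' (\<phi> x \<oplus>\<^bsub>Y\<^esub> \<phi> y) = \<phi> (x \<ominus>\<^bsub>X\<^esub> y)"
      using J'[of "x \<oplus>\<^bsub>X\<^esub> y"] JX[OF that] xy by (simp add: space_isoD(5)[OF iso])
    then show ?thesis using space_iso_minus[OF vector_space V iso xy] by simp
  qed
  then show ?thesis
    using fundamental_decomposition_iso[OF dec V iso] by (auto simp: fundamental_symmetry_def)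
qed

text \<open>A Krein space with a chosen fundamental symmetry; \<open>J_space K J\<close> is the associated Hilbert space.\<close>

locale krein = 
  fixes K :: "'a form_space" and J :: "'a \<Rightarrow> 'a"
  assumes symmetry: "fundamental_symmetry K J"
begin

lemma krein_space: "krein_space K"
  using symmetry by (auto simp: fundamental_symmetry_def krein_space_def)

sublocale K: hermitian K
  using symmetry by unfold_locales (auto simp: fundamental_symmetry_def fundamental_decomposition_def)

lemma smult_minus_one_twice: "x \<in> carrier K \<Longrightarrow> (-1) \<odot>\<^bsub>K\<^esub> ((-1) \<odot>\<^bsub>K\<^esub> x) = x"
  using K.vector_space[unfolded complex_vector_space_iff] by (metis minus_mult_minus mult_1)

lemma decomposition:
  obtains Kp Km where "Kp \<subseteq> carrier K" "Km \<subseteq> carrier K"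
    "\<forall>x\<in>Kp. \<forall>y\<in>Km. J (x \<oplus>\<^bsub>K\<^esub> y) = x \<ominus>\<^bsub>K\<^esub> y"
    "\<forall>x\<in>carrier K. \<exists>p\<in>Kp. \<exists>m\<in>Km. x = p \<oplus>\<^bsub>K\<^esub> m"
    "\<forall>x\<in>Kp. \<forall>y\<in>Km. form K x y = 0 \<and> form K y x = 0"
    "hilbert (form_domain K Kp (form K))" "hilbert (form_domain K Km (\<lambda>x y. - form K x y))"
proof -
  obtain Kp Km where dec: "fundamental_decomposition K Kp Km"
    and JK: "\<And>x y. x \<in> Kp \<Longrightarrow> y \<in> Km \<Longrightarrow> J (x \<oplus>\<^bsub>K\<^esub> y) = x \<ominus>\<^bsub>K\<^esub> y"
    using symmetry by (auto simp: fundamental_symmetry_def)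
  note dec' = dec[unfolded fundamental_decomposition_iff]
  have sub: "Kp \<subseteq> carrier K" "Km \<subseteq> carrier K"
    using dec' by (auto simp: linear_subspace_iff[OF K.vector_space])
  have orth: "form K x y = 0" if "x \<in> Kp" "y \<in> Km" for x y using dec' that by blast
  have "form K y x = 0" if "x \<in> Kp" "y \<in> Km" for x y
    using orth[OF that] K.ip_cnj[of x y] that sub by auto
  then show ?thesis
    using that[of Kp Km] sub JK orth dec' by blast
qed

lemma J_closed [simp]: "x \<in> carrier K \<Longrightarrow> J x \<in> carrier K"
  and J_J [simp]: "x \<in> carrier K \<Longrightarrow> J (J x) = x"
  and J_symmetric: "\<lbrakk>x \<in> carrier K; y \<in> carrier K\<rbrakk> \<Longrightarrow> form K (J x) y = form K x (J y)"
  and J_nonneg: "x \<in> carrier K \<Longrightarrow> form K (J x) x \<in> \<real>\<^sub>\<ge>\<^sub>0"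
  and J_definite: "x \<in> carrier K \<Longrightarrow> form K (J x) x = 0 \<Longrightarrow> x = \<zero>\<^bsub>K\<^esub>"
proof -
  obtain Kp Km where sub: "Kp \<subseteq> carrier K" "Km \<subseteq> carrier K"
    and JK': "\<forall>x\<in>Kp. \<forall>y\<in>Km. J (x \<oplus>\<^bsub>K\<^esub> y) = x \<ominus>\<^bsub>K\<^esub> y"
    and split: "\<forall>x\<in>carrier K. \<exists>p\<in>Kp. \<exists>m\<in>Km. x = p \<oplus>\<^bsub>K\<^esub> m"
    and orth: "\<forall>x\<in>Kp. \<forall>y\<in>Km. form K x y = 0 \<and> form K y x = 0"
    and hp: "hilbert (form_domain K Kp (form K))" and hm: "hilbert (form_domain K Km (\<lambda>x y. - form K x y))"
    by (rule decomposition)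
  note JK = JK'[rule_format]
  interpret P: hilbert "form_domain K Kp (form K)" by (rule hp)
  interpret M: hilbert "form_domain K Km (\<lambda>x y. - form K x y)" by (rule hm)
  note [simp] = subsetD[OF sub(1)] subsetD[OF sub(2)]
  have J_minus: "J (p \<ominus>\<^bsub>K\<^esub> m) = p \<oplus>\<^bsub>K\<^esub> m" if "p \<in> Kp" "m \<in> Km" for p m
  proof -
    have m: "(-1) \<odot>\<^bsub>K\<^esub> m \<in> Km" using M.smult_in that by simp
    have "J (p \<ominus>\<^bsub>K\<^esub> m) = J (p \<oplus>\<^bsub>K\<^esub> (-1) \<odot>\<^bsub>K\<^esub> m)" using that by (simp add: K.minus_eq)
    also have "\<dots> = p \<ominus>\<^bsub>K\<^esub> (-1) \<odot>\<^bsub>K\<^esub> m" by (rule JK[OF that(1) m])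
    also have "\<dots> = p \<oplus>\<^bsub>K\<^esub> m" using that by (simp add: K.minus_eq smult_minus_one_twice)
    finally show ?thesis .
  qed
  {
    fix x assume "x \<in> carrier K"
    then obtain p m where pm: "p \<in> Kp" "m \<in> Km" and x: "x = p \<oplus>\<^bsub>K\<^esub> m" using split by blast
    show "J x \<in> carrier K" and "J (J x) = x" using pm by (simp_all add: x JK J_minus)
    have e: "form K (J x) x = form K p p + - form K m m"
      using pm by (simp add: x JK orth)
    have nn: "form K p p \<in> \<real>\<^sub>\<ge>\<^sub>0" "- form K m m \<in> \<real>\<^sub>\<ge>\<^sub>0"
      using P.ip_nonneg[of p] M.ip_nonneg[of m] pm by simp_all
    show "form K (J x) x \<in> \<real>\<^sub>\<ge>\<^sub>0" unfolding e using nn by (rule nonneg_Reals_add_I)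
    show "x = \<zero>\<^bsub>K\<^esub>" if "form K (J x) x = 0"
    proof -
      have "form K p p = 0" "- form K m m = 0"
        using that nn unfolding e by (auto simp: complex_nonneg_Reals_iff complex_eq_iff)
      then have "p = \<zero>\<^bsub>K\<^esub>" "m = \<zero>\<^bsub>K\<^esub>" using P.ip_definite[of p] M.ip_definite[of m] pm by simp_all
      then show ?thesis using K.vector_space[unfolded complex_vector_space_iff] by (simp add: x)
    qed
    fix y assume "y \<in> carrier K"
    then obtain q n where qn: "q \<in> Kp" "n \<in> Km" and y: "y = q \<oplus>\<^bsub>K\<^esub> n" using split by blast
    show "form K (J x) y = form K x (J y)"
      using pm qn by (simp add: x y JK orth)
  }
qed

lemma prehilbert_J: "prehilbert (J_space K J)"
proof
  show "hermitian_space (J_space K J)"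
    unfolding hermitian_space_def
  proof (intro conjI ballI allI)
    show "complex_vector_space (J_space K J)"
      using K.vector_space by (subst complex_vector_space_cong[of _ K]) simp_all
  qed (simp_all add: J_symmetric K.ip_cnj)
qed (simp_all add: J_nonneg J_definite)

text \<open>Completeness: the squared distance splits orthogonally into the distances of the components, so
  a Cauchy sequence has Cauchy components.\<close>

sublocale J: hilbert "J_space K J"
proof -
  interpret X: prehilbert "J_space K J" by (rule prehilbert_J)
  obtain Kp Km where sub: "Kp \<subseteq> carrier K" "Km \<subseteq> carrier K"
    and JK': "\<forall>x\<in>Kp. \<forall>y\<in>Km. J (x \<oplus>\<^bsub>K\<^esub> y) = x \<ominus>\<^bsub>K\<^esub> y"
    and split: "\<forall>x\<in>carrier K. \<exists>p\<in>Kp. \<exists>m\<in>Km. x = p \<oplus>\<^bsub>K\<^esub> m"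
    and orth: "\<forall>x\<in>Kp. \<forall>y\<in>Km. form K x y = 0 \<and> form K y x = 0"
    and hp: "hilbert (form_domain K Kp (form K))" and hm: "hilbert (form_domain K Km (\<lambda>x y. - form K x y))"
    by (rule decomposition)
  note JK = JK'[rule_format]
  let ?P = "form_domain K Kp (form K)" and ?M = "form_domain K Km (\<lambda>x y. - form K x y)"
  interpret P: hilbert ?P by (rule hp)
  interpret M: hilbert ?M by (rule hm)
  note [simp] = subsetD[OF sub(1)] subsetD[OF sub(2)]
  have dist: "(X.N ((p \<oplus>\<^bsub>K\<^esub> m) \<ominus>\<^bsub>J_space K J\<^esub> (q \<oplus>\<^bsub>K\<^esub> n)))\<^sup>2 = (P.N (p \<ominus>\<^bsub>?P\<^esub> q))\<^sup>2 + (M.N (m \<ominus>\<^bsub>?M\<^esub> n))\<^sup>2"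
    if "p \<in> Kp" "q \<in> Kp" "m \<in> Km" "n \<in> Km" for p q m n
  proof -
    have p: "p \<ominus>\<^bsub>?P\<^esub> q \<in> Kp" and m: "m \<ominus>\<^bsub>?M\<^esub> n \<in> Km" using P.minus_in M.minus_in that by simp_all
    have e: "(p \<oplus>\<^bsub>K\<^esub> m) \<ominus>\<^bsub>J_space K J\<^esub> (q \<oplus>\<^bsub>K\<^esub> n) = (p \<ominus>\<^bsub>?P\<^esub> q) \<oplus>\<^bsub>K\<^esub> (m \<ominus>\<^bsub>?M\<^esub> n)"
      by (rule X.ip_eqI) (use that in \<open>simp_all add: X.minus_eq P.minus_eq M.minus_eq\<close>)
    have "form K (J ((p \<ominus>\<^bsub>?P\<^esub> q) \<oplus>\<^bsub>K\<^esub> (m \<ominus>\<^bsub>?M\<^esub> n))) ((p \<ominus>\<^bsub>?P\<^esub> q) \<oplus>\<^bsub>K\<^esub> (m \<ominus>\<^bsub>?M\<^esub> n))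
        = form K (p \<ominus>\<^bsub>?P\<^esub> q) (p \<ominus>\<^bsub>?P\<^esub> q) - form K (m \<ominus>\<^bsub>?M\<^esub> n) (m \<ominus>\<^bsub>?M\<^esub> n)"
      using p m by (simp add: JK orth)
    moreover have "(X.N ((p \<ominus>\<^bsub>?P\<^esub> q) \<oplus>\<^bsub>K\<^esub> (m \<ominus>\<^bsub>?M\<^esub> n)))\<^sup>2
        = Re (form K (J ((p \<ominus>\<^bsub>?P\<^esub> q) \<oplus>\<^bsub>K\<^esub> (m \<ominus>\<^bsub>?M\<^esub> n))) ((p \<ominus>\<^bsub>?P\<^esub> q) \<oplus>\<^bsub>K\<^esub> (m \<ominus>\<^bsub>?M\<^esub> n)))"
      using p m by (subst X.N_square) simp_all
    ultimately show ?thesis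
      using p m P.N_square[of "p \<ominus>\<^bsub>?P\<^esub> q"] M.N_square[of "m \<ominus>\<^bsub>?M\<^esub> n"] by (simp add: e)
  qed
  show "hilbert (J_space K J)"
  proof (rule prehilbert_hilbertI[OF prehilbert_J])
    fix \<sigma> :: "nat \<Rightarrow> _" assume \<sigma>: "\<And>n. \<sigma> n \<in> carrier (J_space K J)"
      and C: "\<And>e. e > 0 \<Longrightarrow> \<exists>M. \<forall>m\<ge>M. \<forall>n\<ge>M. X.N (\<sigma> m \<ominus>\<^bsub>J_space K J\<^esub> \<sigma> n) < e"
    have "\<exists>p m. p \<in> Kp \<and> m \<in> Km \<and> \<sigma> n = p \<oplus>\<^bsub>K\<^esub> m" for n
    proof -
      have "\<sigma> n \<in> carrier K" using \<sigma>[of n] by simp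
      then show ?thesis using split by blast
    qed
    then obtain p m where p: "\<And>n. p n \<in> Kp" and m: "\<And>n. m n \<in> Km" and pm: "\<And>n. \<sigma> n = p n \<oplus>\<^bsub>K\<^esub> m n"
      by metis
    have le: "P.N (p i \<ominus>\<^bsub>?P\<^esub> p j) \<le> X.N (\<sigma> i \<ominus>\<^bsub>J_space K J\<^esub> \<sigma> j)"
      "M.N (m i \<ominus>\<^bsub>?M\<^esub> m j) \<le> X.N (\<sigma> i \<ominus>\<^bsub>J_space K J\<^esub> \<sigma> j)" for i j
    proof -
      let ?d = "X.N (\<sigma> i \<ominus>\<^bsub>J_space K J\<^esub> \<sigma> j)"
      have d: "?d\<^sup>2 = (P.N (p i \<ominus>\<^bsub>?P\<^esub> p j))\<^sup>2 + (M.N (m i \<ominus>\<^bsub>?M\<^esub> m j))\<^sup>2"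
        unfolding pm by (rule dist[OF p p m m])
      have "0 \<le> ?d" using X.N_nonneg[OF X.minus_in[OF \<sigma> \<sigma>]] .
      then show "P.N (p i \<ominus>\<^bsub>?P\<^esub> p j) \<le> ?d" "M.N (m i \<ominus>\<^bsub>?M\<^esub> m j) \<le> ?d"
        by (rule power2_le_imp_le[rotated], simp add: d)+
    qed
    obtain l where l: "l \<in> Kp" "(\<lambda>n. P.N (p n \<ominus>\<^bsub>?P\<^esub> l)) \<longlonglongrightarrow> 0"
    proof (rule P.Cauchy_converges[of p])
      show "\<exists>M. \<forall>m\<ge>M. \<forall>n\<ge>M. P.N (p m \<ominus>\<^bsub>?P\<^esub> p n) < e" if "e > 0" for e
        using C[OF that] le(1) by (meson le_less_trans)
    qed (use p in simp_all)
    obtain k where k: "k \<in> Km" "(\<lambda>n. M.N (m n \<ominus>\<^bsub>?M\<^esub> k)) \<longlonglongrightarrow> 0"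
    proof (rule M.Cauchy_converges[of m])
      show "\<exists>M. \<forall>i\<ge>M. \<forall>n\<ge>M. M.N (m i \<ominus>\<^bsub>?M\<^esub> m n) < e" if "e > 0" for e
        using C[OF that] le(2) by (meson le_less_trans)
    qed (use m in simp_all)
    have "(\<lambda>n. sqrt ((P.N (p n \<ominus>\<^bsub>?P\<^esub> l))\<^sup>2 + (M.N (m n \<ominus>\<^bsub>?M\<^esub> k))\<^sup>2)) \<longlonglongrightarrow> sqrt (0\<^sup>2 + 0\<^sup>2)"
      by (intro tendsto_intros l k)
    moreover have "sqrt ((P.N (p n \<ominus>\<^bsub>?P\<^esub> l))\<^sup>2 + (M.N (m n \<ominus>\<^bsub>?M\<^esub> k))\<^sup>2) = X.N (\<sigma> n \<ominus>\<^bsub>J_space K J\<^esub> (l \<oplus>\<^bsub>K\<^esub> k))" for n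
    proof -
      have "0 \<le> X.N (\<sigma> n \<ominus>\<^bsub>J_space K J\<^esub> (l \<oplus>\<^bsub>K\<^esub> k))"
        by (intro X.N_nonneg X.minus_in \<sigma>) (use l k in simp)
      moreover have "(X.N (\<sigma> n \<ominus>\<^bsub>J_space K J\<^esub> (l \<oplus>\<^bsub>K\<^esub> k)))\<^sup>2 = (P.N (p n \<ominus>\<^bsub>?P\<^esub> l))\<^sup>2 + (M.N (m n \<ominus>\<^bsub>?M\<^esub> k))\<^sup>2"
        unfolding pm by (rule dist[OF p l(1) m k(1)])
      ultimately show ?thesis by (intro real_sqrt_unique)
    qed
    ultimately show "\<exists>x\<in>carrier (J_space K J). (\<lambda>n. X.N (\<sigma> n \<ominus>\<^bsub>J_space K J\<^esub> x)) \<longlonglongrightarrow> 0"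
      using l k by (intro bexI[of _ "l \<oplus>\<^bsub>K\<^esub> k"]) simp_all
  qed
qed

lemma nondegenerate:
  assumes "x \<in> carrier K" "y \<in> carrier K" "\<And>z. z \<in> carrier K \<Longrightarrow> form K z x = form K z y"
  shows "x = y"
  by (rule J.ip_eqI) (use assms in simp_all)

lemma J_linear:
  assumes "x \<in> carrier K" "y \<in> carrier K"
  shows "J (x \<oplus>\<^bsub>K\<^esub> y) = J x \<oplus>\<^bsub>K\<^esub> J y" "J (a \<odot>\<^bsub>K\<^esub> x) = a \<odot>\<^bsub>K\<^esub> J x"
proof -
  have "J.symmetric_on J" by (simp add: J.symmetric_on_def J_symmetric)
  then show "J (x \<oplus>\<^bsub>K\<^esub> y) = J x \<oplus>\<^bsub>K\<^esub> J y" "J (a \<odot>\<^bsub>K\<^esub> x) = a \<odot>\<^bsub>K\<^esub> J x"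
    using J.symmetric_on_linear(1,2)[of J x y] assms by simp_all
qed

lemma J_isometry: "\<lbrakk>x \<in> carrier K; y \<in> carrier K\<rbrakk> \<Longrightarrow> form K (J x) (J y) = form K x y"
  by (simp add: J_symmetric)

lemma norm_J: "x \<in> carrier K \<Longrightarrow> form_norm (J_space K J) (J x) = form_norm (J_space K J) x"
  by (simp add: form_norm_def J_symmetric)

end

section \<open>Nonnegative operators that are self-adjoint for the indefinite inner product\<close>

text \<open>Here \<open>adjoint_op K A\<close> is the adjoint with respect to the indefinite inner product \<open>[\<cdot>, \<cdot>]\<close>.\<close>

definition krein_operator :: "'a form_space \<Rightarrow> ('a \<times> 'a) set \<Rightarrow> bool" where
  "krein_operator K A \<longleftrightarrow> linear_operator K A \<and> nonnegative_op K A \<and> adjoint_op K A = A \<and>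
     Range A = carrier K"

context krein
begin

text \<open>Since \<open>J\<^sup>2 = 1\<close> and \<open>J\<close> is symmetric, \<open>{J A x, y} = [A x, y]\<close> and \<open>{x, J z} = [x, z]\<close>.\<close>

lemma in_adjoint_J_comp_iff:
  assumes A: "A \<subseteq> carrier K \<times> carrier K" and y: "y \<in> carrier K" "z \<in> carrier K"
  shows "(y, J z) \<in> adjoint_op (J_space K J) (J_comp J A) \<longleftrightarrow> (y, z) \<in> adjoint_op K A"
proof -
  have "(form K (J (J w)) y = form K (J x) (J z)) = (form K w y = form K x z)" if "(x, w) \<in> A" for x w
  proof -
    have "x \<in> carrier K" "w \<in> carrier K" using that A by auto
    then show ?thesis using y by (simp add: J_symmetric)
  qed
  then have "(\<forall>(x, w)\<in>A. form K (J (J w)) y = form K (J x) (J z)) \<longleftrightarrow> (\<forall>(x, w)\<in>A. form K w y = form K x z)"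
    by blast
  then show ?thesis using y by (fastforce simp: adjoint_op_def J_comp_def)
qed

lemma krein_operatorI:
  assumes nn: "J_nonnegative K J A" and sa: "J_self_adjoint K J A"
    and inv: "boundedly_invertible (J_space K J) A"
  shows "krein_operator K A"
proof -
  have lin: "linear_operator K A" using sa by (simp add: J_self_adjoint_def)
  then have A: "A \<subseteq> carrier K \<times> carrier K" by (simp add: linear_operator_def)
  have adj: "adjoint_op (J_space K J) (J_comp J A) = J_comp J A"
    using sa by (simp add: J_self_adjoint_def self_adjoint_def)
  have mem: "(y, J z) \<in> J_comp J A \<longleftrightarrow> (y, z) \<in> A" if "z \<in> carrier K" for y z
  proof -
    have "z = z'" if "J z = J z'" "z' \<in> carrier K" for z'
      using that \<open>z \<in> carrier K\<close> by (metis J_J)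
    then show ?thesis using A by (fastforce simp: J_comp_def)
  qed
  have "adjoint_op K A = A"
  proof (intro equalityI subrelI)
    fix y z assume yz: "(y, z) \<in> adjoint_op K A"
    then have "y \<in> carrier K" "z \<in> carrier K" by (auto simp: adjoint_op_def)
    then show "(y, z) \<in> A" using yz in_adjoint_J_comp_iff[OF A] adj mem by blast
  next
    fix y z assume yz: "(y, z) \<in> A"
    then have "y \<in> carrier K" "z \<in> carrier K" using A by auto
    then show "(y, z) \<in> adjoint_op K A" using yz in_adjoint_J_comp_iff[OF A] adj mem by blast
  qed
  moreover have "nonnegative_op K A"
  proof -
    have "form K w x \<in> \<real>\<^sub>\<ge>\<^sub>0" if "(x, w) \<in> A" for x w
    proof -
      have "(x, J w) \<in> J_comp J A" using that by (auto simp: J_comp_def)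
      then have "form K (J (J w)) x \<in> \<real>\<^sub>\<ge>\<^sub>0"
        using nn unfolding J_nonnegative_def nonnegative_op_def by fastforce
      moreover have "w \<in> carrier K" using that A by auto
      ultimately show ?thesis by simp
    qed
    then show ?thesis by (auto simp: nonnegative_op_def)
  qed
  moreover have "Range A = carrier K" using inv by (simp add: boundedly_invertible_def Domain_converse)
  ultimately show ?thesis using lin by (simp add: krein_operator_def)
qed

text \<open>The map \<open>c = (J A)\<^sup>-\<^sup>1 = A\<^sup>-\<^sup>1 J\<close> is defined everywhere because \<open>A\<close> is surjective, and it is positive
  for \<open>{\<cdot>, \<cdot>}\<close>.\<close>

lemma krein_operator_inverse:
  assumes kA: "krein_operator K A"
  obtains c where "J.positive_on c" "J_comp J A = J.inverse_graph c"
    "\<forall>x\<in>carrier K. c x = \<zero>\<^bsub>K\<^esub> \<longrightarrow> x = \<zero>\<^bsub>K\<^esub>"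
    "\<forall>x y. (x, y) \<in> A \<longleftrightarrow> y \<in> carrier K \<and> x = c (J y)"
proof -
  have A: "A \<subseteq> carrier K \<times> carrier K" and sv: "single_valued A" and zero: "(\<zero>\<^bsub>K\<^esub>, \<zero>\<^bsub>K\<^esub>) \<in> A"
    and nn: "\<And>x w. (x, w) \<in> A \<Longrightarrow> form K w x \<in> \<real>\<^sub>\<ge>\<^sub>0"
    and adj: "adjoint_op K A = A" and ran: "Range A = carrier K"
    using kA by (auto simp: krein_operator_def linear_operator_def nonnegative_op_def)
  have sym: "form K w y = form K x z" if "(x, w) \<in> A" "(y, z) \<in> A" for x w y z
  proof -
    have "(y, z) \<in> adjoint_op K A" using that adj by simp
    then show ?thesis using that by (auto simp: adjoint_op_def)
  qed
  have "\<forall>y\<in>carrier K. \<exists>x. (x, y) \<in> A" using ran by auto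
  then obtain a where a: "\<And>y. y \<in> carrier K \<Longrightarrow> (a y, y) \<in> A" by metis
  have a_in [simp]: "a y \<in> carrier K" if "y \<in> carrier K" for y using a[OF that] A by auto
  have a_unique: "x = a y" if xy: "(x, y) \<in> A" for x y
  proof (rule nondegenerate)
    have y: "y \<in> carrier K" using xy A by auto
    show "x \<in> carrier K" "a y \<in> carrier K" using xy A y by auto
    fix z assume "z \<in> carrier K"
    then show "form K z x = form K z (a y)"
      using sym[OF a xy] sym[OF a a[OF y]] by simp
  qed
  define c where "c x = a (J x)" for x
  have c_sym: "form K (J (c x)) y = form K (J x) (c y)" if "x \<in> carrier K" "y \<in> carrier K" for x y
    using sym[OF a a, of "J x" "J y"] that by (simp add: c_def J_symmetric)
  have c_pos: "form K (J (c x)) x \<in> \<real>\<^sub>\<ge>\<^sub>0" if "x \<in> carrier K" for x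
  proof -
    have "form K (J (c x)) x = form K (J x) (c x)" using c_sym that by simp
    then show ?thesis using nn[OF a[of "J x"]] that by (simp add: c_def)
  qed
  have iff: "(x, y) \<in> A \<longleftrightarrow> y \<in> carrier K \<and> x = c (J y)" for x y
    using a a_unique A by (auto simp: c_def)
  show ?thesis
  proof
    show "J.positive_on c"
      using c_sym c_pos by (auto simp: J.positive_on_def J.symmetric_on_def c_def)
    show "\<forall>x y. (x, y) \<in> A \<longleftrightarrow> y \<in> carrier K \<and> x = c (J y)" using iff by blast
    show "J_comp J A = J.inverse_graph c"
    proof (intro equalityI subrelI)
      fix x y assume "(x, y) \<in> J_comp J A"
      then obtain y' where "y = J y'" "(x, y') \<in> A" by (auto simp: J_comp_def)
      then show "(x, y) \<in> J.inverse_graph c" by (auto simp: iff J.inverse_graph_def)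
    next
      fix x y assume "(x, y) \<in> J.inverse_graph c"
      then have y: "y \<in> carrier K" "x = c y" by (auto simp: J.inverse_graph_def)
      then have "(x, J y) \<in> A" by (simp add: iff)
      then show "(x, y) \<in> J_comp J A" using y J_J unfolding J_comp_def by force
    qed
    show "\<forall>x\<in>carrier K. c x = \<zero>\<^bsub>K\<^esub> \<longrightarrow> x = \<zero>\<^bsub>K\<^esub>"
    proof (intro ballI impI)
      fix x assume x: "x \<in> carrier K" "c x = \<zero>\<^bsub>K\<^esub>"
      then have "(\<zero>\<^bsub>K\<^esub>, J x) \<in> A" by (simp add: iff)
      then have "J x = \<zero>\<^bsub>K\<^esub>" using sv zero by (auto simp: single_valued_def)
      then show "x = \<zero>\<^bsub>K\<^esub>" using J_definite[of x] x by simp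
    qed
  qed
qed

text \<open>The domain of \<open>A\<close> is the range of the injective symmetric operator \<open>c\<close>, hence dense, and the inverse
  is bounded by the Hellinger-Toeplitz theorem.\<close>

lemma krein_operatorD:
  assumes kA: "krein_operator K A"
  shows "J_nonnegative K J A" "J_self_adjoint K J A" "boundedly_invertible (J_space K J) A"
proof -
  obtain c where c: "J.positive_on c" and graph: "J_comp J A = J.inverse_graph c"
    and inj: "\<forall>x\<in>carrier K. c x = \<zero>\<^bsub>K\<^esub> \<longrightarrow> x = \<zero>\<^bsub>K\<^esub>"
    and iff': "\<forall>x y. (x, y) \<in> A \<longleftrightarrow> y \<in> carrier K \<and> x = c (J y)"
    by (rule krein_operator_inverse[OF kA])
  note iff = iff'[rule_format]
  have sym: "J.symmetric_on c" using c by (simp add: J.positive_on_def)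
  have sa: "self_adjoint (J_space K J) (J_comp J A)"
    unfolding graph by (rule J.self_adjoint_inverse_graph[OF sym]) (use inj in simp)
  have lin: "linear_operator K A" using kA by (simp add: krein_operator_def)
  have "Domain A = Domain (J_comp J A)" by (auto simp: J_comp_def)
  then have dense: "dense_in (J_space K J) (Domain A)" using sa by (simp add: self_adjoint_def)
  show "J_self_adjoint K J A" using sa lin dense by (simp add: J_self_adjoint_def)
  have "nonnegative_op (J_space K J) (J_comp J A)"
  proof -
    have "form K (J y) (c y) \<in> \<real>\<^sub>\<ge>\<^sub>0" if "y \<in> carrier K" for y
    proof -
      have "form K (J (c y)) y \<in> \<real>\<^sub>\<ge>\<^sub>0" using c that by (simp add: J.positive_on_def)
      then show ?thesis using J.positive_onD(2)[OF c, of y y] that by simp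
    qed
    then show ?thesis unfolding graph by (auto simp: nonnegative_op_def J.inverse_graph_def)
  qed
  then show "J_nonnegative K J A" using lin dense by (simp add: J_nonnegative_def)
  obtain C where C: "\<And>x. x \<in> carrier K \<Longrightarrow> J.N (c x) \<le> C * J.N x"
    using J.symmetric_on_bounded[OF sym] by auto
  have "single_valued (A\<inverse>)" by (auto simp: single_valued_def iff)
  moreover have "Domain (A\<inverse>) = carrier K" by (auto simp: iff)
  moreover have "J.N x \<le> C * J.N y" if "(y, x) \<in> A\<inverse>" for x y
    using that C[of "J y"] by (auto simp: iff norm_J)
  ultimately show "boundedly_invertible (J_space K J) A"
    by (auto simp: boundedly_invertible_def)
qed

end

text \<open>All fundamental symmetries lead to the same condition on \<open>A\<close>.\<close>

lemma N_class_iff: "(K, A) \<in> N_class \<longleftrightarrow> (\<exists>J. fundamental_symmetry K J) \<and> krein_operator K A"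
proof
  assume "(K, A) \<in> N_class"
  then obtain J where J: "fundamental_symmetry K J" and
    p: "J_nonnegative K J A" "J_self_adjoint K J A" "boundedly_invertible (J_space K J) A"
    unfolding N_class_def by blast
  interpret krein K J using J by unfold_locales
  show "(\<exists>J. fundamental_symmetry K J) \<and> krein_operator K A" using J krein_operatorI p by blast
next
  assume "(\<exists>J. fundamental_symmetry K J) \<and> krein_operator K A"
  then obtain J where J: "fundamental_symmetry K J" and kA: "krein_operator K A" by blast
  interpret krein K J using J by unfold_locales
  show "(K, A) \<in> N_class" using krein_operatorD[OF kA] krein_space J by (auto simp: N_class_def)
qed

section \<open>Closed forms with gap point zero\<close>

text \<open>Continuity of the embedding of \<open>D\<close> into \<open>H\<close> is expressed by a norm estimate.\<close>

locale gap_form =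
  fixes H :: "'a form_space" and D :: "'a set" and t :: "'a \<Rightarrow> 'a \<Rightarrow> complex" and J :: "'a \<Rightarrow> 'a"
  assumes hilb: "hilbert H" and subspace: "linear_subspace D H" and dense: "dense_in H D"
    and symmetry: "fundamental_symmetry (form_domain H D t) J"
    and embedding: "\<exists>C. \<forall>u\<in>D. form_norm H u \<le> C * form_norm (J_space (form_domain H D t) J) u"

lemma form_shift_0 [simp]: "form_shift H t 0 = t"
  by (simp add: form_shift_def fun_eq_iff)

lemma gap_embedding_iff:
  assumes "hilbert H" "linear_subspace D H" "fundamental_symmetry (form_domain H D t) J"
  shows "continuous_map (norm_topology (J_space (form_domain H D t) J)) (norm_topology H) id \<longleftrightarrow>
    (\<exists>C. \<forall>u\<in>D. form_norm H u \<le> C * form_norm (J_space (form_domain H D t) J) u)"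
proof -
  interpret H: hilbert H by fact
  interpret krein "form_domain H D t" J by unfold_locales fact
  have "D \<subseteq> carrier H" using assms(2) H.subspaceD(1) by blast
  then show ?thesis
    using continuous_embedding_iff[OF prehilbert_J H.prehilbert_axioms] by simp
qed

lemma M_class_iff: "(H, D, t) \<in> M_class \<longleftrightarrow> (\<exists>J. gap_form H D t J)"
proof
  assume M: "(H, D, t) \<in> M_class"
  then have "hilbert H" and sub: "linear_subspace D H" "dense_in H D"
    by (auto simp: M_class_def hilbert_space_iff closed_form_def symmetric_form_def)
  moreover obtain J where "fundamental_symmetry (form_domain H D t) J"
    "continuous_map (norm_topology (J_space (form_domain H D t) J)) (norm_topology H) id"
    using M by (auto simp: M_class_def gap_point_def Let_def)
  ultimately show "\<exists>J. gap_form H D t J"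
    using gap_embedding_iff by (fastforce simp: gap_form_def)
next
  assume "\<exists>J. gap_form H D t J"
  then obtain J where "gap_form H D t J" ..
  then interpret gap_form H D t J .
  interpret krein "form_domain H D t" J by unfold_locales (rule symmetry)
  have "gap_point H D t 0"
    using krein_space symmetry embedding gap_embedding_iff[OF hilb subspace symmetry]
    by (auto simp: gap_point_def Let_def)
  moreover have "symmetric_form H D t"
    using subspace dense K.hermitian by (simp add: symmetric_form_def)
  ultimately show "(H, D, t) \<in> M_class"
    using hilb by (auto simp: M_class_def closed_form_def hilbert_space_iff)
qed

sublocale gap_form \<subseteq> H: hilbert H by (rule hilb)
sublocale gap_form \<subseteq> krein "form_domain H D t" J by unfold_locales (rule symmetry)

context gap_form
begin

lemma D_sub: "x \<in> D \<Longrightarrow> x \<in> carrier H" by (rule H.subspaceD(1)[OF subspace])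

text \<open>The functional \<open>(\<cdot>, w)\<close> is continuous on \<open>D\<close>, so the Riesz theorem in \<open>(D, t[J \<cdot>, \<cdot>])\<close> gives \<open>p\<close> with
  \<open>(v, w) = t[J v, p] = t[v, J p]\<close>, and \<open>u = J p\<close>.\<close>

lemma form_represents:
  assumes w: "w \<in> carrier H"
  obtains u where "u \<in> D" "\<And>v. v \<in> D \<Longrightarrow> t u v = form H w v"
proof -
  obtain C where C: "\<And>u. u \<in> D \<Longrightarrow> form_norm H u \<le> C * J.N u" using embedding by blast
  have "cmod (form H v w) \<le> (form_norm H w * C) * J.N v" if v: "v \<in> D" for v
  proof -
    have "cmod (form H v w) \<le> form_norm H w * form_norm H v"
      using H.Cauchy_Schwarz[of v w] D_sub[OF v] w by (simp add: mult.commute)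
    also have "\<dots> \<le> form_norm H w * (C * J.N v)" using C[OF v] w by (intro mult_left_mono) auto
    finally show ?thesis by (simp add: mult.assoc)
  qed
  then obtain p where p: "p \<in> D" "\<And>v. v \<in> D \<Longrightarrow> form H v w = t (J v) p"
    using J.Riesz[of "\<lambda>v. form H v w" "form_norm H w * C"] D_sub w by auto
  have Jp: "J p \<in> D" using J_closed[of p] p by simp
  show ?thesis
  proof (rule that[OF Jp])
    fix v assume v: "v \<in> D"
    have "t (J p) v = t p (J v)" using J_symmetric[of p v] p v by simp
    also have "\<dots> = cnj (t (J v) p)" using K.ip_cnj[of "J v" p] J_closed[of v] p v by simp
    also have "\<dots> = form H w v" using p v w D_sub by (simp add: H.ip_cnj flip: p(2))
    finally show "t (J p) v = form H w v" .
  qed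
qed

definition T :: "('a \<times> 'a) set" where
  "T = {(u, w). u \<in> D \<and> w \<in> carrier H \<and> (\<forall>v\<in>D. t u v = form H w v)}"

lemma T_unique: 
  assumes "u \<in> D" "u' \<in> D" "\<And>v. v \<in> D \<Longrightarrow> t v u = t v u'"
  shows "u = u'"
  using nondegenerate[of u u'] assms by simp

lemma T_symmetric: "\<lbrakk>(u, w) \<in> T; (u', w') \<in> T\<rbrakk> \<Longrightarrow> form H w u' = form H u w'"
proof -
  assume "(u, w) \<in> T" "(u', w') \<in> T"
  then have u: "u \<in> D" "w \<in> carrier H" "t u u' = form H w u'"
    and u': "u' \<in> D" "w' \<in> carrier H" "t u' u = form H w' u" by (auto simp: T_def)
  have "form H w u' = cnj (t u' u)" using u u' K.ip_cnj[of u' u] by simp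
  then show ?thesis using u' D_sub[OF u(1)] by (simp add: H.ip_cnj)
qed

text \<open>The largest candidate \<open>T\<close> is symmetric, so \<open>S \<subseteq> T\<close> implies \<open>T \<subseteq> T\<^sup>* \<subseteq> S\<^sup>* = S\<close>.\<close>

lemma T_eq_representing:
  assumes S: "self_adjoint H S" "Domain S \<subseteq> D" "\<forall>(u, w)\<in>S. \<forall>v\<in>D. t u v = form H w v"
  shows "S = T"
proof
  have "S \<subseteq> carrier H \<times> carrier H" using S(1) by (simp add: self_adjoint_def linear_operator_def)
  then show ST: "S \<subseteq> T" using S by (fastforce simp: T_def)
  have "T \<subseteq> adjoint_op H S"
  proof (rule subrelI)
    fix y z assume yz: "(y, z) \<in> T"
    then have "\<forall>(x, w)\<in>S. form H w y = form H x z" using ST T_symmetric by blast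
    moreover have "y \<in> carrier H" "z \<in> carrier H" using yz D_sub by (auto simp: T_def)
    ultimately show "(y, z) \<in> adjoint_op H S" by (simp add: adjoint_op_def)
  qed
  then show "T \<subseteq> S" using S(1) by (simp add: self_adjoint_def)
qed

lemma representing_operator_eq: "representing_operator H D t = T"
proof -
  have "\<exists>u. u \<in> D \<and> (\<forall>v\<in>D. t u v = form H w v)" if "w \<in> carrier H" for w
    by (rule form_represents[OF that]) blast
  then obtain r where r: "\<And>w. w \<in> carrier H \<Longrightarrow> r w \<in> D \<and> (\<forall>v\<in>D. t (r w) v = form H w v)"
    by metis
  then have rT: "(r w, w) \<in> T" if "w \<in> carrier H" for w using that by (simp add: T_def)
  have "H.symmetric_on r"
    using T_symmetric[OF rT rT] r D_sub by (auto simp: H.symmetric_on_def)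
  moreover have "x = \<zero>\<^bsub>H\<^esub>" if x: "x \<in> carrier H" "r x = \<zero>\<^bsub>H\<^esub>" for x
  proof (rule H.dense_eqI[OF subspace dense])
    fix d assume d: "d \<in> D"
    have "form H x d = t (r x) d" using r[OF x(1)] d by simp
    also have "\<dots> = 0" using K.ip_zero_left[of d] d x by simp
    finally show "form H d x = form H d \<zero>\<^bsub>H\<^esub>"
      using d D_sub x H.ip_cnj[of x d] by simp
  qed (use x in simp_all)
  ultimately have sa: "self_adjoint H (H.inverse_graph r)" by (rule H.self_adjoint_inverse_graph)
  have T: "H.inverse_graph r = T"
    by (rule T_eq_representing[OF sa]) (use r in \<open>auto simp: H.inverse_graph_def\<close>)
  show ?thesis
    unfolding representing_operator_def
  proof (rule the_equality)
    show "self_adjoint H T \<and> Domain T \<subseteq> D \<and> (\<forall>(u, w)\<in>T. \<forall>v\<in>D. t u v = form H w v)"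
      using sa unfolding T by (auto simp: T_def)
  qed (use T_eq_representing in blast)
qed

lemma range_restriction_iff:
  "(f, g) \<in> range_restriction H D t \<longleftrightarrow> f \<in> D \<and> g \<in> D \<and> (\<forall>v\<in>D. t f v = form H g v)"
  unfolding range_restriction_def representing_operator_eq using D_sub by (auto simp: T_def)

text \<open>Every \<open>g \<in> D\<close> has a preimage under \<open>A\<close>, and \<open>t[A f, f] = (A f, A f) \<ge> 0\<close>. If \<open>(y, z)\<close> lies in the adjoint
  and \<open>A u = z\<close>, then \<open>t[v, y] = t[v, u]\<close> for all \<open>v\<close> in the range of \<open>A\<close>, that is, for all \<open>v \<in> D\<close>.\<close>

lemma Phi_in_N_class: "Phi (H, D, t) \<in> N_class"
proof -
  let ?A = "range_restriction H D t" and ?K = "form_domain H D t"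
  have ex: "\<exists>f. (f, g) \<in> ?A" if "g \<in> D" for g
    using form_represents[OF D_sub[OF that]] that by (metis range_restriction_iff)
  have sym: "t g f' = t f g'" if "(f, g) \<in> ?A" "(f', g') \<in> ?A" for f g f' g'
  proof -
    have "t g f' = cnj (t f' g)" using that K.ip_cnj[of f' g] by (auto simp: range_restriction_iff)
    also have "\<dots> = cnj (form H g' g)" using that by (auto simp: range_restriction_iff)
    also have "\<dots> = form H g g'" using that D_sub by (auto simp: range_restriction_iff H.ip_cnj)
    also have "\<dots> = t f g'" using that by (auto simp: range_restriction_iff)
    finally show ?thesis .
  qed
  have "linear_operator (?K) ?A"
    unfolding linear_operator_def
  proof (intro conjI)
    show "single_valued ?A"
    proof (rule single_valuedI)
      fix f g g' assume fg: "(f, g) \<in> ?A" "(f, g') \<in> ?A"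
      show "g = g'"
      proof (rule H.dense_eqI[OF subspace dense])
        fix d assume "d \<in> D"
        then show "form H d g = form H d g'"
          using fg D_sub H.ip_cnj[of g d] H.ip_cnj[of g' d] by (auto simp: range_restriction_iff)
      qed (use fg D_sub in \<open>auto simp: range_restriction_iff\<close>)
    qed
    note [simp] = K.zero_in[simplified] K.add_in[simplified] K.smult_in[simplified]
      K.ip_add_left[simplified] K.ip_smult_left[simplified] K.ip_zero_left[simplified] D_sub
    show "(\<zero>\<^bsub>?K\<^esub>, \<zero>\<^bsub>?K\<^esub>) \<in> ?A"
      by (simp add: range_restriction_iff)
    show "\<forall>(x, y)\<in>?A. \<forall>(x', y')\<in>?A. (x \<oplus>\<^bsub>?K\<^esub> x', y \<oplus>\<^bsub>?K\<^esub> y') \<in> ?A"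
      by (auto simp: range_restriction_iff)
    show "\<forall>a. \<forall>(x, y)\<in>?A. (a \<odot>\<^bsub>?K\<^esub> x, a \<odot>\<^bsub>?K\<^esub> y) \<in> ?A"
      by (auto simp: range_restriction_iff)
  qed (auto simp: range_restriction_iff)
  moreover have "nonnegative_op (?K) ?A"
  proof -
    have "t g f \<in> \<real>\<^sub>\<ge>\<^sub>0" if "(f, g) \<in> ?A" for f g
    proof -
      have "t g f = t f g" using sym[OF that that] .
      also have "\<dots> = form H g g" using that by (auto simp: range_restriction_iff)
      finally show ?thesis using that D_sub H.ip_nonneg by (auto simp: range_restriction_iff)
    qed
    then show ?thesis by (auto simp: nonnegative_op_def)
  qed
  moreover have "adjoint_op (?K) ?A = ?A"
  proof (intro equalityI subrelI)
    fix y z assume "(y, z) \<in> adjoint_op (?K) ?A"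
    then have yz: "y \<in> D" "z \<in> D" "\<And>f g. (f, g) \<in> ?A \<Longrightarrow> t g y = t f z"
      by (auto simp: adjoint_op_def)
    obtain u where u: "(u, z) \<in> ?A" using ex yz by blast
    have "y = u"
    proof (rule T_unique)
      fix v assume "v \<in> D"
      then obtain f where "(f, v) \<in> ?A" using ex by blast
      then show "t v y = t v u" using yz(3) sym u by metis
    qed (use yz u in \<open>auto simp: range_restriction_iff\<close>)
    then show "(y, z) \<in> ?A" using u by simp
  next
    fix y z assume "(y, z) \<in> ?A"
    then have "\<forall>(x, w)\<in>?A. t w y = t x z" using sym by blast
    moreover have "y \<in> D" "z \<in> D" using \<open>(y, z) \<in> ?A\<close> range_restriction_iff by blast+
    ultimately show "(y, z) \<in> adjoint_op (?K) ?A" by (simp add: adjoint_op_def)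
  qed
  moreover have "Range ?A = D"
  proof (intro equalityI subsetI)
    show "g \<in> Range ?A" if "g \<in> D" for g using ex[OF that] by blast
    show "g \<in> D" if "g \<in> Range ?A" for g using that range_restriction_iff by blast
  qed
  ultimately have "krein_operator (?K) ?A" by (simp add: krein_operator_def)
  then show ?thesis using symmetry N_class_iff by auto
qed

end

text \<open>The image of a form with gap point \<open>0\<close> under an isometry of the Hilbert space.\<close>

lemma gap_form_iso:
  assumes gap: "gap_form H D t J" and V: "complex_vector_space H'" and iso: "space_iso H H' \<phi>"
    and t: "\<And>x y. x \<in> D \<Longrightarrow> y \<in> D \<Longrightarrow> t' (\<phi> x) (\<phi> y) = t x y"
  obtains J' where "gap_form H' (\<phi> ` D) t' J'"
proof -
  interpret gap_form H D t J by fact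
  note I = space_isoD[OF iso]
  have sub: "D \<subseteq> carrier H" using D_sub by blast
  let ?K = "form_domain H D t" and ?K' = "form_domain H' (\<phi> ` D) t'"
  interpret H': hilbert H' by (rule hilbert_iso[OF hilb V iso])
  have subspace': "linear_subspace (\<phi> ` D) H'"
    by (rule linear_subspace_iso[OF H.vector_space V iso subspace])
  have isoK: "space_iso ?K ?K' \<phi>" using space_iso_subspace[OF iso sub, of t' t] t by blast
  define J' where "J' y = \<phi> (J (the_inv_into D \<phi> y))" for y
  have J': "J' (\<phi> x) = \<phi> (J x)" if "x \<in> D" for x
    using that inj_on_subset[OF I(2) sub] by (simp add: J'_def the_inv_into_f_f)
  have V': "complex_vector_space ?K'" by (rule complex_vector_space_subspace[OF V subspace'])
  have sym: "fundamental_symmetry ?K' J'"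
    by (rule fundamental_symmetry_iso[OF symmetry V' isoK]) (use J' in simp)
  have "dense_in H' (\<phi> ` D)"
    unfolding H'.dense_in_iff_orthogonal[OF subspace']
  proof (intro ballI impI)
    fix y assume "y \<in> carrier H'" and 0: "\<forall>d\<in>\<phi> ` D. form H' d y = 0"
    then obtain x where x: "x \<in> carrier H" "y = \<phi> x" using I(3) by blast
    then have "x = \<zero>\<^bsub>H\<^esub>"
      using 0 dense I(7) D_sub by (auto simp: H.dense_in_iff_orthogonal[OF subspace])
    then show "y = \<zero>\<^bsub>H'\<^esub>" using x space_iso_zero[OF H.vector_space V iso] by simp
  qed
  moreover have "\<exists>C. \<forall>u\<in>\<phi> ` D. form_norm H' u \<le> C * form_norm (J_space ?K' J') u"
  proof -
    obtain C where C: "\<And>u. u \<in> D \<Longrightarrow> form_norm H u \<le> C * form_norm (J_space ?K J) u"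
      using embedding by blast
    have "form_norm (J_space ?K' J') (\<phi> u) = form_norm (J_space ?K J) u" if "u \<in> D" for u
      using that J_closed[of u] by (simp add: form_norm_def J' t)
    then show ?thesis using C D_sub space_iso_norm[OF iso] by auto
  qed
  ultimately show ?thesis
    using that sym subspace' H'.hilbert_axioms by (simp add: gap_form_def)
qed

section \<open>Isomorphism of triples\<close>

lemma M_iso_imp_N_iso:
  assumes m1: "gap_form H1 D1 t1 J1" and m2: "gap_form H2 D2 t2 J2"
    and iso: "M_iso (H1, D1, t1) (H2, D2, t2)"
  shows "N_iso (Phi (H1, D1, t1)) (Phi (H2, D2, t2))"
proof -
  interpret m1: gap_form H1 D1 t1 J1 by fact
  interpret m2: gap_form H2 D2 t2 J2 by fact
  obtain \<phi> where \<phi>: "space_iso H1 H2 \<phi>" and D: "D2 = \<phi> ` D1"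
    and t: "\<And>f g. f \<in> D1 \<Longrightarrow> g \<in> D1 \<Longrightarrow> t2 (\<phi> f) (\<phi> g) = t1 f g"
    using iso by auto
  note I = space_isoD[OF \<phi>]
  have K: "space_iso (form_domain H1 D1 t1) (form_domain H2 D2 t2) \<phi>"
    unfolding D by (rule space_iso_subspace[OF \<phi>]) (use m1.D_sub t in auto)
  let ?A1 = "range_restriction H1 D1 t1" and ?A2 = "range_restriction H2 D2 t2"
  have mem: "(\<phi> f, \<phi> g) \<in> ?A2 \<longleftrightarrow> (f, g) \<in> ?A1" if "f \<in> D1" "g \<in> D1" for f g
    using that m1.D_sub
    by (simp add: m1.range_restriction_iff m2.range_restriction_iff[unfolded D] D t I(7))
  have "\<phi> ` Domain ?A1 = Domain ?A2"
  proof (intro equalityI subsetI)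
    fix y assume "y \<in> \<phi> ` Domain ?A1"
    then obtain f g where fg: "(f, g) \<in> ?A1" "y = \<phi> f" by blast
    then show "y \<in> Domain ?A2" using mem by (auto simp: m1.range_restriction_iff intro!: DomainI)
  next
    fix y assume "y \<in> Domain ?A2"
    then obtain z where yz: "(y, z) \<in> ?A2" by blast
    then have "y \<in> \<phi> ` D1" "z \<in> \<phi> ` D1" by (simp_all add: m2.range_restriction_iff flip: D)
    then obtain f g where fg: "f \<in> D1" "g \<in> D1" "y = \<phi> f" "z = \<phi> g" by blast
    then show "y \<in> \<phi> ` Domain ?A1" using mem yz by blast
  qed
  moreover have "?A1 = {(x, y) \<in> D1 \<times> D1. (\<phi> x, \<phi> y) \<in> ?A2}"
    using mem m1.range_restriction_iff by auto
  ultimately show ?thesis using K by auto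
qed

text \<open>The isomorphism \<open>\<psi>\<close> of Krein triples preserves \<open>t\<close> and \<open>A\<close>, hence also the inner product
  \<open>(f, g) = t[A\<^sup>-\<^sup>1 f, g]\<close> on the dense subspaces \<open>D1\<close> and \<open>D2\<close>.\<close>

lemma N_iso_imp_M_iso:
  assumes m1: "gap_form H1 D1 t1 J1" and m2: "gap_form H2 D2 t2 J2"
    and iso: "N_iso (Phi (H1, D1, t1)) (Phi (H2, D2, t2))"
  shows "M_iso (H1, D1, t1) (H2, D2, t2)"
proof -
  interpret m1: gap_form H1 D1 t1 J1 by fact
  interpret m2: gap_form H2 D2 t2 J2 by fact
  let ?A1 = "range_restriction H1 D1 t1" and ?A2 = "range_restriction H2 D2 t2"
  obtain \<psi> where \<psi>: "space_iso (form_domain H1 D1 t1) (form_domain H2 D2 t2) \<psi>"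
    and A: "?A1 = {(x, y) \<in> D1 \<times> D1. (\<psi> x, \<psi> y) \<in> ?A2}"
    using iso by auto
  note I = space_isoD[OF \<psi>, simplified]
  have ip: "form H2 (\<psi> f) (\<psi> g) = form H1 f g" if fg: "f \<in> D1" "g \<in> D1" for f g
  proof -
    obtain u where u: "(u, f) \<in> ?A1"
      using m1.form_represents[OF m1.D_sub[OF fg(1)]] fg(1) by (metis m1.range_restriction_iff)
    then have "(\<psi> u, \<psi> f) \<in> ?A2" using A by blast
    then have "form H2 (\<psi> f) (\<psi> g) = t2 (\<psi> u) (\<psi> g)"
      using fg I(4) by (simp add: m2.range_restriction_iff)
    also have "\<dots> = t1 u g" using u fg I(7) by (simp add: m1.range_restriction_iff)
    also have "\<dots> = form H1 f g" using u fg by (simp add: m1.range_restriction_iff)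
    finally show ?thesis .
  qed
  obtain \<phi> where \<phi>: "space_iso H1 H2 \<phi>" "\<forall>x\<in>D1. \<phi> x = \<psi> x"
    by (rule extend_dense_isometry[OF m1.hilb m2.hilb m1.subspace m1.dense m2.subspace m2.dense I(1) I(5,6) ip])
  have "D2 = \<phi> ` D1" using I(3) \<phi>(2) by auto
  then show ?thesis using \<phi> I(7) by auto
qed

section \<open>The form triple of a Krein triple\<close>

lemma N_iso_iff:
  "N_iso (K1, A1) (K2, A2) \<longleftrightarrow> (\<exists>\<psi>. space_iso K1 K2 \<psi> \<and> \<psi> ` Domain A1 = Domain A2 \<and>
     (\<forall>x y. (x, y) \<in> A1 \<longleftrightarrow> x \<in> carrier K1 \<and> y \<in> carrier K1 \<and> (\<psi> x, \<psi> y) \<in> A2))"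
  by (simp add: set_eq_iff)

lemma complex_vector_space_iso:
  assumes X: "complex_vector_space X" and bij: "bij_betw \<phi> (carrier X) (carrier Y)"
    and add: "\<And>x y. x \<in> carrier X \<Longrightarrow> y \<in> carrier X \<Longrightarrow> \<phi> (x \<oplus>\<^bsub>X\<^esub> y) = \<phi> x \<oplus>\<^bsub>Y\<^esub> \<phi> y"
    and smult: "\<And>a x. x \<in> carrier X \<Longrightarrow> \<phi> (a \<odot>\<^bsub>X\<^esub> x) = a \<odot>\<^bsub>Y\<^esub> \<phi> x"
    and zero: "\<phi> \<zero>\<^bsub>X\<^esub> = \<zero>\<^bsub>Y\<^esub>"
  shows "complex_vector_space Y"
proof -
  have Y: "carrier Y = \<phi> ` carrier X" using bij by (simp add: bij_betw_def)
  have closed: "x \<oplus>\<^bsub>X\<^esub> y \<in> carrier X" "a \<odot>\<^bsub>X\<^esub> x \<in> carrier X" "\<zero>\<^bsub>X\<^esub> \<in> carrier X"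
    if "x \<in> carrier X" "y \<in> carrier X" for x y a
    using X that unfolding complex_vector_space_iff by simp_all
  have laws: "(x \<oplus>\<^bsub>X\<^esub> y) \<oplus>\<^bsub>X\<^esub> z = x \<oplus>\<^bsub>X\<^esub> (y \<oplus>\<^bsub>X\<^esub> z)" "x \<oplus>\<^bsub>X\<^esub> y = y \<oplus>\<^bsub>X\<^esub> x"
    "\<zero>\<^bsub>X\<^esub> \<oplus>\<^bsub>X\<^esub> x = x" "(0::complex) \<odot>\<^bsub>X\<^esub> x = \<zero>\<^bsub>X\<^esub>" "1 \<odot>\<^bsub>X\<^esub> x = x" "(a + b) \<odot>\<^bsub>X\<^esub> x = a \<odot>\<^bsub>X\<^esub> x \<oplus>\<^bsub>X\<^esub> b \<odot>\<^bsub>X\<^esub> x"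
    "a \<odot>\<^bsub>X\<^esub> (x \<oplus>\<^bsub>X\<^esub> y) = a \<odot>\<^bsub>X\<^esub> x \<oplus>\<^bsub>X\<^esub> a \<odot>\<^bsub>X\<^esub> y" "(a * b) \<odot>\<^bsub>X\<^esub> x = a \<odot>\<^bsub>X\<^esub> (b \<odot>\<^bsub>X\<^esub> x)"
    if "x \<in> carrier X" "y \<in> carrier X" "z \<in> carrier X" for x y z a b
    using X that unfolding complex_vector_space_iff by blast+
  have z: "\<zero>\<^bsub>X\<^esub> \<in> carrier X" using X unfolding complex_vector_space_iff by simp
  show ?thesis
    unfolding complex_vector_space_iff Y ball_simps
  proof (intro conjI ballI allI)
    show "\<zero>\<^bsub>Y\<^esub> \<in> \<phi> ` carrier X" using zero z by (metis imageI)
  qed (simp_all add: closed z laws(1) laws(3-8) flip: add smult zero, simp add: laws(2))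
qed

text \<open>Here \<open>c = (J A)\<^sup>-\<^sup>1\<close> and \<open>q = (J A)\<^sup>-\<^sup>1\<^sup>/\<^sup>2\<close>. The domain of \<open>S = q\<^sup>-\<^sup>1 = (J A)\<^sup>1\<^sup>/\<^sup>2\<close> is \<open>D = K\<^sub>+\<close>.\<close>

locale krein_triple = krein +
  fixes A :: "('a \<times> 'a) set" and c q :: "'a \<Rightarrow> 'a"
  assumes c: "J.positive_on c" and graph: "J_comp J A = J.inverse_graph c"
    and c_inj: "\<forall>x\<in>carrier K. c x = \<zero>\<^bsub>K\<^esub> \<longrightarrow> x = \<zero>\<^bsub>K\<^esub>"
    and A_iff: "(x, y) \<in> A \<longleftrightarrow> y \<in> carrier K \<and> x = c (J y)"
    and root: "J.positive_root c q"

lemma krein_triple_exists: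
  assumes "fundamental_symmetry K J" "krein_operator K A"
  obtains c q where "krein_triple K J A c q"
proof -
  interpret krein K J using assms by unfold_locales
  obtain c where c: "J.positive_on c" "J_comp J A = J.inverse_graph c"
    "\<forall>x\<in>carrier K. c x = \<zero>\<^bsub>K\<^esub> \<longrightarrow> x = \<zero>\<^bsub>K\<^esub>"
    "\<forall>x y. (x, y) \<in> A \<longleftrightarrow> y \<in> carrier K \<and> x = c (J y)"
    by (rule krein_operator_inverse[OF assms(2)])
  obtain q where "J.positive_root c q" using J.positive_sqrt[OF c(1)] by blast
  then have "krein_triple K J A c q" using c by unfold_locales auto
  then show ?thesis by (rule that)
qed

context krein_triple
begin

lemma q_positive: "J.positive_on q" by (rule J.positive_rootD(1)[OF root])
lemma q_symmetric_on: "J.symmetric_on q" using q_positive by (simp add: J.positive_on_def)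

lemma c_in [simp]: "x \<in> carrier K \<Longrightarrow> c x \<in> carrier K"
  using J.positive_onD(1)[OF c] by simp
lemma q_in [simp]: "x \<in> carrier K \<Longrightarrow> q x \<in> carrier K"
  using J.positive_onD(1)[OF q_positive] by simp
lemma q_q: "x \<in> carrier K \<Longrightarrow> q (q x) = c x"
  using J.positive_rootD(2)[OF root] by simp
lemma q_symmetric: "\<lbrakk>x \<in> carrier K; y \<in> carrier K\<rbrakk> \<Longrightarrow> form K (J (q x)) y = form K (J x) (q y)"
  using J.positive_onD(2)[OF q_positive, of x y] by simp
lemma q_add: "\<lbrakk>x \<in> carrier K; y \<in> carrier K\<rbrakk> \<Longrightarrow> q (x \<oplus>\<^bsub>K\<^esub> y) = q x \<oplus>\<^bsub>K\<^esub> q y"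
  using J.symmetric_on_linear(1)[OF q_symmetric_on, of x y] by simp
lemma q_smult: "x \<in> carrier K \<Longrightarrow> q (a \<odot>\<^bsub>K\<^esub> x) = a \<odot>\<^bsub>K\<^esub> q x"
  using J.symmetric_on_linear(2)[OF q_symmetric_on, of x x] by simp
lemma q_zero: "q \<zero>\<^bsub>K\<^esub> = \<zero>\<^bsub>K\<^esub>"
  using J.symmetric_on_linear(4)[OF q_symmetric_on J.zero_in J.zero_in] by simp

lemma q_kernel: "x \<in> carrier K \<Longrightarrow> q x = \<zero>\<^bsub>K\<^esub> \<Longrightarrow> x = \<zero>\<^bsub>K\<^esub>"
  using c_inj q_q[of x] q_zero by simp

lemma q_inj: "inj_on q (carrier K)"
  using J.symmetric_inj_on[OF q_symmetric_on] q_kernel by simp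

abbreviation D :: "'a set" where "D \<equiv> q ` carrier K"
definition S :: "'a \<Rightarrow> 'a" where "S = the_inv_into (carrier K) q"
definition t :: "'a \<Rightarrow> 'a \<Rightarrow> complex" where "t u v = form K (S u) (S v)"

lemma S_q [simp]: "x \<in> carrier K \<Longrightarrow> S (q x) = x"
  using q_inj by (simp add: S_def the_inv_into_f_f)

lemma sqrt_eq: "operator_sqrt (J_space K J) (J_comp J A) = J.inverse_graph q"
  unfolding graph by (rule J.operator_sqrt_inverse_graph[OF c root]) (use c_inj in simp)

lemma op_app_sqrt: "x \<in> carrier K \<Longrightarrow> op_app (J.inverse_graph q) (q x) = x"
  unfolding op_app_def J.inverse_graph_def using q_inj by (auto simp: inj_on_def)

lemma D_subspace: "linear_subspace D (J_space K J)"
  unfolding linear_subspace_iff[OF J.vector_space]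
proof (intro conjI)
  show "\<zero>\<^bsub>J_space K J\<^esub> \<in> D" using imageI[OF K.zero_in, of q] by (simp add: q_zero)
qed (auto simp flip: q_add q_smult)

lemma D_dense: "dense_in (J_space K J) D"
proof -
  have "self_adjoint (J_space K J) (J.inverse_graph q)"
    by (rule J.self_adjoint_inverse_graph[OF q_symmetric_on]) (use q_kernel in simp)
  moreover have "Domain (J.inverse_graph q) = D" by (auto simp: J.inverse_graph_def)
  ultimately show ?thesis by (simp add: self_adjoint_def)
qed

lemma iso_q: "space_iso K (form_domain (J_space K J) D t) q"
  using q_inj by (auto simp: space_iso_def bij_betw_def q_add q_smult t_def)

text \<open>The map \<open>q\<close> is an isometry of \<open>K\<close> onto \<open>(D, t)\<close>, which makes \<open>(D, t)\<close> a Krein space; the boundedness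
  of \<open>q\<close> makes its embedding into \<open>(K, {\<cdot>, \<cdot>})\<close> continuous.\<close>

lemma gap_form_triple: "gap_form (J_space K J) D t (\<lambda>u. q (J (S u)))"
  unfolding gap_form_def
proof (intro conjI)
  let ?K = "form_domain (J_space K J) D t" and ?J = "\<lambda>u. q (J (S u))"
  have V: "complex_vector_space (?K)"
    by (rule complex_vector_space_subspace[OF J.vector_space D_subspace])
  show "fundamental_symmetry (?K) ?J"
    by (rule fundamental_symmetry_iso[OF symmetry V iso_q]) simp
  obtain C where C: "\<And>x. x \<in> carrier K \<Longrightarrow> J.N (q x) \<le> C * J.N x"
    using J.symmetric_on_bounded[OF q_symmetric_on] by auto
  have "form_norm (J_space (?K) ?J) (q x) = J.N x"
    if "x \<in> carrier K" for x using that by (simp add: form_norm_def t_def)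
  then show "\<exists>C. \<forall>u\<in>D. J.N u \<le> C * form_norm (J_space (?K) ?J) u"
    using C by auto
qed (rule J.hilbert_axioms D_subspace D_dense)+

text \<open>The range restriction maps \<open>q x\<close> to \<open>q y\<close> iff \<open>[x, v] = {q y, q v} = {c y, v} = [J c y, v]\<close> for all
  \<open>v\<close>, that is, \<open>J x = c y\<close>, which says \<open>A (J x) = J y\<close>. So \<open>q x \<mapsto> J x\<close> is the isomorphism.\<close>

lemma N_iso_Phi_triple: "N_iso (Phi (J_space K J, D, t)) (K, A)"
proof -
  interpret M: gap_form "J_space K J" D t "\<lambda>u. q (J (S u))" by (rule gap_form_triple)
  let ?R = "range_restriction (J_space K J) D t"
  have mem: "(q x, q y) \<in> ?R \<longleftrightarrow> (J x, J y) \<in> A" if "x \<in> carrier K" "y \<in> carrier K" for x y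
  proof -
    have "(q x, q y) \<in> ?R \<longleftrightarrow> (\<forall>v\<in>carrier K. form K x v = form K (J (c y)) v)"
      using that by (auto simp: M.range_restriction_iff t_def q_symmetric simp flip: q_q)
    also have "\<dots> \<longleftrightarrow> x = J (c y)"
    proof
      assume *: "\<forall>v\<in>carrier K. form K x v = form K (J (c y)) v"
      show "x = J (c y)"
      proof (rule nondegenerate)
        fix z assume z: "z \<in> carrier K"
        have "cnj (form K x z) = cnj (form K (J (c y)) z)" using * z by simp
        then show "form K z x = form K z (J (c y))" using that z by (simp add: K.ip_cnj)
      qed (use that in simp_all)
    qed simp
    also have "\<dots> \<longleftrightarrow> J x = c y" using that by (metis J_J c_in)
    also have "\<dots> \<longleftrightarrow> (J x, J y) \<in> A" using that by (simp add: A_iff)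
    finally show ?thesis .
  qed
  let ?\<psi> = "J \<circ> S"
  have "space_iso K K J"
    unfolding space_iso_def
    by (auto simp: J_linear J_isometry intro!: bij_betwI[where g=J])
  moreover have "space_iso (form_domain (J_space K J) D t) K S"
    unfolding S_def by (rule space_iso_inv[OF K.vector_space iso_q])
  ultimately have iso: "space_iso (form_domain (J_space K J) D t) K ?\<psi>" by (rule space_iso_comp[rotated])
  have R: "?R \<subseteq> D \<times> D" by (auto simp: M.range_restriction_iff)
  have A: "A \<subseteq> carrier K \<times> carrier K" by (auto simp: A_iff)
  have "?\<psi> ` Domain ?R = Domain A"
  proof (intro equalityI subsetI)
    fix z assume "z \<in> ?\<psi> ` Domain ?R"
    then obtain u w where uw: "(u, w) \<in> ?R" "z = J (S u)" by auto
    then obtain x y where "u = q x" "w = q y" "x \<in> carrier K" "y \<in> carrier K" using R by blast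
    then show "z \<in> Domain A" using uw mem by auto
  next
    fix z assume "z \<in> Domain A"
    then obtain w where zw: "(z, w) \<in> A" by auto
    then have in_K: "z \<in> carrier K" "w \<in> carrier K" using A by auto
    then have "(q (J z), q (J w)) \<in> ?R" using zw by (simp add: mem)
    then show "z \<in> ?\<psi> ` Domain ?R" using in_K by (intro image_eqI[where x="q (J z)"]) auto
  qed
  moreover have "(u, w) \<in> ?R \<longleftrightarrow> u \<in> D \<and> w \<in> D \<and> (?\<psi> u, ?\<psi> w) \<in> A" for u w
    using R mem by auto
  ultimately show ?thesis
    unfolding Phi.simps N_iso_iff using iso by (intro exI[of _ ?\<psi>]) simp
qed

text \<open>The isometry of \<open>(K, {\<cdot>, \<cdot>})\<close> onto \<open>K\<^sub>-\<close>: it is \<open>A\<^sub>- q\<close>, since \<open>{S f, x} = {f, q x}\<^sub>+\<close>.\<close>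

definition U :: "'a \<Rightarrow> 'a \<Rightarrow> complex" where
  "U x = restrict (\<lambda>f. form K (J (S f)) x) D"

lemma U_q [simp]: "y \<in> carrier K \<Longrightarrow> U x (q y) = form K (J y) x"
  by (simp add: U_def)

lemma U_eqI: "\<lbrakk>\<And>y. y \<in> carrier K \<Longrightarrow> \<phi> (q y) = U x (q y); \<phi> \<in> extensional D\<rbrakk> \<Longrightarrow> \<phi> = U x"
  by (rule extensionalityI[of _ D]) (auto simp: U_def)

lemma K_plus_simps:
  "carrier (K_plus J K A) = D" "add (K_plus J K A) = add K" "smult (K_plus J K A) = smult K"
  "zero (K_plus J K A) = zero K"
  "\<lbrakk>x \<in> carrier K; y \<in> carrier K\<rbrakk> \<Longrightarrow> form (K_plus J K A) (q x) (q y) = form K (J x) y"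
proof -
  have "Domain (J.inverse_graph q) = D" by (auto simp: J.inverse_graph_def)
  then show "carrier (K_plus J K A) = D" "add (K_plus J K A) = add K" "smult (K_plus J K A) = smult K"
    "zero (K_plus J K A) = zero K"
    "\<lbrakk>x \<in> carrier K; y \<in> carrier K\<rbrakk> \<Longrightarrow> form (K_plus J K A) (q x) (q y) = form K (J x) y"
    unfolding K_plus_def Let_def sqrt_eq by (simp_all add: op_app_sqrt)
qed

lemma iso_K_plus: "space_iso (J_space K J) (K_plus J K A) q"
  using q_inj by (auto simp: space_iso_def bij_betw_def q_add q_smult K_plus_simps)

lemma hilbert_K_plus: "hilbert (K_plus J K A)"
proof (rule hilbert_iso[OF J.hilbert_axioms _ iso_K_plus])
  have "complex_vector_space (form_domain (J_space K J) D t)"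
    by (rule complex_vector_space_subspace[OF J.vector_space D_subspace])
  then show "complex_vector_space (K_plus J K A)"
    by (subst complex_vector_space_cong[of _ "form_domain (J_space K J) D t"]) (simp_all add: K_plus_simps)
qed

lemma A_minus_q: "x \<in> carrier K \<Longrightarrow> A_minus J K A (q x) = U x"
  by (rule U_eqI) (simp_all add: A_minus_def K_plus_simps)

text \<open>For \<open>g = q y\<close> one has \<open>[g, f] = {q y, J f} = {y, q J f}\<close>.\<close>

lemma K_embed_eq: "f \<in> carrier K \<Longrightarrow> K_embed J K A f = U (q (J f))"
  by (rule U_eqI) (simp_all add: K_embed_def K_plus_simps J_isometry flip: q_symmetric)

lemma U_inj: "inj_on U (carrier K)"
proof (rule inj_onI)
  fix x y assume xy: "x \<in> carrier K" "y \<in> carrier K" "U x = U y"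
  have "form K (J z) x = form K (J z) y" if "z \<in> carrier K" for z
    using U_q[OF that, of x] U_q[OF that, of y] xy by simp
  then show "x = y" using xy by (intro J.ip_eqI) simp_all
qed

lemma A_minus_inv: "x \<in> carrier K \<Longrightarrow> the_inv_into D (A_minus J K A) (U x) = q x"
proof -
  assume x: "x \<in> carrier K"
  have "inj_on (A_minus J K A) D"
    using U_inj by (auto simp: inj_on_def A_minus_q)
  then show ?thesis
    by (rule the_inv_into_f_eq) (use x in \<open>simp_all add: A_minus_q\<close>)
qed

lemma K_embed_inv: "f \<in> carrier K \<Longrightarrow> the_inv_into (carrier K) (K_embed J K A) (U (q f)) = J f"
proof -
  assume f: "f \<in> carrier K"
  have "inj_on (K_embed J K A) (carrier K)"
  proof (rule inj_onI)
    fix x y assume xy: "x \<in> carrier K" "y \<in> carrier K" "K_embed J K A x = K_embed J K A y"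
    then have "J x = J y" using inj_onD[OF U_inj] inj_onD[OF q_inj] by (simp add: K_embed_eq)
    then show "x = y" using xy by (metis J_J)
  qed
  then show ?thesis
    by (rule the_inv_into_f_eq) (use f in \<open>simp_all add: K_embed_eq\<close>)
qed

lemma K_minus_simps:
  "add (K_minus J K A) \<phi> \<psi> = restrict (\<lambda>f. \<phi> f + \<psi> f) D"
  "smult (K_minus J K A) a \<phi> = restrict (\<lambda>f. cnj a * \<phi> f) D"
  "zero (K_minus J K A) = restrict (\<lambda>f. 0) D"
  "x \<in> carrier K \<Longrightarrow> form (K_minus J K A) (U x) \<psi> = \<psi> (q x)"
  by (simp_all add: K_minus_def Let_def K_plus_simps A_minus_inv)

lemma K_minus_carrier: "\<phi> \<in> carrier (K_minus J K A) \<longleftrightarrow> \<phi> \<in> extensional D \<and>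
    (\<forall>x\<in>carrier K. \<forall>y\<in>carrier K. \<phi> (q (x \<oplus>\<^bsub>K\<^esub> y)) = \<phi> (q x) + \<phi> (q y)) \<and>
    (\<forall>a. \<forall>x\<in>carrier K. \<phi> (q (a \<odot>\<^bsub>K\<^esub> x)) = a * \<phi> (q x)) \<and>
    (\<exists>C. \<forall>x\<in>carrier K. cmod (\<phi> (q x)) \<le> C * J.N x)"
proof -
  interpret P: hilbert "K_plus J K A" by (rule hilbert_K_plus)
  have norm: "P.N (q x) = J.N x" if "x \<in> carrier K" for x
    using space_iso_norm[OF iso_K_plus, of x] that by simp
  have "\<phi> \<in> carrier (K_minus J K A) \<longleftrightarrow> \<phi> \<in> extensional D \<and>
    (\<forall>x\<in>carrier K. \<forall>y\<in>carrier K. \<phi> (q (x \<oplus>\<^bsub>K\<^esub> y)) = \<phi> (q x) + \<phi> (q y)) \<and>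
    (\<forall>a. \<forall>x\<in>carrier K. \<phi> (q (a \<odot>\<^bsub>K\<^esub> x)) = a * \<phi> (q x)) \<and>
    continuous_map (norm_topology (K_plus J K A)) euclidean \<phi>"
    by (simp add: K_minus_def Let_def K_plus_simps q_add q_smult)
  moreover have "continuous_map (norm_topology (K_plus J K A)) euclidean \<phi> \<longleftrightarrow>
      (\<exists>C. \<forall>x\<in>carrier K. cmod (\<phi> (q x)) \<le> C * J.N x)"
    if "\<forall>x\<in>carrier K. \<forall>y\<in>carrier K. \<phi> (q (x \<oplus>\<^bsub>K\<^esub> y)) = \<phi> (q x) + \<phi> (q y)"
      "\<forall>a. \<forall>x\<in>carrier K. \<phi> (q (a \<odot>\<^bsub>K\<^esub> x)) = a * \<phi> (q x)"
    by (subst continuous_functional_iff[OF P.prehilbert_axioms])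
      (use that in \<open>auto simp: K_plus_simps norm q_add q_smult\<close>)
  ultimately show ?thesis by blast
qed

text \<open>Surjectivity is the Riesz theorem, applied to \<open>x \<mapsto> \<phi> (q x)\<close>; the conjugated scalar multiplication of
  \<open>K\<^sub>-\<close> makes \<open>U\<close> linear.\<close>

lemma iso_K_minus: "space_iso (J_space K J) (K_minus J K A) U"
proof -
  have add: "U (x \<oplus>\<^bsub>K\<^esub> y) = U x \<oplus>\<^bsub>K_minus J K A\<^esub> U y" if "x \<in> carrier K" "y \<in> carrier K" for x y
    by (rule U_eqI[symmetric]) (use that in \<open>simp_all add: K_minus_simps\<close>)
  have smult: "U (a \<odot>\<^bsub>K\<^esub> x) = a \<odot>\<^bsub>K_minus J K A\<^esub> U x" if "x \<in> carrier K" for a x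
    by (rule U_eqI[symmetric]) (use that in \<open>simp_all add: K_minus_simps\<close>)
  have "U ` carrier K = carrier (K_minus J K A)"
  proof (intro equalityI subsetI)
    fix \<phi> assume "\<phi> \<in> U ` carrier K"
    then obtain x where x: "x \<in> carrier K" "\<phi> = U x" by blast
    have "cmod (form K (J y) x) \<le> J.N x * J.N y" if "y \<in> carrier K" for y
      using J.Cauchy_Schwarz[of y x] x that by (simp add: mult.commute)
    moreover have "U x \<in> extensional D" by (simp add: U_def)
    ultimately show "\<phi> \<in> carrier (K_minus J K A)"
      using x by (auto simp: K_minus_carrier J_linear)
  next
    fix \<phi> assume "\<phi> \<in> carrier (K_minus J K A)"
    then have ext: "\<phi> \<in> extensional D"
      and lin: "\<And>x y. x \<in> carrier K \<Longrightarrow> y \<in> carrier K \<Longrightarrow> \<phi> (q (x \<oplus>\<^bsub>K\<^esub> y)) = \<phi> (q x) + \<phi> (q y)"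
        "\<And>a x. x \<in> carrier K \<Longrightarrow> \<phi> (q (a \<odot>\<^bsub>K\<^esub> x)) = a * \<phi> (q x)"
      and "\<exists>C. \<forall>x\<in>carrier K. cmod (\<phi> (q x)) \<le> C * J.N x"
      unfolding K_minus_carrier by blast+
    then obtain C where C: "\<And>x. x \<in> carrier K \<Longrightarrow> cmod (\<phi> (q x)) \<le> C * J.N x" by blast
    obtain p where p: "p \<in> carrier (J_space K J)"
      "\<And>v. v \<in> carrier (J_space K J) \<Longrightarrow> \<phi> (q v) = form (J_space K J) v p"
      using J.Riesz[of "\<lambda>x. \<phi> (q x)" C] lin C by auto
    have "\<phi> = U p" by (rule U_eqI) (use p ext in simp_all)
    then show "\<phi> \<in> U ` carrier K" using p by simp
  qed
  then show ?thesis
    using U_inj add smult by (auto simp: space_iso_def bij_betw_def K_minus_simps)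
qed

lemma complex_vector_space_K_minus: "complex_vector_space (K_minus J K A)"
proof (rule complex_vector_space_iso[OF J.vector_space])
  show "U \<zero>\<^bsub>J_space K J\<^esub> = \<zero>\<^bsub>K_minus J K A\<^esub>"
    by (rule U_eqI[symmetric]) (simp_all add: K_minus_simps)
qed (use space_isoD[OF iso_K_minus] in auto)

lemma M_iso_Psi: "M_iso (J_space K J, D, t) (Psi J (K, A))"
proof -
  have "K_embed J K A ` carrier K = U ` D"
  proof -
    have "K_embed J K A ` carrier K = (\<lambda>f. U (q (J f))) ` carrier K"
      by (rule image_cong) (simp_all add: K_embed_eq)
    also have "\<dots> = U ` q ` J ` carrier K" by (simp add: image_image)
    also have "J ` carrier K = carrier K"
      by (rule bij_betw_imp_surj_on[OF bij_betwI[where g=J]]) auto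
    finally show ?thesis .
  qed
  then show ?thesis
    using iso_K_minus by (auto simp: t_def K_embed_inv J_isometry intro!: exI[of _ U])
qed

lemma Psi_in_M_class: "Psi J (K, A) \<in> M_class"
proof -
  let ?D = "K_embed J K A ` carrier K"
  obtain \<phi> where \<phi>: "space_iso (J_space K J) (K_minus J K A) \<phi>" "?D = \<phi> ` D"
    "\<forall>f\<in>D. \<forall>g\<in>D. t f g = snd (snd (Psi J (K, A))) (\<phi> f) (\<phi> g)"
    using M_iso_Psi by auto
  obtain J' where "gap_form (K_minus J K A) (\<phi> ` D) (snd (snd (Psi J (K, A)))) J'"
    by (rule gap_form_iso[OF gap_form_triple complex_vector_space_K_minus \<phi>(1)])
      (use \<phi>(3) in auto)
  then show ?thesis unfolding Psi.simps \<phi>(2) M_class_iff by auto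
qed

end

section \<open>The bijection\<close>

lemma M_iso_refl: "M_iso m m"
proof (cases m)
  case (fields H D t)
  then show ?thesis using space_iso_id[of H] by (auto intro!: exI[of _ id])
qed

lemma M_iso_sym:
  assumes m: "m \<in> M_class" and iso: "M_iso m m'"
  shows "M_iso m' m"
proof -
  obtain H D t where mH: "m = (H, D, t)" by (cases m)
  obtain H' D' t' where m': "m' = (H', D', t')" by (cases m')
  obtain J where "gap_form H D t J" using m unfolding mH M_class_iff ..
  then interpret gap_form H D t J .
  obtain \<phi> where \<phi>: "space_iso H H' \<phi>" "D' = \<phi> ` D" "\<And>f g. f \<in> D \<Longrightarrow> g \<in> D \<Longrightarrow> t f g = t' (\<phi> f) (\<phi> g)"
    using iso unfolding mH m' by auto
  let ?\<psi> = "the_inv_into (carrier H) \<phi>"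
  have [simp]: "?\<psi> (\<phi> f) = f" if "f \<in> D" for f
    using space_isoD(2)[OF \<phi>(1)] D_sub[OF that] by (rule the_inv_into_f_f)
  have "?\<psi> ` D' = D" unfolding \<phi>(2) by (force simp: image_image)
  then show ?thesis
    unfolding mH m' using space_iso_inv[OF H.vector_space \<phi>(1)] \<phi>(2,3) by auto
qed

lemma M_iso_trans: "\<lbrakk>M_iso m1 m2; M_iso m2 m3\<rbrakk> \<Longrightarrow> M_iso m1 m3"
proof -
  assume iso: "M_iso m1 m2" "M_iso m2 m3"
  obtain H1 D1 t1 where m1: "m1 = (H1, D1, t1)" by (cases m1)
  obtain H2 D2 t2 where m2: "m2 = (H2, D2, t2)" by (cases m2)
  obtain H3 D3 t3 where m3: "m3 = (H3, D3, t3)" by (cases m3)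
  obtain \<phi> where \<phi>: "space_iso H1 H2 \<phi>" "D2 = \<phi> ` D1" "\<And>f g. f \<in> D1 \<Longrightarrow> g \<in> D1 \<Longrightarrow> t1 f g = t2 (\<phi> f) (\<phi> g)"
    using iso(1) unfolding m1 m2 by auto
  obtain \<psi> where \<psi>: "space_iso H2 H3 \<psi>" "D3 = \<psi> ` D2" "\<And>f g. f \<in> D2 \<Longrightarrow> g \<in> D2 \<Longrightarrow> t2 f g = t3 (\<psi> f) (\<psi> g)"
    using iso(2) unfolding m2 m3 by auto
  have "D3 = (\<psi> \<circ> \<phi>) ` D1" using \<phi>(2) \<psi>(2) by auto
  then show ?thesis
    unfolding m1 m3 using space_iso_comp[OF \<phi>(1) \<psi>(1)] \<phi>(2,3) \<psi>(3) by auto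
qed

lemma N_iso_refl: "n \<in> N_class \<Longrightarrow> N_iso n n"
proof (cases n)
  case (Pair K A)
  assume "n \<in> N_class"
  then have "A \<subseteq> carrier K \<times> carrier K"
    by (auto simp: Pair N_class_iff krein_operator_def linear_operator_def)
  then show ?thesis
    unfolding Pair using space_iso_id[of K] by (auto intro!: exI[of _ id])
qed

lemma N_iso_sym:
  assumes n: "n \<in> N_class" "n' \<in> N_class" and iso: "N_iso n n'"
  shows "N_iso n' n"
proof -
  obtain K A where nK: "n = (K, A)" by (cases n)
  obtain K' A' where n': "n' = (K', A')" by (cases n')
  have A: "A \<subseteq> carrier K \<times> carrier K" "A' \<subseteq> carrier K' \<times> carrier K'"
    using n by (auto simp: nK n' N_class_iff krein_operator_def linear_operator_def)
  obtain J where "fundamental_symmetry K J" using n(1) unfolding nK N_class_iff by blast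
  then interpret krein K J by unfold_locales
  obtain \<psi> where \<psi>: "space_iso K K' \<psi>" "\<psi> ` Domain A = Domain A'"
    "\<forall>x y. (x, y) \<in> A \<longleftrightarrow> x \<in> carrier K \<and> y \<in> carrier K \<and> (\<psi> x, \<psi> y) \<in> A'"
    using iso unfolding nK n' N_iso_iff by blast
  note I = space_isoD[OF \<psi>(1)]
  let ?\<chi> = "the_inv_into (carrier K) \<psi>"
  have inv [simp]: "?\<chi> (\<psi> x) = x" if "x \<in> carrier K" for x
    using I(2) that by (rule the_inv_into_f_f)
  have "?\<chi> ` Domain A' = Domain A"
  proof -
    have "(\<lambda>x. ?\<chi> (\<psi> x)) ` Domain A = id ` Domain A"
      by (rule image_cong) (use A in auto)
    then show ?thesis unfolding \<psi>(2)[symmetric] by (simp add: image_image)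
  qed
  moreover have "(x', y') \<in> A' \<longleftrightarrow> x' \<in> carrier K' \<and> y' \<in> carrier K' \<and> (?\<chi> x', ?\<chi> y') \<in> A" for x' y'
  proof (cases "x' \<in> carrier K' \<and> y' \<in> carrier K'")
    case True
    then obtain x y where "x \<in> carrier K" "y \<in> carrier K" "x' = \<psi> x" "y' = \<psi> y"
      using I(3) by (metis imageE)
    then show ?thesis using True \<psi>(3) by simp
  qed (use A(2) in auto)
  ultimately show ?thesis
    unfolding nK n' N_iso_iff using space_iso_inv[OF K.vector_space \<psi>(1)] by (intro exI[of _ ?\<chi>]) simp
qed

lemma N_iso_trans: "\<lbrakk>N_iso n1 n2; N_iso n2 n3\<rbrakk> \<Longrightarrow> N_iso n1 n3"
proof -
  assume iso: "N_iso n1 n2" "N_iso n2 n3"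
  obtain K1 A1 where n1: "n1 = (K1, A1)" by (cases n1)
  obtain K2 A2 where n2: "n2 = (K2, A2)" by (cases n2)
  obtain K3 A3 where n3: "n3 = (K3, A3)" by (cases n3)
  obtain \<phi> where \<phi>: "space_iso K1 K2 \<phi>" "\<phi> ` Domain A1 = Domain A2"
    "\<forall>x y. (x, y) \<in> A1 \<longleftrightarrow> x \<in> carrier K1 \<and> y \<in> carrier K1 \<and> (\<phi> x, \<phi> y) \<in> A2"
    using iso(1) unfolding n1 n2 N_iso_iff by blast
  obtain \<psi> where \<psi>: "space_iso K2 K3 \<psi>" "\<psi> ` Domain A2 = Domain A3"
    "\<forall>x y. (x, y) \<in> A2 \<longleftrightarrow> x \<in> carrier K2 \<and> y \<in> carrier K2 \<and> (\<psi> x, \<psi> y) \<in> A3"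
    using iso(2) unfolding n2 n3 N_iso_iff by blast
  have "(\<psi> \<circ> \<phi>) ` Domain A1 = Domain A3"
    unfolding \<psi>(2)[symmetric] \<phi>(2)[symmetric] by (rule image_comp[symmetric])
  moreover have "(x, y) \<in> A1 \<longleftrightarrow> x \<in> carrier K1 \<and> y \<in> carrier K1 \<and> ((\<psi> \<circ> \<phi>) x, (\<psi> \<circ> \<phi>) y) \<in> A3" for x y
    using \<phi>(3) \<psi>(3) space_isoD(4)[OF \<phi>(1)] by auto
  ultimately show ?thesis
    unfolding n1 n3 N_iso_iff using space_iso_comp[OF \<phi>(1) \<psi>(1)]
    by (intro exI[of _ "\<psi> \<circ> \<phi>"]) simp
qed

declare M_iso.simps [simp del] N_iso.simps [simp del] Phi.simps [simp del]

lemma equiv_M: "equiv M_class M_rel"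
proof (rule equivI)
  show "sym M_rel" by (rule symI) (simp add: M_rel_def M_iso_sym)
  show "trans M_rel" by (rule transI) (auto simp: M_rel_def intro: M_iso_trans)
qed (auto simp: M_rel_def refl_on_def M_iso_refl)

lemma equiv_N: "equiv N_class N_rel"
proof (rule equivI)
  show "sym N_rel" by (rule symI) (simp add: N_rel_def N_iso_sym)
  show "trans N_rel" by (rule transI) (auto simp: N_rel_def intro: N_iso_trans)
qed (auto simp: N_rel_def refl_on_def N_iso_refl)

lemma Phi_in_N: "m \<in> M_class \<Longrightarrow> Phi m \<in> N_class"
  by (cases m) (use M_class_iff gap_form.Phi_in_N_class in blast)

lemma M_iso_iff_N_iso:
  assumes "m1 \<in> M_class" "m2 \<in> M_class"
  shows "M_iso m1 m2 \<longleftrightarrow> N_iso (Phi m1) (Phi m2)"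
proof -
  obtain H1 D1 t1 where m1: "m1 = (H1, D1, t1)" by (cases m1)
  obtain H2 D2 t2 where m2: "m2 = (H2, D2, t2)" by (cases m2)
  obtain J1 where J1: "gap_form H1 D1 t1 J1" using assms(1) unfolding m1 M_class_iff ..
  obtain J2 where J2: "gap_form H2 D2 t2 J2" using assms(2) unfolding m2 M_class_iff ..
  show ?thesis
    unfolding m1 m2 using M_iso_imp_N_iso[OF J1 J2] N_iso_imp_M_iso[OF J1 J2] by blast
qed

lemma Phi_class_eq:
  assumes m: "m \<in> M_class"
  shows "Phi_class (M_rel `` {m}) = N_rel `` {Phi m}"
proof -
  have "N_rel `` {Phi m'} = N_rel `` {Phi m}" if "m' \<in> M_rel `` {m}" for m'
  proof -
    have m': "m' \<in> M_class" "M_iso m m'" using that by (auto simp: M_rel_def)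
    then have "(Phi m, Phi m') \<in> N_rel"
      using M_iso_iff_N_iso[OF m m'(1)] Phi_in_N[OF m] Phi_in_N[OF m'(1)] by (simp add: N_rel_def)
    then show ?thesis using equiv_class_eq[OF equiv_N] by metis
  qed
  moreover have "m \<in> M_rel `` {m}" using equiv_class_self[OF equiv_M m] .
  ultimately show ?thesis unfolding Phi_class_def by blast
qed

lemma Phi_class_inj: "inj_on Phi_class (M_class // M_rel)"
proof (rule inj_onI)
  fix C1 C2 assume "C1 \<in> M_class // M_rel" "C2 \<in> M_class // M_rel" and eq: "Phi_class C1 = Phi_class C2"
  then obtain m1 m2 where m: "m1 \<in> M_class" "m2 \<in> M_class" and C: "C1 = M_rel `` {m1}" "C2 = M_rel `` {m2}"
    by (auto elim!: quotientE)
  have "N_rel `` {Phi m1} = N_rel `` {Phi m2}" using eq m by (simp add: C Phi_class_eq)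
  then have "N_iso (Phi m1) (Phi m2)"
    using eq_equiv_class[OF _ equiv_N Phi_in_N[OF m(2)]] by (auto simp: N_rel_def)
  then have "(m1, m2) \<in> M_rel" using m M_iso_iff_N_iso[OF m] by (simp add: M_rel_def)
  then show "C1 = C2" unfolding C by (rule equiv_class_eq[OF equiv_M])
qed

text \<open>The preimage of \<open>(K, A)\<close> is \<open>(K, {\<cdot>, \<cdot>})\<close> with the form \<open>t[q x, q y] = [x, y]\<close>.\<close>

lemma form_triple_preimage:
  fixes K :: "'a form_space"
  assumes n: "(K, A) \<in> N_class" and J: "fundamental_symmetry K J"
  obtains m :: "'a form_triple" where "m \<in> M_class" "N_iso (Phi m) (K, A)"
    "M_iso m (Psi J (K, A))" "Psi J (K, A) \<in> M_class"
proof -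
  have "krein_operator K A" using n by (simp add: N_class_iff)
  then obtain c q where "krein_triple K J A c q" using krein_triple_exists[OF J] by blast
  then interpret krein_triple K J A c q .
  have "(J_space K J, D, t) \<in> M_class" using gap_form_triple M_class_iff by blast
  then show ?thesis using that N_iso_Phi_triple M_iso_Psi Psi_in_M_class by blast
qed

lemma Phi_class_bij: "bij_betw Phi_class (M_class // M_rel) (N_class // N_rel)"
  unfolding bij_betw_def
proof (intro conjI Phi_class_inj equalityI subsetI)
  fix C assume "C \<in> Phi_class ` (M_class // M_rel)"
  then obtain m where m: "m \<in> M_class" and C: "C = Phi_class (M_rel `` {m})"
    by (auto elim!: quotientE)
  show "C \<in> N_class // N_rel"
    unfolding C Phi_class_eq[OF m] by (rule quotientI[OF Phi_in_N[OF m]])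
next
  fix C :: "'a krein_triple set" assume "C \<in> N_class // N_rel"
  then obtain K A where n: "(K, A) \<in> N_class" and C: "C = N_rel `` {(K, A)}"
    by (auto elim!: quotientE)
  obtain J where "fundamental_symmetry K J" using n N_class_iff by blast
  then obtain m :: "'a form_triple" where m: "m \<in> M_class" "N_iso (Phi m) (K, A)"
    using form_triple_preimage[OF n] by blast
  then have "(Phi m, (K, A)) \<in> N_rel" using Phi_in_N[OF m(1)] n by (simp add: N_rel_def)
  then have "C = Phi_class (M_rel `` {m})"
    unfolding C Phi_class_eq[OF m(1)] using equiv_class_eq[OF equiv_N] by metis
  then show "C \<in> Phi_class ` (M_class // M_rel)" by (rule image_eqI) (rule quotientI[OF m(1)])
qed

lemma Psi_properties:
  fixes K :: "'a form_space"
  assumes n: "(K, A) \<in> N_class" and J: "fundamental_symmetry K J"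
  shows "Psi J (K, A) \<in> M_class" "N_iso (Phi (Psi J (K, A))) (K, A)"
    "inv_into (M_class // M_rel) Phi_class (N_rel `` {(K, A)}) = {m \<in> M_class. M_iso m (Psi J (K, A))}"
proof -
  obtain m :: "'a form_triple" where m: "m \<in> M_class" and Phi_m: "N_iso (Phi m) (K, A)"
    and Psi_m: "M_iso m (Psi J (K, A))" and Psi: "Psi J (K, A) \<in> M_class"
    using form_triple_preimage[OF n J] by blast
  show "Psi J (K, A) \<in> M_class" by (rule Psi)
  have "N_iso (Phi (Psi J (K, A))) (Phi m)"
    using M_iso_iff_N_iso[OF Psi m] M_iso_sym[OF m Psi_m] by blast
  then show "N_iso (Phi (Psi J (K, A))) (K, A)" using Phi_m N_iso_trans by blast
  have "(Phi m, (K, A)) \<in> N_rel" using Phi_in_N[OF m] Phi_m n by (auto simp: N_rel_def)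
  then have "Phi_class (M_rel `` {m}) = N_rel `` {(K, A)}"
    unfolding Phi_class_eq[OF m] by (rule equiv_class_eq[OF equiv_N])
  then have "inv_into (M_class // M_rel) Phi_class (N_rel `` {(K, A)}) = M_rel `` {m}"
    using m by (intro inv_into_f_eq Phi_class_inj quotientI)
  also have "\<dots> = {m' \<in> M_class. M_iso m' (Psi J (K, A))}"
  proof -
    have "M_iso m m' \<longleftrightarrow> M_iso m' (Psi J (K, A))" if m': "m' \<in> M_class" for m'
    proof
      show "M_iso m' (Psi J (K, A))" if "M_iso m m'"
        by (rule M_iso_trans[OF M_iso_sym[OF m that] Psi_m])
      show "M_iso m m'" if "M_iso m' (Psi J (K, A))"
        by (rule M_iso_trans[OF Psi_m M_iso_sym[OF m' that]])
    qed
    then show ?thesis using m by (auto simp: M_rel_def)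
  qed
  finally show "inv_into (M_class // M_rel) Phi_class (N_rel `` {(K, A)}) = {m \<in> M_class. M_iso m (Psi J (K, A))}" .
qed

lemma Psi_Phi:
  assumes m: "(H, D, t) \<in> M_class" and J: "fundamental_symmetry (form_domain H D t) J"
  shows "M_iso (Psi J (Phi (H, D, t))) (H, D, t)"
proof -
  have n: "(form_domain H D t, range_restriction H D t) \<in> N_class" using Phi_in_N[OF m] by (simp add: Phi.simps)
  show ?thesis
    using M_iso_iff_N_iso[OF Psi_properties(1)[OF n J] m] Psi_properties(2)[OF n J] by (simp add: Phi.simps)
qed

theorem theorem4p1:
  shows "equiv (M_class :: 'a form_triple set) M_rel \<and>
         equiv (N_class :: 'a krein_triple set) N_rel \<and>
         (\<forall>m \<in> (M_class :: 'a form_triple set). Phi m \<in> N_class) \<and>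
         (\<forall>m\<^sub>1 \<in> (M_class :: 'a form_triple set). \<forall>m\<^sub>2 \<in> (M_class :: 'b form_triple set).
            M_iso m\<^sub>1 m\<^sub>2 \<longleftrightarrow> N_iso (Phi m\<^sub>1) (Phi m\<^sub>2)) \<and>
         (\<forall>m \<in> (M_class :: 'a form_triple set). Phi_class (M_rel `` {m}) = N_rel `` {Phi m}) \<and>
         bij_betw Phi_class ((M_class :: 'a form_triple set) // M_rel) (N_class // N_rel) \<and>
         (\<forall>(K, A) \<in> (N_class :: 'a krein_triple set). \<forall>J. fundamental_symmetry K J \<longrightarrow>
            Psi J (K, A) \<in> M_class \<and>
            N_iso (Phi (Psi J (K, A))) (K, A) \<and>
            inv_into (M_class // M_rel) Phi_class (N_rel `` {(K, A)}) =
              {m \<in> M_class. M_iso m (Psi J (K, A))}) \<and>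
         (\<forall>(H, D, t) \<in> (M_class :: 'a form_triple set). \<forall>J.
            fundamental_symmetry (form_domain H D t) J \<longrightarrow>
            M_iso (Psi J (Phi (H, D, t))) (H, D, t))"
  by (intro conjI ballI equiv_M equiv_N Phi_class_bij;
      ((rule Phi_in_N M_iso_iff_N_iso Phi_class_eq; assumption) |
      (clarify, intro conjI Psi_properties Psi_Phi; assumption)))

end
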